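(* Let $\mathcal{C}$ be any Grothendieck category. Then the presheaf of commutative rings $Z_{\mathcal{C}}(\mathcal{L}) := Z(\mathcal{C}/\mathcal{L})$ is a sheaf on the site $\mathbf{L}^{st}(\mathcal{C})$ of stable localizing subcategories of $\mathcal{C}$, where the coverings of $\mathcal{L}$ are the finite families $\{\mathcal{L}_i\}_{1 \leq i \leq n}$ in $\mathbf{L}^{st}(\mathcal{C})$ with $\mathcal{L} = \bigcap_{i} \mathcal{L}_i$.
   Context: A Grothendieck category is an abelian category which has small coproducts, exact filtered colimits and a generator. A localizing subcategory of $\mathcal{C}$ is a full subcategory closed under subobjects, quotient objects, extensions and arbitrary direct sums; it is called stable if it is also closed under essential extensions. The localizing subcategories of $\mathcal{C}$ form a set. For localizing $\mathcal{L}_1,\mathcal{L}_2$, $\mathcal{L}_1 \vee \mathcal{L}_2$ denotes the smallest localizing subcategory containing both; if $\mathcal{L}_1,\mathcal{L}_2$ are stable then so are $\mathcal{L}_1\cap\mathcal{L}_2$ and $\mathcal{L}_1 \vee \mathcal{L}_2$. $\mathcal{C}/\mathcal{L}$ is the (Serre/Gabriel) quotient category. The center $Z(\mathcal{A})$ of an abelian category $\mathcal{A}$ is the endomorphism ring of the identity functor of $\mathcal{A}$; it is a commutative ring. For $\mathcal{L} \subseteq \mathcal{L}'$ the natural functor $\mathcal{C}/\mathcal{L} \to \mathcal{C}/\mathcal{L}'$ is a quotient functor and so induces a ring homomorphism $Z(\mathcal{C}/\mathcal{L}) \to Z(\mathcal{C}/\mathcal{L}')$. $\mathbf{L}^{st}(\mathcal{C})$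 is the set of all stable localizing subcategories of $\mathcal{C}$, viewed as a category with one morphism $\mathcal{L}_2 \to \mathcal{L}_1$ whenever $\mathcal{L}_1 \subseteq \mathcal{L}_2$. The fiber product of $\mathcal{L}_1 \to \mathcal{L} \leftarrow \mathcal{L}_2$ in it is $\mathcal{L}_1 \vee \mathcal{L}_2$. With the finite coverings described in the claim it is a Grothendieck site, and $\mathcal{L} \mapsto Z(\mathcal{C}/\mathcal{L})$ is a presheaf on it via the ring homomorphisms $Z(\mathcal{C}/\mathcal{L}) \to Z(\mathcal{C}/\mathcal{L}')$ induced, for stable localizing subcategories $\mathcal{L} \subseteq \mathcal{L}'$, by the quotient functors $\mathcal{C}/\mathcal{L} \to \mathcal{C}/\mathcal{L}'$. *)

theory Defs
  imports "HOL-Algebra.Ring" "HOL-Library.FuncSet"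
begin

unbundle cardinal_syntax

section \<open>Universes\<close>

text \<open>
  Sizes are measured against a Grothendieck universe, represented by a type \<open>'u\<close>: a set (over
  any type) is small if its cardinality is strictly below that of \<open>'u\<close>.  The conditions on \<open>'u\<close>
  say that its cardinality is uncountable, strong limit and regular.
\<close>

definition small :: "'u itself \<Rightarrow> 'a set \<Rightarrow> bool" where
  "small U A \<longleftrightarrow> |A| <o |UNIV :: 'u set|"

definition grothendieck_universe :: "'u itself \<Rightarrow> bool" where
  "grothendieck_universe U \<longleftrightarrow>
     small U (UNIV :: nat set) \<and>
     (\<forall>A :: 'u set. small U A \<longrightarrow> small U (Pow A)) \<and>
     (\<forall>(A :: 'u set) (F :: 'u \<Rightarrow> 'u set).
        small U A \<and> (\<forall>a\<in>A. small U (F a)) \<longrightarrow> small U (\<Union>a\<in>A. F a))"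

section \<open>Categories, functors, natural transformations\<close>

record ('o, 'm) cat =
  Obj :: "'o set"
  Arr :: "'m set"
  Dom :: "'m \<Rightarrow> 'o"
  Cod :: "'m \<Rightarrow> 'o"
  Ident :: "'o \<Rightarrow> 'm"
  Comp :: "'m \<Rightarrow> 'm \<Rightarrow> 'm" (infixr "\<cdot>\<index>" 70)

definition homset :: "('o, 'm, 'e) cat_scheme \<Rightarrow> 'o \<Rightarrow> 'o \<Rightarrow> 'm set" where
  "homset C X Y = {f \<in> Arr C. Dom C f = X \<and> Cod C f = Y}"

locale category =
  fixes C :: "('o, 'm, 'e) cat_scheme" (structure)
  assumes Dom_Obj: "f \<in> Arr C \<Longrightarrow> Dom C f \<in> Obj C"
    and Cod_Obj: "f \<in> Arr C \<Longrightarrow> Cod C f \<in> Obj C"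
    and Ident_hom: "X \<in> Obj C \<Longrightarrow> Ident C X \<in> homset C X X"
    and Comp_hom: "\<lbrakk>f \<in> homset C X Y; g \<in> homset C Y Z\<rbrakk> \<Longrightarrow> g \<cdot> f \<in> homset C X Z"
    and Comp_Ident: "f \<in> homset C X Y \<Longrightarrow> f \<cdot> Ident C X = f"
    and Ident_Comp: "f \<in> homset C X Y \<Longrightarrow> Ident C Y \<cdot> f = f"
    and Comp_assoc: "\<lbrakk>f \<in> homset C W X; g \<in> homset C X Y; h \<in> homset C Y Z\<rbrakk>
                      \<Longrightarrow> (h \<cdot> g) \<cdot> f = h \<cdot> (g \<cdot> f)"

definition is_functor ::
  "('i, 'k, 'e) cat_scheme \<Rightarrow> ('o, 'm, 'f) cat_scheme \<Rightarrow> ('i \<Rightarrow> 'o) \<Rightarrow> ('k \<Rightarrow> 'm) \<Rightarrow> bool" where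
  "is_functor J C Fo Fa \<longleftrightarrow>
     (\<forall>i\<in>Obj J. Fo i \<in> Obj C \<and> Fa (Ident J i) = Ident C (Fo i)) \<and>
     (\<forall>a\<in>Arr J. Fa a \<in> homset C (Fo (Dom J a)) (Fo (Cod J a))) \<and>
     (\<forall>a\<in>Arr J. \<forall>b\<in>Arr J. Cod J a = Dom J b \<longrightarrow> Fa (b \<cdot>\<^bsub>J\<^esub> a) = Fa b \<cdot>\<^bsub>C\<^esub> Fa a)"

definition nat_trans ::
  "('i, 'k, 'e) cat_scheme \<Rightarrow> ('o, 'm, 'f) cat_scheme \<Rightarrow> ('i \<Rightarrow> 'o) \<Rightarrow> ('k \<Rightarrow> 'm)
     \<Rightarrow> ('i \<Rightarrow> 'o) \<Rightarrow> ('k \<Rightarrow> 'm) \<Rightarrow> ('i \<Rightarrow> 'm) \<Rightarrow> bool" where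
  "nat_trans J C Fo Fa Go Ga \<eta> \<longleftrightarrow>
     (\<forall>i\<in>Obj J. \<eta> i \<in> homset C (Fo i) (Go i)) \<and>
     (\<forall>a\<in>Arr J. \<eta> (Cod J a) \<cdot>\<^bsub>C\<^esub> Fa a = Ga a \<cdot>\<^bsub>C\<^esub> \<eta> (Dom J a))"

definition is_coproduct ::
  "('o, 'm, 'e) cat_scheme \<Rightarrow> 'i set \<Rightarrow> ('i \<Rightarrow> 'o) \<Rightarrow> 'o \<Rightarrow> ('i \<Rightarrow> 'm) \<Rightarrow> bool" where
  "is_coproduct C I X S \<iota> \<longleftrightarrow>
     S \<in> Obj C \<and> (\<forall>i\<in>I. \<iota> i \<in> homset C (X i) S) \<and>
     (\<forall>Y\<in>Obj C. \<forall>f. (\<forall>i\<in>I. f i \<in> homset C (X i) Y) \<longrightarrow>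
        (\<exists>!h. h \<in> homset C S Y \<and> (\<forall>i\<in>I. h \<cdot>\<^bsub>C\<^esub> \<iota> i = f i)))"

definition is_cocone ::
  "('i, 'k, 'e) cat_scheme \<Rightarrow> ('o, 'm, 'f) cat_scheme \<Rightarrow> ('i \<Rightarrow> 'o) \<Rightarrow> ('k \<Rightarrow> 'm)
     \<Rightarrow> 'o \<Rightarrow> ('i \<Rightarrow> 'm) \<Rightarrow> bool" where
  "is_cocone J C Fo Fa X l \<longleftrightarrow>
     X \<in> Obj C \<and> (\<forall>i\<in>Obj J. l i \<in> homset C (Fo i) X) \<and>
     (\<forall>a\<in>Arr J. l (Cod J a) \<cdot>\<^bsub>C\<^esub> Fa a = l (Dom J a))"

definition is_colimit ::
  "('i, 'k, 'e) cat_scheme \<Rightarrow> ('o, 'm, 'f) cat_scheme \<Rightarrow> ('i \<Rightarrow> 'o) \<Rightarrow> ('k \<Rightarrow> 'm)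
     \<Rightarrow> 'o \<Rightarrow> ('i \<Rightarrow> 'm) \<Rightarrow> bool" where
  "is_colimit J C Fo Fa X l \<longleftrightarrow>
     is_cocone J C Fo Fa X l \<and>
     (\<forall>Y m. is_cocone J C Fo Fa Y m \<longrightarrow>
        (\<exists>!h. h \<in> homset C X Y \<and> (\<forall>i\<in>Obj J. h \<cdot>\<^bsub>C\<^esub> l i = m i)))"

definition filtered :: "('i, 'k, 'e) cat_scheme \<Rightarrow> bool" where
  "filtered J \<longleftrightarrow>
     category J \<and> Obj J \<noteq> {} \<and>
     (\<forall>i\<in>Obj J. \<forall>j\<in>Obj J. \<exists>k\<in>Obj J. homset J i k \<noteq> {} \<and> homset J j k \<noteq> {}) \<and>
     (\<forall>i\<in>Obj J. \<forall>j\<in>Obj J. \<forall>a\<in>homset J i j. \<forall>b\<in>homset J i j.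
        \<exists>k\<in>Obj J. \<exists>c\<in>homset J j k. c \<cdot>\<^bsub>J\<^esub> a = c \<cdot>\<^bsub>J\<^esub> b)"

definition is_mono :: "('o, 'm, 'e) cat_scheme \<Rightarrow> 'm \<Rightarrow> bool" where
  "is_mono C f \<longleftrightarrow> f \<in> Arr C \<and>
     (\<forall>W\<in>Obj C. \<forall>g\<in>homset C W (Dom C f). \<forall>h\<in>homset C W (Dom C f).
        f \<cdot>\<^bsub>C\<^esub> g = f \<cdot>\<^bsub>C\<^esub> h \<longrightarrow> g = h)"

definition is_epi :: "('o, 'm, 'e) cat_scheme \<Rightarrow> 'm \<Rightarrow> bool" where
  "is_epi C f \<longleftrightarrow> f \<in> Arr C \<and>
     (\<forall>W\<in>Obj C. \<forall>g\<in>homset C (Cod C f) W. \<forall>h\<in>homset C (Cod C f) W.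
        g \<cdot>\<^bsub>C\<^esub> f = h \<cdot>\<^bsub>C\<^esub> f \<longrightarrow> g = h)"

definition is_zero_obj :: "('o, 'm, 'e) cat_scheme \<Rightarrow> 'o \<Rightarrow> bool" where
  "is_zero_obj C N \<longleftrightarrow> N \<in> Obj C \<and>
     (\<forall>X\<in>Obj C. (\<exists>!f. f \<in> homset C N X) \<and> (\<exists>!f. f \<in> homset C X N))"

section \<open>Abelian and Grothendieck categories\<close>

record ('o, 'm) addcat = "('o, 'm) cat" +
  Plus :: "'m \<Rightarrow> 'm \<Rightarrow> 'm"
  Zero :: "'o \<Rightarrow> 'o \<Rightarrow> 'm"

locale preadditive_category = category C
  for C :: "('o, 'm, 'e) addcat_scheme" (structure) +
  assumes hom_group: "\<lbrakk>X \<in> Obj C; Y \<in> Obj C\<rbrakk> \<Longrightarrow>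
      comm_group \<lparr>carrier = homset C X Y, mult = Plus C, one = Zero C X Y\<rparr>"
    and Comp_Plus: "\<lbrakk>f \<in> homset C X Y; f' \<in> homset C X Y; g \<in> homset C Y Z\<rbrakk> \<Longrightarrow>
      g \<cdot> Plus C f f' = Plus C (g \<cdot> f) (g \<cdot> f')"
    and Plus_Comp: "\<lbrakk>f \<in> homset C X Y; g \<in> homset C Y Z; g' \<in> homset C Y Z\<rbrakk> \<Longrightarrow>
      Plus C g g' \<cdot> f = Plus C (g \<cdot> f) (g' \<cdot> f)"

definition is_kernel :: "('o, 'm, 'e) addcat_scheme \<Rightarrow> 'm \<Rightarrow> 'm \<Rightarrow> bool" where
  "is_kernel C k f \<longleftrightarrow>
     k \<in> Arr C \<and> f \<in> Arr C \<and> Cod C k = Dom C f \<and> f \<cdot>\<^bsub>C\<^esub> k = Zero C (Dom C k) (Cod C f) \<and>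
     (\<forall>W\<in>Obj C. \<forall>g\<in>homset C W (Dom C f). f \<cdot>\<^bsub>C\<^esub> g = Zero C W (Cod C f) \<longrightarrow>
        (\<exists>!h. h \<in> homset C W (Dom C k) \<and> k \<cdot>\<^bsub>C\<^esub> h = g))"

definition is_cokernel :: "('o, 'm, 'e) addcat_scheme \<Rightarrow> 'm \<Rightarrow> 'm \<Rightarrow> bool" where
  "is_cokernel C p f \<longleftrightarrow>
     p \<in> Arr C \<and> f \<in> Arr C \<and> Dom C p = Cod C f \<and> p \<cdot>\<^bsub>C\<^esub> f = Zero C (Dom C f) (Cod C p) \<and>
     (\<forall>W\<in>Obj C. \<forall>g\<in>homset C (Cod C f) W. g \<cdot>\<^bsub>C\<^esub> f = Zero C (Dom C f) W \<longrightarrow>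
        (\<exists>!h. h \<in> homset C (Cod C p) W \<and> h \<cdot>\<^bsub>C\<^esub> p = g))"

definition is_biproduct ::
  "('o, 'm, 'e) addcat_scheme \<Rightarrow> 'o \<Rightarrow> 'o \<Rightarrow> 'o \<Rightarrow> 'm \<Rightarrow> 'm \<Rightarrow> 'm \<Rightarrow> 'm \<Rightarrow> bool" where
  "is_biproduct C X Y S i j p q \<longleftrightarrow>
     S \<in> Obj C \<and> i \<in> homset C X S \<and> j \<in> homset C Y S \<and> p \<in> homset C S X \<and> q \<in> homset C S Y \<and>
     p \<cdot>\<^bsub>C\<^esub> i = Ident C X \<and> q \<cdot>\<^bsub>C\<^esub> j = Ident C Y \<and>
     p \<cdot>\<^bsub>C\<^esub> j = Zero C Y X \<and> q \<cdot>\<^bsub>C\<^esub> i = Zero C X Y \<and>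
     Plus C (i \<cdot>\<^bsub>C\<^esub> p) (j \<cdot>\<^bsub>C\<^esub> q) = Ident C S"

locale abelian_category = preadditive_category C
  for C :: "('o, 'm, 'e) addcat_scheme" (structure) +
  assumes ex_zero: "\<exists>N. is_zero_obj C N"
    and ex_biproduct: "\<lbrakk>X \<in> Obj C; Y \<in> Obj C\<rbrakk> \<Longrightarrow> \<exists>S i j p q. is_biproduct C X Y S i j p q"
    and ex_kernel: "f \<in> Arr C \<Longrightarrow> \<exists>k. is_kernel C k f"
    and ex_cokernel: "f \<in> Arr C \<Longrightarrow> \<exists>p. is_cokernel C p f"
    and mono_normal: "is_mono C f \<Longrightarrow> \<exists>g. is_kernel C f g"
    and epi_normal: "is_epi C f \<Longrightarrow> \<exists>g. is_cokernel C f g"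

definition short_exact :: "('o, 'm, 'e) addcat_scheme \<Rightarrow> 'm \<Rightarrow> 'm \<Rightarrow> bool" where
  "short_exact C i p \<longleftrightarrow> is_kernel C i p \<and> is_cokernel C p i"

definition is_generator :: "('o, 'm, 'e) cat_scheme \<Rightarrow> 'o \<Rightarrow> bool" where
  "is_generator C G \<longleftrightarrow> G \<in> Obj C \<and>
     (\<forall>X\<in>Obj C. \<forall>Y\<in>Obj C. \<forall>f\<in>homset C X Y. \<forall>g\<in>homset C X Y.
        f \<noteq> g \<longrightarrow> (\<exists>h\<in>homset C G X. f \<cdot>\<^bsub>C\<^esub> h \<noteq> g \<cdot>\<^bsub>C\<^esub> h))"

text \<open>
  Every small set is in bijection with a small set of elements of \<open>'u\<close>, so it suffices to index
  small coproducts and small diagrams by the latter.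
\<close>

locale grothendieck_category = abelian_category C
  for U :: "'u itself" and C :: "('o, 'm, 'e) addcat_scheme" (structure) +
  assumes locally_small: "\<lbrakk>X \<in> Obj C; Y \<in> Obj C\<rbrakk> \<Longrightarrow> small U (homset C X Y)"
    and small_coproducts: "\<And>(I :: 'u set) X. \<lbrakk>small U I; X \<in> I \<rightarrow> Obj C\<rbrakk> \<Longrightarrow>
      \<exists>S \<iota>. is_coproduct C I X S \<iota>"
    and filtered_colimits: "\<And>(J :: ('u, 'u) cat) Fo Fa.
      \<lbrakk>filtered J; small U (Obj J); small U (Arr J); is_functor J C Fo Fa\<rbrakk> \<Longrightarrow>
      \<exists>X l. is_colimit J C Fo Fa X l"
    and filtered_colimits_exact: "\<And>(J :: ('u, 'u) cat) Fo Fa Go Ga Ho Ha \<alpha> \<beta> X l Y m Z n a b.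
      \<lbrakk>filtered J; small U (Obj J); small U (Arr J);
       is_functor J C Fo Fa; is_functor J C Go Ga; is_functor J C Ho Ha;
       nat_trans J C Fo Fa Go Ga \<alpha>; nat_trans J C Go Ga Ho Ha \<beta>;
       \<And>i. i \<in> Obj J \<Longrightarrow> short_exact C (\<alpha> i) (\<beta> i);
       is_colimit J C Fo Fa X l; is_colimit J C Go Ga Y m; is_colimit J C Ho Ha Z n;
       a \<in> homset C X Y; \<And>i. i \<in> Obj J \<Longrightarrow> a \<cdot> l i = m i \<cdot> \<alpha> i;
       b \<in> homset C Y Z; \<And>i. i \<in> Obj J \<Longrightarrow> b \<cdot> m i = n i \<cdot> \<beta> i\<rbrakk> \<Longrightarrow>
      short_exact C a b"
    and ex_generator: "\<exists>G. is_generator C G"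

section \<open>Localizing subcategories\<close>

text \<open>Full subcategories are represented by their sets of objects.\<close>

definition localizing :: "'u itself \<Rightarrow> ('o, 'm, 'e) addcat_scheme \<Rightarrow> 'o set \<Rightarrow> bool" where
  "localizing U C L \<longleftrightarrow>
     L \<subseteq> Obj C \<and>
     (\<forall>i. is_mono C i \<and> Cod C i \<in> L \<longrightarrow> Dom C i \<in> L) \<and>
     (\<forall>p. is_epi C p \<and> Dom C p \<in> L \<longrightarrow> Cod C p \<in> L) \<and>
     (\<forall>i p. short_exact C i p \<and> Dom C i \<in> L \<and> Cod C p \<in> L \<longrightarrow> Cod C i \<in> L) \<and>
     (\<forall>(I :: 'u set) X S \<iota>. small U I \<and> X \<in> I \<rightarrow> L \<and> is_coproduct C I X S \<iota> \<longrightarrow> S \<in> L)"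

text \<open>
  A monomorphism into \<open>Y\<close> is essential if its image meets every nonzero subobject \<open>j\<close> of \<open>Y\<close>
  nontrivially, that is, if some nonzero object is a subobject of both.
\<close>

definition is_essential :: "('o, 'm, 'e) cat_scheme \<Rightarrow> 'm \<Rightarrow> bool" where
  "is_essential C i \<longleftrightarrow> is_mono C i \<and>
     (\<forall>j. is_mono C j \<and> Cod C j = Cod C i \<and> \<not> is_zero_obj C (Dom C j) \<longrightarrow>
        (\<exists>W a b. W \<in> Obj C \<and> \<not> is_zero_obj C W \<and> is_mono C a \<and> is_mono C b \<and>
           a \<in> homset C W (Dom C i) \<and> b \<in> homset C W (Dom C j) \<and>
           i \<cdot>\<^bsub>C\<^esub> a = j \<cdot>\<^bsub>C\<^esub> b))"

definition stable_localizing :: "'u itself \<Rightarrow> ('o, 'm, 'e) addcat_scheme \<Rightarrow> 'o set set" where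
  "stable_localizing U C =
     {L. localizing U C L \<and> (\<forall>i. is_essential C i \<and> Dom C i \<in> L \<longrightarrow> Cod C i \<in> L)}"

definition localizing_join ::
  "'u itself \<Rightarrow> ('o, 'm, 'e) addcat_scheme \<Rightarrow> 'o set \<Rightarrow> 'o set \<Rightarrow> 'o set" where
  "localizing_join U C L1 L2 = \<Inter>{M. localizing U C M \<and> L1 \<subseteq> M \<and> L2 \<subseteq> M}"

section \<open>The quotient category\<close>

text \<open>
  \<open>C / L\<close> is the localization of \<open>C\<close> at the arrows whose kernel and cokernel lie in \<open>L\<close>, formed
  by right fractions.  A roof \<open>(s, f)\<close> from \<open>X\<close> to \<open>Y\<close> is a diagram \<open>X \<leftarrow> W \<rightarrow> Y\<close> whose left leg \<open>s\<close>
  is to be inverted; it stands for \<open>f s\<^sup>-\<^sup>1\<close>.  An arrow of \<open>C / L\<close> is a triple of its domain, its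
  codomain and a class of roofs.
\<close>

definition L_isos :: "('o, 'm, 'e) addcat_scheme \<Rightarrow> 'o set \<Rightarrow> 'm set" where
  "L_isos C L = {s \<in> Arr C.
     (\<exists>k. is_kernel C k s \<and> Dom C k \<in> L) \<and> (\<exists>p. is_cokernel C p s \<and> Cod C p \<in> L)}"

definition roofs :: "('o, 'm, 'e) addcat_scheme \<Rightarrow> 'o set \<Rightarrow> 'o \<Rightarrow> 'o \<Rightarrow> ('m \<times> 'm) set" where
  "roofs C L X Y = {(s, f). s \<in> L_isos C L \<and> Cod C s = X \<and> f \<in> homset C (Dom C s) Y}"

definition roof_eq ::
  "('o, 'm, 'e) addcat_scheme \<Rightarrow> 'o set \<Rightarrow> 'm \<times> 'm \<Rightarrow> 'm \<times> 'm \<Rightarrow> bool" where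
  "roof_eq C L = (\<lambda>(s, f) (t, g).
     \<exists>W u v. u \<in> homset C W (Dom C s) \<and> v \<in> homset C W (Dom C t) \<and>
       s \<cdot>\<^bsub>C\<^esub> u = t \<cdot>\<^bsub>C\<^esub> v \<and> s \<cdot>\<^bsub>C\<^esub> u \<in> L_isos C L \<and> f \<cdot>\<^bsub>C\<^esub> u = g \<cdot>\<^bsub>C\<^esub> v)"

definition roof_class ::
  "('o, 'm, 'e) addcat_scheme \<Rightarrow> 'o set \<Rightarrow> 'o \<Rightarrow> 'o \<Rightarrow> 'm \<times> 'm \<Rightarrow> ('m \<times> 'm) set" where
  "roof_class C L X Y r = {r' \<in> roofs C L X Y. roof_eq C L r r'}"

text \<open>
  Composition uses the Ore condition to complete \<open>f\<close> and \<open>t\<close> to a square \<open>f u = t v\<close>, giving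
  \<open>(g t\<^sup>-\<^sup>1) (f s\<^sup>-\<^sup>1) = (g v) (s u)\<^sup>-\<^sup>1\<close>; addition uses a common denominator.  The operations collect
  the results over all choices of representatives, which all lie in a single class.
\<close>

definition quotient_category ::
  "('o, 'm) addcat \<Rightarrow> 'o set \<Rightarrow> ('o, 'o \<times> 'o \<times> ('m \<times> 'm) set) addcat" where
  "quotient_category C L = \<lparr>
     Obj = Obj C,
     Arr = {(X, Y, roof_class C L X Y r) | X Y r. X \<in> Obj C \<and> Y \<in> Obj C \<and> r \<in> roofs C L X Y},
     Dom = (\<lambda>(X, Y, A). X),
     Cod = (\<lambda>(X, Y, A). Y),
     Ident = (\<lambda>X. (X, X, roof_class C L X X (Ident C X, Ident C X))),
     Comp = (\<lambda>(Y, Z, B) (X, Y', A). (X, Z,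
       \<Union>{roof_class C L X Z (s \<cdot>\<^bsub>C\<^esub> u, g \<cdot>\<^bsub>C\<^esub> v) | s f t g u v.
          (s, f) \<in> A \<and> (t, g) \<in> B \<and> u \<in> L_isos C L \<and> Cod C u = Dom C f \<and>
          v \<in> homset C (Dom C u) (Dom C t) \<and> f \<cdot>\<^bsub>C\<^esub> u = t \<cdot>\<^bsub>C\<^esub> v})),
     Plus = (\<lambda>(X, Y, A) (X', Y', B). (X, Y,
       \<Union>{roof_class C L X Y (s, Plus C f g) | s f g. (s, f) \<in> A \<and> (s, g) \<in> B})),
     Zero = (\<lambda>X Y. (X, Y, roof_class C L X Y (Ident C X, Zero C X Y)))\<rparr>"

text \<open>The arrow part of the natural functor \<open>C / L \<rightarrow> C / L'\<close>, which is the identity on objects.\<close>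

definition quotient_functor ::
  "('o, 'm) addcat \<Rightarrow> 'o set \<Rightarrow> 'o set
     \<Rightarrow> 'o \<times> 'o \<times> ('m \<times> 'm) set \<Rightarrow> 'o \<times> 'o \<times> ('m \<times> 'm) set" where
  "quotient_functor C L L' = (\<lambda>(X, Y, A). (X, Y, \<Union>r\<in>A. roof_class C L' X Y r))"

section \<open>The center\<close>

definition center :: "('o, 'm, 'e) addcat_scheme \<Rightarrow> ('o \<Rightarrow> 'm) ring" where
  "center A = \<lparr>
     carrier = {z \<in> extensional (Obj A). nat_trans A A (\<lambda>X. X) (\<lambda>f. f) (\<lambda>X. X) (\<lambda>f. f) z},
     mult = (\<lambda>z w. \<lambda>X\<in>Obj A. z X \<cdot>\<^bsub>A\<^esub> w X),
     one = (\<lambda>X\<in>Obj A. Ident A X),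
     zero = (\<lambda>X\<in>Obj A. Zero A X X),
     add = (\<lambda>z w. \<lambda>X\<in>Obj A. Plus A (z X) (w X))\<rparr>"

definition center_restrict ::
  "('o, 'm) addcat \<Rightarrow> 'o set \<Rightarrow> 'o set
     \<Rightarrow> ('o \<Rightarrow> 'o \<times> 'o \<times> ('m \<times> 'm) set) \<Rightarrow> ('o \<Rightarrow> 'o \<times> 'o \<times> ('m \<times> 'm) set)" where
  "center_restrict C L L' z = (\<lambda>X\<in>Obj C. quotient_functor C L L' (z X))"

section \<open>Sheaves of commutative rings on a thin site\<close>

text \<open>
  The underlying category has object set \<open>S\<close> and a single morphism \<open>M \<rightarrow> L\<close> when \<open>below M L\<close>; the
  restriction along it is \<open>res L M\<close>.  \<open>cov L n Ls\<close> says that \<open>Ls 1, \<dots>, Ls n\<close> cover \<open>L\<close>, and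
  \<open>fib L1 L2\<close> is the fiber product of \<open>L1\<close> and \<open>L2\<close> over any object they both map to.
\<close>

definition presheaf_of_comm_rings ::
  "'l set \<Rightarrow> ('l \<Rightarrow> 'l \<Rightarrow> bool) \<Rightarrow> ('l \<Rightarrow> 'r ring) \<Rightarrow> ('l \<Rightarrow> 'l \<Rightarrow> 'r \<Rightarrow> 'r) \<Rightarrow> bool" where
  "presheaf_of_comm_rings S below R res \<longleftrightarrow>
     (\<forall>L\<in>S. cring (R L)) \<and>
     (\<forall>L\<in>S. \<forall>M\<in>S. below M L \<longrightarrow> res L M \<in> ring_hom (R L) (R M)) \<and>
     (\<forall>L\<in>S. \<forall>x\<in>carrier (R L). res L L x = x) \<and>
     (\<forall>L\<in>S. \<forall>M\<in>S. \<forall>N\<in>S. below M L \<and> below N M \<longrightarrow>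
        (\<forall>x\<in>carrier (R L). res M N (res L M x) = res L N x))"

definition sheaf_of_comm_rings ::
  "'l set \<Rightarrow> ('l \<Rightarrow> 'l \<Rightarrow> bool) \<Rightarrow> ('l \<Rightarrow> nat \<Rightarrow> (nat \<Rightarrow> 'l) \<Rightarrow> bool) \<Rightarrow> ('l \<Rightarrow> 'l \<Rightarrow> 'l)
     \<Rightarrow> ('l \<Rightarrow> 'r ring) \<Rightarrow> ('l \<Rightarrow> 'l \<Rightarrow> 'r \<Rightarrow> 'r) \<Rightarrow> bool" where
  "sheaf_of_comm_rings S below cov fib R res \<longleftrightarrow>
     presheaf_of_comm_rings S below R res \<and>
     (\<forall>L\<in>S. \<forall>n Ls. cov L n Ls \<longrightarrow>
        (\<forall>x. (\<forall>i\<in>{1..n}. x i \<in> carrier (R (Ls i))) \<and>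
             (\<forall>i\<in>{1..n}. \<forall>j\<in>{1..n}.
                res (Ls i) (fib (Ls i) (Ls j)) (x i) = res (Ls j) (fib (Ls i) (Ls j)) (x j)) \<longrightarrow>
             (\<exists>!y. y \<in> carrier (R L) \<and> (\<forall>i\<in>{1..n}. res L (Ls i) y = x i))))"

text \<open>The empty family (\<open>n = 0\<close>) has intersection \<open>C\<close>.\<close>

definition stable_covering ::
  "'u itself \<Rightarrow> ('o, 'm, 'e) addcat_scheme \<Rightarrow> 'o set \<Rightarrow> nat \<Rightarrow> (nat \<Rightarrow> 'o set) \<Rightarrow> bool" where
  "stable_covering U C L n Ls \<longleftrightarrow>
     (\<forall>i\<in>{1..n}. Ls i \<in> stable_localizing U C) \<and> L = Obj C \<inter> (\<Inter>i\<in>{1..n}. Ls i)"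

end

theory Submission
  imports Defs
begin

text \<open>
  The sheaf property already holds for the sets of arrows \<open>X \<rightarrow> Y\<close> of \<open>C / L\<close>.  For \<open>L = \<Inter> L\<^sub>i\<close> the
  functor \<open>C / L \<rightarrow> \<Prod> C / L\<^sub>i\<close> is faithful, since \<open>f\<close> becomes zero in \<open>C / L\<close> iff its image lies in \<open>L\<close>;
  this gives uniqueness, and it makes a family glued from central elements natural.

  For the existence, stability of \<open>L\<close> enters as follows: by Zorn's lemma and exactness of filtered
  colimits every subobject \<open>A \<le> X\<close> has a complement \<open>K \<le> X\<close>, maximal with \<open>K \<inter> A = 0\<close>; then
  \<open>A \<rightarrow> X / K\<close> is essential, so that \<open>A \<in> L\<close> implies \<open>X / K \<in> L\<close>.  Hence the denominators in \<open>C / L\<close> can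
  be taken to be monic, the objects of \<open>L\<^sub>1 \<or> L\<^sub>2\<close> are the extensions of objects of \<open>L\<^sub>2\<close> by objects of \<open>L\<^sub>1\<close>,
  and two fractions over \<open>W\<^sub>1, W\<^sub>2 \<le> X\<close> that agree modulo \<open>L\<^sub>1 \<or> L\<^sub>2\<close> agree on \<open>W\<^sub>1 \<inter> W\<^sub>2\<close> after shrinking
  \<open>W\<^sub>1\<close> and \<open>W\<^sub>2\<close>.  They then define an arrow on \<open>W\<^sub>1 + W\<^sub>2\<close>, and \<open>X / (W\<^sub>1 + W\<^sub>2) \<in> L\<^sub>1 \<inter> L\<^sub>2\<close>.  Longer coverings
  follow by induction from \<open>(L\<^sub>1 \<or> M) \<inter> (L\<^sub>2 \<or> M) \<subseteq> (L\<^sub>1 \<inter> L\<^sub>2) \<or> M\<close>.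
\<close>

section \<open>Abelian categories\<close>

text \<open>The obstacle is that agreement modulo \<open>L1 \<or> L2\<close> is of mixed kind: the
  image of the difference is built from a piece in \<open>L1\<close> and a piece in
  \<open>L2\<close>, while the first fraction may be shrunk only with cokernel in \<open>L1\<close>
  and the second only with cokernel in \<open>L2\<close>. Each piece must be removed on its own
  side, by shrinking inside \<open>X\<close> although the difference lives only on the intersection
  of the two domains. Fixing the order of the pieces in \<open>ext_class\<close> makes two
  shrinkings suffice; stability allows layers to be reordered. For longer coverings, a partial
  gluing is known to agree with the next arrow only modulo each single join with \<open>M\<close>,
  hence modulo their intersection; the distributive inclusion turns this into agreement modulo one
  join. These auxiliary subcategories are shown to be localizing only, so quotients are built for
  Serre subcategories. For the class of zero objects the same calculus yields ordinary exactness.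
  Element chasing is replaced by testing on arrows with zero composite; modulo \<open>L\<close>,
  \<open>null\<close> plays the role of zero.\<close>

context category
begin

lemma in_hom:
  "f \<in> homset C X Y \<longleftrightarrow> f \<in> Arr C \<and> Dom C f = X \<and> Cod C f = Y \<and> X \<in> Obj C \<and> Y \<in> Obj C"
  using Dom_Obj Cod_Obj by (auto simp: homset_def)

lemma obj_dom_cod [simp]: "f \<in> Arr C \<Longrightarrow> Dom C f \<in> Obj C" "f \<in> Arr C \<Longrightarrow> Cod C f \<in> Obj C"
  by (simp_all add: Dom_Obj Cod_Obj)

lemma arr_ident [simp]:
  assumes "X \<in> Obj C"
  shows "Ident C X \<in> Arr C" "Dom C (Ident C X) = X" "Cod C (Ident C X) = X"
  using Ident_hom[OF assms] by (simp_all add: in_hom)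

lemma arr_comp [simp]:
  assumes "f \<in> Arr C" "g \<in> Arr C" "Cod C f = Dom C g"
  shows "g \<cdot> f \<in> Arr C" "Dom C (g \<cdot> f) = Dom C f" "Cod C (g \<cdot> f) = Cod C g"
  using Comp_hom[of f "Dom C f" "Dom C g" g "Cod C g"] assms by (simp_all add: in_hom)

lemma comp_assoc [simp]:
  assumes "f \<in> Arr C" "g \<in> Arr C" "h \<in> Arr C" "Cod C f = Dom C g" "Cod C g = Dom C h"
  shows "(h \<cdot> g) \<cdot> f = h \<cdot> (g \<cdot> f)"
  using Comp_assoc[of f "Dom C f" "Dom C g" g "Dom C h" h "Cod C h"] assms by (simp add: in_hom)

lemma comp_ident [simp]:
  "f \<in> Arr C \<Longrightarrow> Dom C f = X \<Longrightarrow> f \<cdot> Ident C X = f"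
  "f \<in> Arr C \<Longrightarrow> Cod C f = X \<Longrightarrow> Ident C X \<cdot> f = f"
  using Comp_Ident[of f X "Cod C f"] Ident_Comp[of f "Dom C f" X] by (auto simp: in_hom)

text \<open>The simplifier brackets composites to the right, so \<open>f \<cdot> u\<close> is no
  subterm of \<open>f \<cdot> (u \<cdot> x)\<close>; this lemma and \<open>comp_rw\<close> apply an
  equation of composites in front of a tail \<open>x\<close>.\<close>

lemma comp_reassoc:
  assumes "f \<cdot> u = g \<cdot> v" "f \<in> Arr C" "u \<in> Arr C" "g \<in> Arr C" "v \<in> Arr C" "x \<in> Arr C"
    "Cod C u = Dom C f" "Cod C v = Dom C g" "Cod C x = Dom C u" "Dom C v = Dom C u"
  shows "f \<cdot> (u \<cdot> x) = g \<cdot> (v \<cdot> x)"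
  using assms by (simp flip: comp_assoc)

lemma comp_rw:
  assumes "g \<cdot> f = e" "f \<in> Arr C" "g \<in> Arr C" "x \<in> Arr C" "Cod C f = Dom C g" "Cod C x = Dom C f"
  shows "g \<cdot> (f \<cdot> x) = e \<cdot> x"
  using assms by (simp flip: comp_assoc)

lemma monoD:
  assumes "is_mono C f" "f \<cdot> g = f \<cdot> h" "g \<in> Arr C" "h \<in> Arr C" "Dom C g = Dom C h"
    "Cod C g = Dom C f" "Cod C h = Dom C f"
  shows "g = h"
proof -
  have "g \<in> homset C (Dom C h) (Dom C f)" "h \<in> homset C (Dom C h) (Dom C f)"
    using assms Dom_Obj Cod_Obj by (auto simp: homset_def)
  then show ?thesis using assms(1,2,4) Dom_Obj unfolding is_mono_def by blast
qed

lemma epiD: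
  assumes "is_epi C f" "g \<cdot> f = h \<cdot> f" "g \<in> Arr C" "h \<in> Arr C" "Cod C g = Cod C h"
    "Dom C g = Cod C f" "Dom C h = Cod C f"
  shows "g = h"
proof -
  have "g \<in> homset C (Cod C f) (Cod C h)" "h \<in> homset C (Cod C f) (Cod C h)"
    using assms Dom_Obj Cod_Obj by (auto simp: homset_def)
  then show ?thesis using assms(1,2,4) Cod_Obj unfolding is_epi_def by blast
qed

lemma mono_arr [simp]: "is_mono C f \<Longrightarrow> f \<in> Arr C"
  unfolding is_mono_def by blast

lemma epi_arr [simp]: "is_epi C f \<Longrightarrow> f \<in> Arr C"
  unfolding is_epi_def by blast

lemma mono_ident [simp]: "X \<in> Obj C \<Longrightarrow> is_mono C (Ident C X)"
  unfolding is_mono_def by (auto simp: in_hom)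

lemma epi_ident [simp]: "X \<in> Obj C \<Longrightarrow> is_epi C (Ident C X)"
  unfolding is_epi_def by (auto simp: in_hom)

lemma mono_comp:
  assumes "is_mono C f" "is_mono C g" "Cod C f = Dom C g"
  shows "is_mono C (g \<cdot> f)"
  unfolding is_mono_def
proof (intro conjI ballI impI)
  show "g \<cdot> f \<in> Arr C" using assms by simp
  fix W a b assume W: "W \<in> Obj C" and a: "a \<in> homset C W (Dom C (g \<cdot> f))"
    and b: "b \<in> homset C W (Dom C (g \<cdot> f))" and eq: "(g \<cdot> f) \<cdot> a = (g \<cdot> f) \<cdot> b"
  have "g \<cdot> (f \<cdot> a) = g \<cdot> (f \<cdot> b)" using eq a b assms by (simp add: in_hom)
  then have "f \<cdot> a = f \<cdot> b" by (rule monoD[OF assms(2)]) (use a b assms in \<open>simp_all add: in_hom\<close>)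
  then show "a = b" by (rule monoD[OF assms(1)]) (use a b assms in \<open>simp_all add: in_hom\<close>)
qed

lemma epi_comp:
  assumes "is_epi C f" "is_epi C g" "Cod C f = Dom C g"
  shows "is_epi C (g \<cdot> f)"
  unfolding is_epi_def
proof (intro conjI ballI impI)
  show "g \<cdot> f \<in> Arr C" using assms by simp
  fix W a b assume W: "W \<in> Obj C" and a: "a \<in> homset C (Cod C (g \<cdot> f)) W"
    and b: "b \<in> homset C (Cod C (g \<cdot> f)) W" and eq: "a \<cdot> (g \<cdot> f) = b \<cdot> (g \<cdot> f)"
  have "(a \<cdot> g) \<cdot> f = (b \<cdot> g) \<cdot> f" using eq a b assms by (simp add: in_hom)
  then have "a \<cdot> g = b \<cdot> g" by (rule epiD[OF assms(1)]) (use a b assms in \<open>simp_all add: in_hom\<close>)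
  then show "a = b" by (rule epiD[OF assms(2)]) (use a b assms in \<open>simp_all add: in_hom\<close>)
qed

lemma epi_cancel:
  assumes "is_epi C (g \<cdot> f)" "f \<in> Arr C" "g \<in> Arr C" "Cod C f = Dom C g"
  shows "is_epi C g"
  unfolding is_epi_def
proof (intro conjI ballI impI)
  fix W a b assume W: "W \<in> Obj C" and a: "a \<in> homset C (Cod C g) W"
    and b: "b \<in> homset C (Cod C g) W" and eq: "a \<cdot> g = b \<cdot> g"
  have "a \<cdot> (g \<cdot> f) = b \<cdot> (g \<cdot> f)" 
    by (rule comp_reassoc[OF eq]) (use assms a b in \<open>simp_all add: in_hom\<close>)
  then show "a = b" by (rule epiD[OF assms(1)]) (use a b assms in \<open>simp_all add: in_hom\<close>)
qed (use assms in simp)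

lemma mono_cancel:
  assumes "is_mono C (g \<cdot> f)" "f \<in> Arr C" "g \<in> Arr C" "Cod C f = Dom C g"
  shows "is_mono C f"
  unfolding is_mono_def
proof (intro conjI ballI impI)
  fix W a b assume W: "W \<in> Obj C" and a: "a \<in> homset C W (Dom C f)"
    and b: "b \<in> homset C W (Dom C f)" and eq: "f \<cdot> a = f \<cdot> b"
  then have "(g \<cdot> f) \<cdot> a = (g \<cdot> f) \<cdot> b" using assms by (simp add: in_hom)
  then show "a = b" by (rule monoD[OF assms(1)]) (use a b assms in \<open>simp_all add: in_hom\<close>)
qed (use assms in simp)

end

section \<open>Additive structure: zero arrows, differences, kernels, cokernels, pullbacks\<close>

context preadditive_category
begin

abbreviation hom_grp :: "'o \<Rightarrow> 'o \<Rightarrow> 'm monoid" where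
  "hom_grp X Y \<equiv> \<lparr>carrier = homset C X Y, mult = Plus C, one = Zero C X Y\<rparr>"

definition neg :: "'m \<Rightarrow> 'm" where
  "neg f = inv\<^bsub>hom_grp (Dom C f) (Cod C f)\<^esub> f"

definition diff :: "'m \<Rightarrow> 'm \<Rightarrow> 'm" where
  "diff f g = Plus C f (neg g)"

text \<open>A predicate instead of an equation with \<open>Zero C X Y\<close>, so that the ends need
  not be tracked; \<open>null\<close> is its analogue modulo a subcategory.\<close>

definition zarr :: "'m \<Rightarrow> bool" where
  "zarr f \<longleftrightarrow> f \<in> Arr C \<and> f = Zero C (Dom C f) (Cod C f)"

lemma zero_arr [simp]:
  assumes "X \<in> Obj C" "Y \<in> Obj C"
  shows "Zero C X Y \<in> Arr C" "Dom C (Zero C X Y) = X" "Cod C (Zero C X Y) = Y"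
proof -
  interpret G: comm_group "hom_grp X Y" by (rule hom_group[OF assms])
  show "Zero C X Y \<in> Arr C" "Dom C (Zero C X Y) = X" "Cod C (Zero C X Y) = Y"
    using G.one_closed by (simp_all add: in_hom)
qed

lemma plus_arr [simp]:
  assumes "f \<in> Arr C" "g \<in> Arr C" "Dom C f = Dom C g" "Cod C f = Cod C g"
  shows "Plus C f g \<in> Arr C" "Dom C (Plus C f g) = Dom C g" "Cod C (Plus C f g) = Cod C g"
proof -
  interpret G: comm_group "hom_grp (Dom C g) (Cod C g)" by (rule hom_group) (use assms in simp_all)
  show "Plus C f g \<in> Arr C" "Dom C (Plus C f g) = Dom C g" "Cod C (Plus C f g) = Cod C g"
    using G.m_closed[of f g] assms by (simp_all add: in_hom)
qed

lemma neg_arr [simp]: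
  assumes "f \<in> Arr C"
  shows "neg f \<in> Arr C" "Dom C (neg f) = Dom C f" "Cod C (neg f) = Cod C f"
proof -
  interpret G: comm_group "hom_grp (Dom C f) (Cod C f)" by (rule hom_group) (use assms in simp_all)
  show "neg f \<in> Arr C" "Dom C (neg f) = Dom C f" "Cod C (neg f) = Cod C f"
    using G.inv_closed[of f] assms by (simp_all add: in_hom neg_def)
qed

lemma diff_arr [simp]:
  assumes "f \<in> Arr C" "g \<in> Arr C" "Dom C f = Dom C g" "Cod C f = Cod C g"
  shows "diff f g \<in> Arr C" "Dom C (diff f g) = Dom C g" "Cod C (diff f g) = Cod C g"
  using assms by (simp_all add: diff_def)

lemma plus_comm:
  assumes "f \<in> Arr C" "g \<in> Arr C" "Dom C f = Dom C g" "Cod C f = Cod C g"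
  shows "Plus C f g = Plus C g f"
proof -
  interpret G: comm_group "hom_grp (Dom C g) (Cod C g)" by (rule hom_group) (use assms in simp_all)
  show ?thesis using G.m_comm[of f g] assms by (simp add: in_hom)
qed

lemma plus_assoc:
  assumes "f \<in> Arr C" "g \<in> Arr C" "h \<in> Arr C" "Dom C f = Dom C g" "Cod C f = Cod C g"
    "Dom C g = Dom C h" "Cod C g = Cod C h"
  shows "Plus C (Plus C f g) h = Plus C f (Plus C g h)"
proof -
  interpret G: comm_group "hom_grp (Dom C g) (Cod C g)" by (rule hom_group) (use assms in simp_all)
  show ?thesis using G.m_assoc[of f g h] assms by (simp add: in_hom)
qed

lemma plus_zero [simp]:
  assumes "f \<in> Arr C" "Dom C f = X" "Cod C f = Y"
  shows "Plus C f (Zero C X Y) = f" "Plus C (Zero C X Y) f = f"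
proof -
  interpret G: comm_group "hom_grp X Y" by (rule hom_group) (use assms in auto)
  show "Plus C f (Zero C X Y) = f" "Plus C (Zero C X Y) f = f"
    using G.r_one[of f] G.l_one[of f] assms by (auto simp: in_hom)
qed

lemma plus_neg [simp]:
  assumes "f \<in> Arr C"
  shows "Plus C f (neg f) = Zero C (Dom C f) (Cod C f)"
    "Plus C (neg f) f = Zero C (Dom C f) (Cod C f)"
proof -
  interpret G: comm_group "hom_grp (Dom C f) (Cod C f)" by (rule hom_group) (use assms in auto)
  show "Plus C f (neg f) = Zero C (Dom C f) (Cod C f)"
    "Plus C (neg f) f = Zero C (Dom C f) (Cod C f)"
    using G.r_inv[of f] G.l_inv[of f] assms by (auto simp: in_hom neg_def)
qed

text \<open>In a group only the neutral element is idempotent. Distributivity makes a composite with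
  a zero arrow idempotent, which is how composition is shown to preserve zero.\<close>

lemma plus_idem_zero:
  assumes "Plus C f f = f" "f \<in> Arr C"
  shows "f = Zero C (Dom C f) (Cod C f)"
proof -
  have "Plus C (Plus C f f) (neg f) = Plus C f (Plus C f (neg f))"
    using assms(2) by (intro plus_assoc) simp_all
  then show ?thesis using assms by simp
qed

lemma comp_plus [simp]:
  assumes "f \<in> Arr C" "g \<in> Arr C" "h \<in> Arr C" "Dom C f = Dom C g" "Cod C f = Cod C g" "Cod C g = Dom C h"
  shows "h \<cdot> Plus C f g = Plus C (h \<cdot> f) (h \<cdot> g)"
  using Comp_Plus[of f "Dom C g" "Cod C g" g h "Cod C h"] assms by (simp add: in_hom)

lemma plus_comp [simp]:
  assumes "f \<in> Arr C" "g \<in> Arr C" "h \<in> Arr C" "Dom C f = Dom C g" "Cod C f = Cod C g" "Cod C h = Dom C g"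
  shows "Plus C f g \<cdot> h = Plus C (f \<cdot> h) (g \<cdot> h)"
  using Plus_Comp[of h "Dom C h" "Dom C g" f "Cod C g" g] assms by (simp add: in_hom)

lemma comp_zero [simp]:
  assumes "f \<in> Arr C" "X \<in> Obj C" "Dom C f = Y"
  shows "f \<cdot> Zero C X Y = Zero C X (Cod C f)"
proof -
  have Y: "Y \<in> Obj C" using assms by auto
  have "Plus C (f \<cdot> Zero C X Y) (f \<cdot> Zero C X Y) = f \<cdot> Plus C (Zero C X Y) (Zero C X Y)"
    using assms Y by (intro comp_plus[symmetric]) simp_all
  also have "\<dots> = f \<cdot> Zero C X Y" using assms Y by simp
  finally have "f \<cdot> Zero C X Y = Zero C (Dom C (f \<cdot> Zero C X Y)) (Cod C (f \<cdot> Zero C X Y))"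
    by (rule plus_idem_zero) (use assms Y in simp)
  then show ?thesis using assms Y by simp
qed

lemma zero_comp [simp]:
  assumes "f \<in> Arr C" "Y \<in> Obj C" "Cod C f = X"
  shows "Zero C X Y \<cdot> f = Zero C (Dom C f) Y"
proof -
  have X: "X \<in> Obj C" using assms by auto
  have "Plus C (Zero C X Y \<cdot> f) (Zero C X Y \<cdot> f) = Plus C (Zero C X Y) (Zero C X Y) \<cdot> f"
    using assms X by (intro plus_comp[symmetric]) simp_all
  also have "\<dots> = Zero C X Y \<cdot> f" using assms X by simp
  finally have "Zero C X Y \<cdot> f = Zero C (Dom C (Zero C X Y \<cdot> f)) (Cod C (Zero C X Y \<cdot> f))"
    by (rule plus_idem_zero) (use assms X in simp)
  then show ?thesis using assms X by simp
qed

lemma neg_unique: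
  assumes "Plus C f g = Zero C (Dom C f) (Cod C f)" "f \<in> Arr C" "g \<in> Arr C" "Dom C f = Dom C g" "Cod C f = Cod C g"
  shows "g = neg f"
proof -
  have "Plus C (neg f) (Plus C f g) = neg f" using assms by simp
  moreover have "Plus C (neg f) (Plus C f g) = Plus C (Plus C (neg f) f) g"
    using assms by (intro plus_assoc[symmetric]) simp_all
  moreover have "\<dots> = g" using assms by simp
  ultimately show ?thesis by simp
qed

lemma comp_neg [simp]:
  assumes "f \<in> Arr C" "h \<in> Arr C" "Cod C f = Dom C h"
  shows "h \<cdot> neg f = neg (h \<cdot> f)"
proof (rule neg_unique)
  show "Plus C (h \<cdot> f) (h \<cdot> neg f) = Zero C (Dom C (h \<cdot> f)) (Cod C (h \<cdot> f))"
    using assms by (simp flip: comp_plus)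
qed (use assms in simp_all)

lemma neg_comp [simp]:
  assumes "f \<in> Arr C" "h \<in> Arr C" "Cod C h = Dom C f"
  shows "neg f \<cdot> h = neg (f \<cdot> h)"
proof (rule neg_unique)
  show "Plus C (f \<cdot> h) (neg f \<cdot> h) = Zero C (Dom C (f \<cdot> h)) (Cod C (f \<cdot> h))"
    using assms by (simp flip: plus_comp)
qed (use assms in simp_all)

lemma neg_neg [simp]: "f \<in> Arr C \<Longrightarrow> neg (neg f) = f"
  by (rule neg_unique[symmetric]) simp_all

lemma neg_zero: "X \<in> Obj C \<Longrightarrow> Y \<in> Obj C \<Longrightarrow> neg (Zero C X Y) = Zero C X Y"
  using neg_unique[of "Zero C X Y" "Zero C X Y"] by simp

lemma comp_diff:
  assumes "f \<in> Arr C" "g \<in> Arr C" "h \<in> Arr C" "Dom C f = Dom C g" "Cod C f = Cod C g" "Cod C g = Dom C h"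
  shows "h \<cdot> diff f g = diff (h \<cdot> f) (h \<cdot> g)"
  using assms by (simp add: diff_def)

lemma diff_comp:
  assumes "f \<in> Arr C" "g \<in> Arr C" "h \<in> Arr C" "Dom C f = Dom C g" "Cod C f = Cod C g" "Cod C h = Dom C g"
  shows "diff f g \<cdot> h = diff (f \<cdot> h) (g \<cdot> h)"
  using assms by (simp add: diff_def)

lemma zarr_arr: "zarr f \<Longrightarrow> f \<in> Arr C"
  by (simp add: zarr_def)

lemma zarr_zero [simp]: "X \<in> Obj C \<Longrightarrow> Y \<in> Obj C \<Longrightarrow> zarr (Zero C X Y)"
  by (simp add: zarr_def)

lemma zarr_comp_left:
  assumes "zarr f" "g \<in> Arr C" "Cod C f = Dom C g"
  shows "zarr (g \<cdot> f)"
proof -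
  have "g \<cdot> f = g \<cdot> Zero C (Dom C f) (Cod C f)" using assms(1) by (simp add: zarr_def)
  also have "\<dots> = Zero C (Dom C f) (Cod C g)" using assms by (simp add: zarr_arr)
  finally show ?thesis using assms by (simp add: zarr_arr)
qed

lemma zarr_comp_right:
  assumes "zarr f" "g \<in> Arr C" "Cod C g = Dom C f"
  shows "zarr (f \<cdot> g)"
proof -
  have "f \<cdot> g = Zero C (Dom C f) (Cod C f) \<cdot> g" using assms(1) by (simp add: zarr_def)
  also have "\<dots> = Zero C (Dom C g) (Cod C f)" using assms by (simp add: zarr_arr)
  finally show ?thesis using assms by (simp add: zarr_arr)
qed

lemma zarr_diff_iff:
  assumes "f \<in> Arr C" "g \<in> Arr C" "Dom C f = Dom C g" "Cod C f = Cod C g"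
  shows "zarr (diff f g) \<longleftrightarrow> f = g"
proof
  assume "zarr (diff f g)"
  then have z: "Plus C f (neg g) = Zero C (Dom C g) (Cod C g)"
    using assms by (simp add: zarr_def diff_def)
  have "f = Plus C f (Plus C (neg g) g)" using assms by simp
  also have "\<dots> = Plus C (Plus C f (neg g)) g" using assms by (intro plus_assoc[symmetric]) simp_all
  finally show "f = g" using z assms by simp
qed (use assms in \<open>simp add: diff_def\<close>)

lemma mono_zeroD:
  assumes "is_mono C f" "zarr (f \<cdot> w)" "w \<in> Arr C" "Cod C w = Dom C f"
  shows "zarr w"
proof -
  have "f \<cdot> w = f \<cdot> Zero C (Dom C w) (Dom C f)" using assms by (simp add: zarr_def)
  then have "w = Zero C (Dom C w) (Dom C f)" by (rule monoD[OF assms(1)]) (use assms in simp_all)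
  then show ?thesis using assms by (simp add: zarr_def)
qed

lemma epi_zeroD:
  assumes "is_epi C f" "zarr (w \<cdot> f)" "w \<in> Arr C" "Dom C w = Cod C f"
  shows "zarr w"
proof -
  have "w \<cdot> f = Zero C (Cod C f) (Cod C w) \<cdot> f" using assms by (simp add: zarr_def)
  then have "w = Zero C (Cod C f) (Cod C w)" by (rule epiD[OF assms(1)]) (use assms in simp_all)
  then show ?thesis using assms by (simp add: zarr_def)
qed

text \<open>Parallel arrows agree iff their difference is zero, so additivity reduces cancellation
  to arrows with zero composite.\<close>

lemma mono_zeroI:
  assumes "f \<in> Arr C" "\<And>w. w \<in> Arr C \<Longrightarrow> Cod C w = Dom C f \<Longrightarrow> zarr (f \<cdot> w) \<Longrightarrow> zarr w"
  shows "is_mono C f"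
  unfolding is_mono_def
proof (intro conjI ballI impI)
  fix W g h assume W: "W \<in> Obj C" and g: "g \<in> homset C W (Dom C f)"
    and h: "h \<in> homset C W (Dom C f)" and eq: "f \<cdot> g = f \<cdot> h"
  have "zarr (f \<cdot> diff g h)" using g h eq assms(1) by (simp add: comp_diff in_hom zarr_diff_iff)
  then have "zarr (diff g h)" by (rule assms(2)[rotated 2]) (use g h in \<open>simp_all add: in_hom\<close>)
  then show "g = h" using g h by (simp add: zarr_diff_iff in_hom)
qed (use assms(1) in simp)

lemma epi_zeroI:
  assumes "f \<in> Arr C" "\<And>w. w \<in> Arr C \<Longrightarrow> Dom C w = Cod C f \<Longrightarrow> zarr (w \<cdot> f) \<Longrightarrow> zarr w"
  shows "is_epi C f"
  unfolding is_epi_def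
proof (intro conjI ballI impI)
  fix W g h assume W: "W \<in> Obj C" and g: "g \<in> homset C (Cod C f) W"
    and h: "h \<in> homset C (Cod C f) W" and eq: "g \<cdot> f = h \<cdot> f"
  have "zarr (diff g h \<cdot> f)" using g h eq assms(1) by (simp add: diff_comp in_hom zarr_diff_iff)
  then have "zarr (diff g h)" by (rule assms(2)[rotated 2]) (use g h in \<open>simp_all add: in_hom\<close>)
  then show "g = h" using g h by (simp add: zarr_diff_iff in_hom)
qed (use assms(1) in simp)

lemma kernelD:
  assumes "is_kernel C k f"
  shows "k \<in> Arr C" "f \<in> Arr C" "Cod C k = Dom C f" "zarr (f \<cdot> k)" "is_mono C k"
proof -
  note d = assms[unfolded is_kernel_def]
  show k: "k \<in> Arr C" and f: "f \<in> Arr C" and e: "Cod C k = Dom C f" using d by auto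
  show z: "zarr (f \<cdot> k)" using d by (simp add: zarr_def)
  show "is_mono C k"
  proof (rule mono_zeroI[OF k])
    fix w assume w: "w \<in> Arr C" "Cod C w = Dom C k" and kw: "zarr (k \<cdot> w)"
    have "f \<cdot> (k \<cdot> w) = Zero C (Dom C w) (Cod C f)"
      using zarr_comp_left[OF kw, of f] k f e w by (simp add: zarr_def)
    moreover have "k \<cdot> w \<in> homset C (Dom C w) (Dom C f)" using w k e f by (simp add: in_hom)
    \<comment> \<open>Both \<open>w\<close> and the zero arrow are factorizations of
      \<open>k \<cdot> w = 0\<close> through \<open>k\<close>; uniqueness identifies them.\<close>
    ultimately have "\<exists>!h. h \<in> homset C (Dom C w) (Dom C k) \<and> k \<cdot> h = k \<cdot> w"
      using d w by (metis obj_dom_cod(1))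
    moreover have "w \<in> homset C (Dom C w) (Dom C k)" using w k by (simp add: in_hom)
    moreover have "Zero C (Dom C w) (Dom C k) \<in> homset C (Dom C w) (Dom C k)"
      using w k by (simp add: in_hom)
    moreover have "k \<cdot> Zero C (Dom C w) (Dom C k) = k \<cdot> w" using kw w k by (simp add: zarr_def)
    ultimately have "w = Zero C (Dom C w) (Dom C k)" by metis
    then show "zarr w" using w by (simp add: zarr_def)
  qed
qed

lemma kernel_factor:
  assumes "is_kernel C k f" "w \<in> Arr C" "Cod C w = Dom C f" "zarr (f \<cdot> w)"
  obtains h where "h \<in> Arr C" "Dom C h = Dom C w" "Cod C h = Dom C k" "k \<cdot> h = w"
proof -
  have "w \<in> homset C (Dom C w) (Dom C f)" using assms kernelD(2)[OF assms(1)] by (simp add: in_hom)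
  moreover have "f \<cdot> w = Zero C (Dom C w) (Cod C f)"
    using assms kernelD(2)[OF assms(1)] by (simp add: zarr_def)
  ultimately have "\<exists>h. h \<in> homset C (Dom C w) (Dom C k) \<and> k \<cdot> h = w"
    using assms(1,2) unfolding is_kernel_def by (metis obj_dom_cod(1))
  then show ?thesis using that by (auto simp: in_hom)
qed

lemma kernelI:
  assumes "is_mono C k" "f \<in> Arr C" "Cod C k = Dom C f" "zarr (f \<cdot> k)"
    "\<And>w. w \<in> Arr C \<Longrightarrow> Cod C w = Dom C f \<Longrightarrow> zarr (f \<cdot> w) \<Longrightarrow>
       \<exists>h. h \<in> Arr C \<and> Dom C h = Dom C w \<and> Cod C h = Dom C k \<and> k \<cdot> h = w"
  shows "is_kernel C k f"
  unfolding is_kernel_def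
proof (intro conjI ballI impI)
  show "f \<cdot> k = Zero C (Dom C k) (Cod C f)" using assms by (simp add: zarr_def)
  fix W g assume W: "W \<in> Obj C" and g: "g \<in> homset C W (Dom C f)"
    and fg: "f \<cdot> g = Zero C W (Cod C f)"
  then obtain h where hh: "h \<in> Arr C \<and> Dom C h = Dom C g \<and> Cod C h = Dom C k \<and> k \<cdot> h = g"
    using assms(5)[of g] assms(2) by (auto simp: in_hom)
  then show "\<exists>!h. h \<in> homset C W (Dom C k) \<and> k \<cdot> h = g"
  proof (intro ex1I[of _ h])
    fix h' assume h': "h' \<in> homset C W (Dom C k) \<and> k \<cdot> h' = g"
    then have "k \<cdot> h' = k \<cdot> h" using hh by simp
    then show "h' = h" by (rule monoD[OF assms(1)]) (use h' hh g in \<open>simp_all add: in_hom\<close>)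
  next
    show "h \<in> homset C W (Dom C k) \<and> k \<cdot> h = g" using hh g assms(1) by (simp add: in_hom)
  qed
qed (use assms(1-4) in simp_all)

lemma cokernelD:
  assumes "is_cokernel C p f"
  shows "p \<in> Arr C" "f \<in> Arr C" "Dom C p = Cod C f" "zarr (p \<cdot> f)" "is_epi C p"
proof -
  note d = assms[unfolded is_cokernel_def]
  show p: "p \<in> Arr C" and f: "f \<in> Arr C" and e: "Dom C p = Cod C f" using d by auto
  show z: "zarr (p \<cdot> f)" using d by (simp add: zarr_def)
  show "is_epi C p"
  proof (rule epi_zeroI[OF p])
    fix w assume w: "w \<in> Arr C" "Dom C w = Cod C p" and kw: "zarr (w \<cdot> p)"
    have "(w \<cdot> p) \<cdot> f = Zero C (Dom C f) (Cod C w)"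
      using zarr_comp_right[OF kw, of f] p f e w by (simp add: zarr_def)
    moreover have "w \<cdot> p \<in> homset C (Cod C f) (Cod C w)" using w p e f by (simp add: in_hom)
    ultimately have "\<exists>!h. h \<in> homset C (Cod C p) (Cod C w) \<and> h \<cdot> p = w \<cdot> p"
      using d w by (metis obj_dom_cod(2))
    moreover have "w \<in> homset C (Cod C p) (Cod C w)" using w p by (simp add: in_hom)
    moreover have "Zero C (Cod C p) (Cod C w) \<in> homset C (Cod C p) (Cod C w)"
      using w p by (simp add: in_hom)
    moreover have "Zero C (Cod C p) (Cod C w) \<cdot> p = w \<cdot> p" using kw w p by (simp add: zarr_def)
    ultimately have "w = Zero C (Cod C p) (Cod C w)" by metis
    then show "zarr w" using w by (simp add: zarr_def)
  qed
qed

lemma cokernel_factor: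
  assumes "is_cokernel C p f" "w \<in> Arr C" "Dom C w = Cod C f" "zarr (w \<cdot> f)"
  obtains h where "h \<in> Arr C" "Cod C h = Cod C w" "Dom C h = Cod C p" "h \<cdot> p = w"
proof -
  have "w \<in> homset C (Cod C f) (Cod C w)" using assms cokernelD(2)[OF assms(1)] by (simp add: in_hom)
  moreover have "w \<cdot> f = Zero C (Dom C f) (Cod C w)"
    using assms cokernelD(2)[OF assms(1)] by (simp add: zarr_def)
  ultimately have "\<exists>h. h \<in> homset C (Cod C p) (Cod C w) \<and> h \<cdot> p = w"
    using assms(1,2) unfolding is_cokernel_def by (metis obj_dom_cod(2))
  then show ?thesis using that by (auto simp: in_hom)
qed

lemma cokernelI:
  assumes "is_epi C p" "f \<in> Arr C" "Dom C p = Cod C f" "zarr (p \<cdot> f)"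
    "\<And>w. w \<in> Arr C \<Longrightarrow> Dom C w = Cod C f \<Longrightarrow> zarr (w \<cdot> f) \<Longrightarrow>
       \<exists>h. h \<in> Arr C \<and> Cod C h = Cod C w \<and> Dom C h = Cod C p \<and> h \<cdot> p = w"
  shows "is_cokernel C p f"
  unfolding is_cokernel_def
proof (intro conjI ballI impI)
  show "p \<cdot> f = Zero C (Dom C f) (Cod C p)" using assms by (simp add: zarr_def)
  fix W g assume W: "W \<in> Obj C" and g: "g \<in> homset C (Cod C f) W"
    and fg: "g \<cdot> f = Zero C (Dom C f) W"
  then obtain h where hh: "h \<in> Arr C \<and> Cod C h = Cod C g \<and> Dom C h = Cod C p \<and> h \<cdot> p = g"
    using assms(5)[of g] assms(2) by (auto simp: in_hom)
  then show "\<exists>!h. h \<in> homset C (Cod C p) W \<and> h \<cdot> p = g"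
  proof (intro ex1I[of _ h])
    fix h' assume h': "h' \<in> homset C (Cod C p) W \<and> h' \<cdot> p = g"
    then have "h' \<cdot> p = h \<cdot> p" using hh by simp
    then show "h' = h" by (rule epiD[OF assms(1)]) (use h' hh g in \<open>simp_all add: in_hom\<close>)
  next
    show "h \<in> homset C (Cod C p) W \<and> h \<cdot> p = g" using hh g assms(1) by (simp add: in_hom)
  qed
qed (use assms(1-4) in simp_all)

text \<open>Uniqueness of the induced arrow is stated as joint monicity of \<open>u\<close> and
  \<open>v\<close>, tested on zero composites; by additivity this is equivalent, and it is the form
  in which it is used.\<close>

definition pullback :: "'m \<Rightarrow> 'm \<Rightarrow> 'm \<Rightarrow> 'm \<Rightarrow> bool" where
  "pullback f t u v \<longleftrightarrow> u \<in> Arr C \<and> v \<in> Arr C \<and> Dom C u = Dom C v \<and> Cod C u = Dom C f \<and> Cod C v = Dom C t \<and>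
     f \<cdot> u = t \<cdot> v \<and>
     (\<forall>a b. a \<in> Arr C \<and> b \<in> Arr C \<and> Dom C a = Dom C b \<and> Cod C a = Dom C f \<and> Cod C b = Dom C t \<and>
        f \<cdot> a = t \<cdot> b \<longrightarrow> (\<exists>h. h \<in> Arr C \<and> Dom C h = Dom C b \<and> Cod C h = Dom C v \<and> u \<cdot> h = a \<and> v \<cdot> h = b)) \<and>
     (\<forall>w. w \<in> Arr C \<and> Cod C w = Dom C v \<and> zarr (u \<cdot> w) \<and> zarr (v \<cdot> w) \<longrightarrow> zarr w)"

lemma pullbackD:
  assumes "pullback f t u v"
  shows "u \<in> Arr C" "v \<in> Arr C" "Dom C u = Dom C v" "Cod C u = Dom C f" "Cod C v = Dom C t" "f \<cdot> u = t \<cdot> v"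
  using assms by (simp_all add: pullback_def)

lemma pullback_factor:
  assumes "pullback f t u v" "f \<cdot> a = t \<cdot> b" "a \<in> Arr C" "b \<in> Arr C" "Dom C a = Dom C b"
    "Cod C a = Dom C f" "Cod C b = Dom C t"
  obtains h where "h \<in> Arr C" "Dom C h = Dom C b" "Cod C h = Dom C v" "u \<cdot> h = a" "v \<cdot> h = b"
  using assms unfolding pullback_def by blast

lemma pullback_jointly_mono:
  assumes "pullback f t u v" "zarr (u \<cdot> w)" "zarr (v \<cdot> w)" "w \<in> Arr C" "Cod C w = Dom C v"
  shows "zarr w"
  using assms unfolding pullback_def by blast

lemma pullback_mono_left:
  assumes p: "pullback f t u v" and t: "is_mono C t" and f: "f \<in> Arr C"
  shows "is_mono C u"
proof (rule mono_zeroI)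
  note d = pullbackD[OF p]
  show "u \<in> Arr C" by (rule d)
  fix w assume w: "w \<in> Arr C" "Cod C w = Dom C u" "zarr (u \<cdot> w)"
  have "zarr (f \<cdot> u \<cdot> w)" by (rule zarr_comp_left[OF w(3)]) (use w(1,2) d(1-5) f in simp_all)
  moreover have "f \<cdot> u \<cdot> w = t \<cdot> v \<cdot> w" by (rule comp_reassoc[OF d(6)]) (use w(1,2) d(1-5) f t in simp_all)
  ultimately have "zarr (t \<cdot> v \<cdot> w)" by simp
  then have "zarr (v \<cdot> w)" by (rule mono_zeroD[OF t]) (use w(1,2) d(1-5) in simp_all)
  then show "zarr w" using p w d(3) unfolding pullback_def by metis
qed

lemma pullback_mono_right:
  assumes p: "pullback f t u v" and f: "is_mono C f" and t: "t \<in> Arr C"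
  shows "is_mono C v"
proof (rule mono_zeroI)
  note d = pullbackD[OF p]
  show "v \<in> Arr C" by (rule d)
  fix w assume w: "w \<in> Arr C" "Cod C w = Dom C v" "zarr (v \<cdot> w)"
  have "zarr (t \<cdot> v \<cdot> w)" by (rule zarr_comp_left[OF w(3)]) (use w(1,2) d(1-5) t in simp_all)
  moreover have "f \<cdot> u \<cdot> w = t \<cdot> v \<cdot> w" by (rule comp_reassoc[OF d(6)]) (use w(1,2) d(1-5) f t in simp_all)
  ultimately have "zarr (f \<cdot> u \<cdot> w)" by simp
  then have "zarr (u \<cdot> w)" by (rule mono_zeroD[OF f]) (use w(1,2) d(1-5) in simp_all)
  then show "zarr w" using p w unfolding pullback_def by metis
qed

end

section \<open>Normality, images and exactness of pullback squares\<close>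

context abelian_category
begin

lemma kernelE:
  assumes "f \<in> Arr C"
  obtains k where "is_kernel C k f" "k \<in> Arr C" "Cod C k = Dom C f" "zarr (f \<cdot> k)" "is_mono C k"
  using ex_kernel[OF assms] kernelD by metis

lemma cokernelE:
  assumes "f \<in> Arr C"
  obtains p where "is_cokernel C p f" "p \<in> Arr C" "Dom C p = Cod C f" "zarr (p \<cdot> f)" "is_epi C p"
  using ex_cokernel[OF assms] cokernelD by metis

text \<open>By normality \<open>m\<close> is the kernel of some \<open>g\<close>. As
  \<open>g\<close> kills \<open>m\<close>, it factors through the cokernel \<open>p\<close>, so
  whatever \<open>p\<close> kills is killed by \<open>g\<close> and factors through
  \<open>m\<close>.\<close>

lemma mono_kernel_cokernel:
  assumes "is_mono C m" "is_cokernel C p m"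
  shows "is_kernel C m p"
proof -
  obtain g where g: "is_kernel C m g" using mono_normal[OF assms(1)] by blast
  note gD = kernelD[OF g] and pD = cokernelD[OF assms(2)]
  obtain h where h: "h \<in> Arr C" "Cod C h = Cod C g" "Dom C h = Cod C p" "h \<cdot> p = g"
    using cokernel_factor[OF assms(2), of g] gD by metis
  show ?thesis
  proof (rule kernelI)
    fix w assume w: "w \<in> Arr C" "Cod C w = Dom C p" "zarr (p \<cdot> w)"
    have "zarr (g \<cdot> w)" using zarr_comp_left[OF w(3), of h] w pD h(1-3) by (simp flip: h(4))
    then show "\<exists>h. h \<in> Arr C \<and> Dom C h = Dom C w \<and> Cod C h = Dom C m \<and> m \<cdot> h = w"
      using kernel_factor[OF g, of w] w gD pD by metis
  qed (use assms pD in simp_all)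
qed

lemma epi_cokernel_kernel:
  assumes "is_epi C e" "is_kernel C k e"
  shows "is_cokernel C e k"
proof -
  obtain g where g: "is_cokernel C e g" using epi_normal[OF assms(1)] by blast
  note gD = cokernelD[OF g] and pD = kernelD[OF assms(2)]
  obtain h where h: "h \<in> Arr C" "Dom C h = Dom C g" "Cod C h = Dom C k" "k \<cdot> h = g"
    using kernel_factor[OF assms(2), of g] gD by metis
  show ?thesis
  proof (rule cokernelI)
    fix w assume w: "w \<in> Arr C" "Dom C w = Cod C k" "zarr (w \<cdot> k)"
    have "zarr (w \<cdot> g)" using zarr_comp_right[OF w(3), of h] w pD h(1-3) by (simp flip: h(4))
    then show "\<exists>h. h \<in> Arr C \<and> Cod C h = Cod C w \<and> Dom C h = Cod C e \<and> h \<cdot> e = w"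
      using cokernel_factor[OF g, of w] w gD pD by metis
  qed (use assms pD in simp_all)
qed

text \<open>A mono is the kernel of its cokernel, so factoring through it is a matter of being
  killed by the cokernel. Quantifying over all arrows that kill \<open>m\<close> spares the caller
  the choice of one.\<close>

lemma mono_factor:
  assumes "is_mono C m" "f \<in> Arr C" "Cod C f = Cod C m"
    and "\<And>w. w \<in> Arr C \<Longrightarrow> Dom C w = Cod C m \<Longrightarrow> zarr (w \<cdot> m) \<Longrightarrow> zarr (w \<cdot> f)"
  obtains g where "g \<in> Arr C" "Dom C g = Dom C f" "Cod C g = Dom C m" "m \<cdot> g = f"
proof -
  obtain p where p: "is_cokernel C p m" "p \<in> Arr C" "Dom C p = Cod C m" "zarr (p \<cdot> m)"
    by (rule cokernelE[of m]) (use assms(1) in auto)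
  have "zarr (p \<cdot> f)" using assms(4) p by blast
  then show ?thesis using that assms(2,3) p(2,3)
    by (auto elim!: kernel_factor[OF mono_kernel_cokernel[OF assms(1) p(1)], of f])
qed

lemma epi_factor:
  assumes "is_epi C e" "f \<in> Arr C" "Dom C f = Dom C e"
    and "\<And>w. w \<in> Arr C \<Longrightarrow> Cod C w = Dom C e \<Longrightarrow> zarr (e \<cdot> w) \<Longrightarrow> zarr (f \<cdot> w)"
  obtains g where "g \<in> Arr C" "Cod C g = Cod C f" "Dom C g = Cod C e" "g \<cdot> e = f"
proof -
  obtain k where k: "is_kernel C k e" "k \<in> Arr C" "Cod C k = Dom C e" "zarr (e \<cdot> k)"
    by (rule kernelE[of e]) (use assms(1) in auto)
  have "zarr (f \<cdot> k)" using assms(4) k by blast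
  then show ?thesis using that assms(2,3) k(2,3)
    by (auto elim!: cokernel_factor[OF epi_cokernel_kernel[OF assms(1) k(1)], of f])
qed

text \<open>Here \<open>m\<close> is the kernel of the cokernel \<open>p\<close> of
  \<open>f\<close>. If \<open>g\<close> kills \<open>e\<close>, then \<open>f\<close> factors
  through the smaller mono \<open>m \<cdot> k\<close> with \<open>k\<close> the kernel of
  \<open>g\<close>. Arrows killing \<open>m \<cdot> k\<close> kill \<open>f\<close>, factor through
  \<open>p\<close> and so kill \<open>m\<close>; hence \<open>m\<close> factors through
  \<open>m \<cdot> k\<close>, \<open>k\<close> has a section, and \<open>g\<close> is zero.\<close>

lemma image_factorization:
  assumes f: "f \<in> Arr C"
  obtains e m where "is_epi C e" "is_mono C m" "Dom C e = Dom C f" "Cod C m = Cod C f"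
    "Cod C e = Dom C m" "m \<cdot> e = f"
proof -
  obtain p where p: "is_cokernel C p f" "p \<in> Arr C" "Dom C p = Cod C f" "zarr (p \<cdot> f)" "is_epi C p"
    using cokernelE[OF f] by auto
  obtain m where m: "is_kernel C m p" "m \<in> Arr C" "Cod C m = Dom C p" "zarr (p \<cdot> m)" "is_mono C m"
    using kernelE[OF p(2)] by auto
  obtain e where e: "e \<in> Arr C" "Dom C e = Dom C f" "Cod C e = Dom C m" "m \<cdot> e = f"
    using kernel_factor[OF m(1), of f] f p by metis
  have "is_epi C e"
  proof (rule epi_zeroI[OF e(1)])
    fix g assume g: "g \<in> Arr C" "Dom C g = Cod C e" and ge: "zarr (g \<cdot> e)"
    obtain k where k: "is_kernel C k g" "k \<in> Arr C" "Cod C k = Dom C g" "zarr (g \<cdot> k)" "is_mono C k"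
      using kernelE[OF g(1)] by auto
    obtain e' where e': "e' \<in> Arr C" "Dom C e' = Dom C e" "Cod C e' = Dom C k" "k \<cdot> e' = e"
      using kernel_factor[OF k(1) e(1)] g ge by metis
    have mk: "is_mono C (m \<cdot> k)" using m k g e by (intro mono_comp) simp_all
    obtain y where y: "y \<in> Arr C" "Dom C y = Dom C m" "Cod C y = Dom C k" "(m \<cdot> k) \<cdot> y = m"
    proof (rule mono_factor[OF mk m(2)])
      fix w assume w: "w \<in> Arr C" "Dom C w = Cod C (m \<cdot> k)" "zarr (w \<cdot> (m \<cdot> k))"
      have "zarr (w \<cdot> f)"
      proof -
        have "(w \<cdot> (m \<cdot> k)) \<cdot> e' = w \<cdot> f" using e e' w m k g by simp
        then show ?thesis using zarr_comp_right[OF w(3), of e'] e' w m k g e by simp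
      qed
      then obtain h where "h \<in> Arr C" "Dom C h = Cod C p" "h \<cdot> p = w"
        using cokernel_factor[OF p(1), of w] w m k g e p by auto
      then show "zarr (w \<cdot> m)" using zarr_comp_left[OF m(4), of h] m p comp_rw[of h p w m] by simp
    qed (use m k g e in simp_all)
    have "m \<cdot> Ident C (Dom C m) = m \<cdot> (k \<cdot> y)" using y m k g e by simp
    then have ky: "Ident C (Dom C m) = k \<cdot> y"
      by (rule monoD[OF m(5)]) (use y m k g e in simp_all)
    have "g = (g \<cdot> k) \<cdot> y" using ky g e m k y by (metis comp_assoc comp_ident(1))
    then show "zarr g" using zarr_comp_right[OF k(4), of y] y k g by simp
  qed
  then show ?thesis using that m e p by metis
qed

lemma zero_objE:
  obtains N where "N \<in> Obj C" "is_zero_obj C N"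
  using ex_zero is_zero_obj_def by metis

lemma zero_obj_iff: "X \<in> Obj C \<Longrightarrow> is_zero_obj C X \<longleftrightarrow> zarr (Ident C X)"
proof
  assume X: "X \<in> Obj C" and "is_zero_obj C X"
  then have "\<exists>!f. f \<in> homset C X X" by (simp add: is_zero_obj_def)
  moreover have "Ident C X \<in> homset C X X" "Zero C X X \<in> homset C X X" using X by (simp_all add: in_hom)
  ultimately have "Ident C X = Zero C X X" by metis
  then show "zarr (Ident C X)" using X by simp
next
  assume X: "X \<in> Obj C" and z: "zarr (Ident C X)"
  have 1: "f = Zero C X Y" if "f \<in> homset C X Y" for f Y
    using zarr_comp_left[OF z, of f] that X by (simp add: in_hom zarr_def)
  have 2: "f = Zero C Y X" if "f \<in> homset C Y X" for f Y
    using zarr_comp_right[OF z, of f] that X by (simp add: in_hom zarr_def)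
  show "is_zero_obj C X" unfolding is_zero_obj_def
  proof (intro conjI ballI X)
    fix Y assume Y: "Y \<in> Obj C"
    have "Zero C X Y \<in> homset C X Y" "Zero C Y X \<in> homset C Y X" using X Y by (simp_all add: in_hom)
    then show "\<exists>!f. f \<in> homset C X Y" "\<exists>!f. f \<in> homset C Y X" using 1 2 by blast+
  qed
qed

lemma biproductE:
  assumes "X \<in> Obj C" "Y \<in> Obj C"
  obtains S i j p q where "S \<in> Obj C" "i \<in> Arr C" "Dom C i = X" "Cod C i = S"
    "j \<in> Arr C" "Dom C j = Y" "Cod C j = S" "p \<in> Arr C" "Dom C p = S" "Cod C p = X"
    "q \<in> Arr C" "Dom C q = S" "Cod C q = Y" "p \<cdot> i = Ident C X" "q \<cdot> j = Ident C Y"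
    "p \<cdot> j = Zero C Y X" "q \<cdot> i = Zero C X Y" "Plus C (i \<cdot> p) (j \<cdot> q) = Ident C S"
proof -
  obtain S i j p q where "is_biproduct C X Y S i j p q" using ex_biproduct[OF assms] by blast
  then show ?thesis by (intro that[of S i j p q]) (simp_all add: is_biproduct_def in_hom)
qed

text \<open>
  The second property is exactness on the other side of the square: the extension of \<open>w\<close> by \<open>0\<close> on the
  domain of \<open>t\<close> factors through the image \<open>m\<close> of \<open>(f, -t)\<close>.
\<close>

lemma ex_pullback:
  assumes f: "f \<in> Arr C" and t: "t \<in> Arr C" and e: "Cod C f = Cod C t"
  obtains u v where "pullback f t u v"
    "\<forall>w. w \<in> Arr C \<and> Dom C w = Cod C u \<and> zarr (w \<cdot> u) \<longrightarrow>
       (\<exists>m f' t' w'. is_mono C m \<and> f' \<in> Arr C \<and> t' \<in> Arr C \<and> w' \<in> Arr C \<and> Cod C f' = Dom C m \<and>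
         Cod C t' = Dom C m \<and> Dom C w' = Dom C m \<and> m \<cdot> f' = f \<and> m \<cdot> t' = t \<and> w' \<cdot> f' = w \<and> zarr (w' \<cdot> t'))"
proof -
  obtain S i j p q where S: "S \<in> Obj C" "i \<in> Arr C" "Dom C i = Dom C f" "Cod C i = S"
    "j \<in> Arr C" "Dom C j = Dom C t" "Cod C j = S" "p \<in> Arr C" "Dom C p = S" "Cod C p = Dom C f"
    "q \<in> Arr C" "Dom C q = S" "Cod C q = Dom C t" "p \<cdot> i = Ident C (Dom C f)" "q \<cdot> j = Ident C (Dom C t)"
    "p \<cdot> j = Zero C (Dom C t) (Dom C f)" "q \<cdot> i = Zero C (Dom C f) (Dom C t)"
    "Plus C (i \<cdot> p) (j \<cdot> q) = Ident C S"
    by (rule biproductE[of "Dom C f" "Dom C t"]) (use f t in auto)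
  \<comment> \<open>The pullback is the kernel of \<open>r\<close>, with the two coordinates of
    \<open>k\<close> as its legs.\<close>
  define r where "r = diff (f \<cdot> p) (t \<cdot> q)"
  have r: "r \<in> Arr C" "Dom C r = S" "Cod C r = Cod C t" using f t e S by (simp_all add: r_def)
  obtain k where k: "is_kernel C k r" "k \<in> Arr C" "Cod C k = S" "zarr (r \<cdot> k)" "is_mono C k"
    using kernelE[OF r(1)] r(2) by auto
  show ?thesis
  proof (rule that[of "p \<cdot> k" "q \<cdot> k"])
    show "pullback f t (p \<cdot> k) (q \<cdot> k)"
      unfolding pullback_def
    proof (intro conjI allI impI; (elim conjE)?)
      have "r \<cdot> k = diff (f \<cdot> p \<cdot> k) (t \<cdot> q \<cdot> k)" using f t e S k by (simp add: r_def diff_comp)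
      then show "f \<cdot> p \<cdot> k = t \<cdot> q \<cdot> k" using k f t e S by (simp add: zarr_diff_iff)
    next
      fix a b assume a: "a \<in> Arr C" "b \<in> Arr C" "Dom C a = Dom C b" "Cod C a = Dom C f"
        "Cod C b = Dom C t" "f \<cdot> a = t \<cdot> b"
      define x where "x = Plus C (i \<cdot> a) (j \<cdot> b)"
      have x: "x \<in> Arr C" "Dom C x = Dom C b" "Cod C x = S" using a S by (simp_all add: x_def)
      have px: "p \<cdot> x = a"
      proof -
        have "p \<cdot> i \<cdot> a = a" "p \<cdot> j \<cdot> b = Zero C (Dom C b) (Dom C f)"
          using a S f t comp_rw[OF S(14), of a] comp_rw[OF S(16), of b] by simp_all
        then show ?thesis using a S f by (simp add: x_def)
      qed
      have qx: "q \<cdot> x = b"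
      proof -
        have "q \<cdot> i \<cdot> a = Zero C (Dom C b) (Dom C t)" "q \<cdot> j \<cdot> b = b"
          using a S f t comp_rw[OF S(17), of a] comp_rw[OF S(15), of b] by simp_all
        then show ?thesis using a S t by (simp add: x_def)
      qed
      have "r \<cdot> x = diff (f \<cdot> p \<cdot> x) (t \<cdot> q \<cdot> x)" using f t e S x by (simp add: r_def diff_comp)
      then have "zarr (r \<cdot> x)" using px qx a f t e by (simp add: zarr_diff_iff)
      then obtain h where h: "h \<in> Arr C" "Dom C h = Dom C x" "Cod C h = Dom C k" "k \<cdot> h = x"
        using kernel_factor[OF k(1) x(1)] x r by metis
      show "\<exists>h. h \<in> Arr C \<and> Dom C h = Dom C b \<and> Cod C h = Dom C (q \<cdot> k) \<and> (p \<cdot> k) \<cdot> h = a \<and> (q \<cdot> k) \<cdot> h = b"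
        using h px qx S k x by (intro exI[of _ h]) simp
    next
      fix w assume w: "w \<in> Arr C" "Cod C w = Dom C (q \<cdot> k)" "zarr ((p \<cdot> k) \<cdot> w)" "zarr ((q \<cdot> k) \<cdot> w)"
      have cw: "Cod C w = Dom C k" using w S k by simp
      have kw: "k \<cdot> w \<in> Arr C" "Cod C (k \<cdot> w) = S" "Dom C (k \<cdot> w) = Dom C w" using w k cw by simp_all
      have "k \<cdot> w = Plus C (i \<cdot> p) (j \<cdot> q) \<cdot> k \<cdot> w" using kw by (simp add: S(18))
      also have "\<dots> = Plus C (i \<cdot> p \<cdot> k \<cdot> w) (j \<cdot> q \<cdot> k \<cdot> w)" using S(1-17) kw cw by simp
      also have "\<dots> = Zero C (Dom C w) S"
        using w(3,4) S kw cw w(1) k by (simp add: zarr_def)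
      finally have "zarr (k \<cdot> w)" using w S by simp
      then show "zarr w" using mono_zeroD[OF k(5)] w cw by blast
    qed (use S k in simp_all)
    show "\<forall>w. w \<in> Arr C \<and> Dom C w = Cod C (p \<cdot> k) \<and> zarr (w \<cdot> (p \<cdot> k)) \<longrightarrow>
       (\<exists>m f' t' w'. is_mono C m \<and> f' \<in> Arr C \<and> t' \<in> Arr C \<and> w' \<in> Arr C \<and> Cod C f' = Dom C m \<and>
         Cod C t' = Dom C m \<and> Dom C w' = Dom C m \<and> m \<cdot> f' = f \<and> m \<cdot> t' = t \<and> w' \<cdot> f' = w \<and> zarr (w' \<cdot> t'))"
    proof (intro allI impI; elim conjE)
      fix w assume w: "w \<in> Arr C" "Dom C w = Cod C (p \<cdot> k)" "zarr (w \<cdot> (p \<cdot> k))"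
      have dw: "Dom C w = Dom C f" using w S k by simp
      obtain e m where em: "is_epi C e" "is_mono C m" "Dom C e = S" "Cod C m = Cod C t"
        "Cod C e = Dom C m" "m \<cdot> e = r"
        using image_factorization[OF r(1)] r by metis
      have wp: "w \<cdot> p \<in> Arr C" "Dom C (w \<cdot> p) = Dom C e" using w(1) dw S em by simp_all
      \<comment> \<open>\<open>w \<cdot> p\<close> kills the kernel \<open>k\<close> of
        \<open>r = m \<cdot> e\<close>, which is also the kernel of \<open>e\<close>; therefore it
        descends along the epi \<open>e\<close>.\<close>
      obtain w' where w': "w' \<in> Arr C" "Cod C w' = Cod C (w \<cdot> p)" "Dom C w' = Cod C e" "w' \<cdot> e = w \<cdot> p"
      proof (rule epi_factor[OF em(1) wp])
        fix x assume x: "x \<in> Arr C" "Cod C x = Dom C e" "zarr (e \<cdot> x)"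
        have "zarr (m \<cdot> e \<cdot> x)" using zarr_comp_left[OF x(3)] x em by simp
        then have "zarr (r \<cdot> x)" using comp_rw[OF em(6)] x em by simp
        then obtain h where h: "h \<in> Arr C" "Dom C h = Dom C x" "Cod C h = Dom C k" "k \<cdot> h = x"
          using kernel_factor[OF k(1) x(1)] x r em by metis
        have "w \<cdot> p \<cdot> x = (w \<cdot> p \<cdot> k) \<cdot> h" unfolding h(4)[symmetric] using h(1-3) S k w(1) dw by simp
        then show "zarr ((w \<cdot> p) \<cdot> x)" using zarr_comp_right[OF w(3) h(1)] h(2,3) k S w(1) dw x em by simp
      qed
      have ri: "r \<cdot> i = f"
      proof -
        have "r \<cdot> i = diff (f \<cdot> p \<cdot> i) (t \<cdot> q \<cdot> i)" using f t e S by (simp add: r_def diff_comp)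
        then show ?thesis using f t e S(1-17) by (simp add: diff_def neg_zero)
      qed
      have rj: "r \<cdot> j = neg t"
      proof -
        have "r \<cdot> j = diff (f \<cdot> p \<cdot> j) (t \<cdot> q \<cdot> j)" using f t e S by (simp add: r_def diff_comp)
        then show ?thesis using f t e S(1-17) by (simp add: diff_def)
      qed
      have 1: "m \<cdot> e \<cdot> i = f" using comp_rw[OF em(6), of i] em S ri by simp
      \<comment> \<open>The second component of \<open>r\<close> is \<open>neg t\<close>, which
        forces the sign in the leg \<open>neg (e \<cdot> j)\<close> over \<open>t\<close>.\<close>
      have 2: "m \<cdot> neg (e \<cdot> j) = t"
      proof -
        have "m \<cdot> neg (e \<cdot> j) = neg (m \<cdot> e \<cdot> j)" using em S by simp
        also have "m \<cdot> e \<cdot> j = neg t" using comp_rw[OF em(6), of j] em S rj by simp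
        finally show ?thesis using t by simp
      qed
      have 3: "w' \<cdot> e \<cdot> i = w" using comp_rw[OF w'(4), of i] w'(1,3) em S w(1) dw by simp
      have 4: "w' \<cdot> neg (e \<cdot> j) = neg (w' \<cdot> e \<cdot> j)" using w'(1,3) em S by simp
      have 5: "w' \<cdot> e \<cdot> j = Zero C (Dom C t) (Cod C w)"
        using comp_rw[OF w'(4), of j] w'(1,3) em S w(1) dw t by simp
      have 6: "zarr (w' \<cdot> neg (e \<cdot> j))" unfolding 4 5 using t w(1) by (simp add: neg_zero)
      show "\<exists>m f' t' w'. is_mono C m \<and> f' \<in> Arr C \<and> t' \<in> Arr C \<and> w' \<in> Arr C \<and> Cod C f' = Dom C m \<and>
           Cod C t' = Dom C m \<and> Dom C w' = Dom C m \<and> m \<cdot> f' = f \<and> m \<cdot> t' = t \<and> w' \<cdot> f' = w \<and> zarr (w' \<cdot> t')"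
        by (rule exI[of _ m], rule exI[of _ "e \<cdot> i"], rule exI[of _ "neg (e \<cdot> j)"], rule exI[of _ w'])
          (use 1 2 3 6 em w'(1,3) S in simp)
    qed
  qed
qed

end

section \<open>Serre subcategories\<close>

text \<open>This generality covers the localizing subcategories, their joins and intersections, and
  the class of zero objects (\<open>serre_zero\<close>). \<open>L_zero\<close> excludes the empty
  class, which satisfies the other closure conditions.\<close>

locale serre_subcategory = abelian_category C
  for C :: "('o, 'm, 'e) addcat_scheme" (structure) +
  fixes L :: "'o set"
  assumes L_obj: "X \<in> L \<Longrightarrow> X \<in> Obj C"
    and L_zero: "is_zero_obj C N \<Longrightarrow> N \<in> L"
    and L_sub: "is_mono C i \<Longrightarrow> Cod C i \<in> L \<Longrightarrow> Dom C i \<in> L"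
    and L_quot: "is_epi C p \<Longrightarrow> Dom C p \<in> L \<Longrightarrow> Cod C p \<in> L"
    and L_ext: "short_exact C i p \<Longrightarrow> Dom C i \<in> L \<Longrightarrow> Cod C p \<in> L \<Longrightarrow> Cod C i \<in> L"
begin

text \<open>
  Images in \<open>L\<close>: these arrows are the ones that become zero in \<open>C / L\<close>.
\<close>

definition null :: "'m \<Rightarrow> bool" where
  "null f \<longleftrightarrow> f \<in> Arr C \<and> (\<exists>a b. a \<in> Arr C \<and> b \<in> Arr C \<and> Dom C a = Dom C f \<and> Cod C a = Dom C b \<and>
     Cod C b = Cod C f \<and> Dom C b \<in> L \<and> b \<cdot> a = f)"

lemma null_arr: "null f \<Longrightarrow> f \<in> Arr C"
  by (simp add: null_def)

lemma nullI:
  assumes "a \<in> Arr C" "b \<in> Arr C" "Cod C a = Dom C b" "Dom C b \<in> L"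
  shows "null (b \<cdot> a)"
  unfolding null_def by (intro conjI exI[of _ a] exI[of _ b]) (use assms in simp_all)

lemma null_cod: "f \<in> Arr C \<Longrightarrow> Cod C f \<in> L \<Longrightarrow> null f"
  using nullI[of f "Ident C (Cod C f)"] by simp

lemma null_dom: "f \<in> Arr C \<Longrightarrow> Dom C f \<in> L \<Longrightarrow> null f"
  using nullI[of "Ident C (Dom C f)" f] by simp

lemma null_comp_left:
  assumes "null f" "g \<in> Arr C" "Cod C f = Dom C g"
  shows "null (g \<cdot> f)"
proof -
  obtain a b where ab: "a \<in> Arr C" "b \<in> Arr C" "Dom C a = Dom C f" "Cod C a = Dom C b"
    "Cod C b = Cod C f" "Dom C b \<in> L" "b \<cdot> a = f" using assms(1) unfolding null_def by blast
  have "null ((g \<cdot> b) \<cdot> a)" by (rule nullI) (use ab assms in simp_all)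
  then show ?thesis using ab assms by simp
qed

lemma null_comp_right:
  assumes "null f" "g \<in> Arr C" "Cod C g = Dom C f"
  shows "null (f \<cdot> g)"
proof -
  obtain a b where ab: "a \<in> Arr C" "b \<in> Arr C" "Dom C a = Dom C f" "Cod C a = Dom C b"
    "Cod C b = Cod C f" "Dom C b \<in> L" "b \<cdot> a = f" using assms(1) unfolding null_def by blast
  have "null (b \<cdot> (a \<cdot> g))" by (rule nullI) (use ab assms in simp_all)
  moreover have "f \<cdot> g = b \<cdot> (a \<cdot> g)" unfolding ab(7)[symmetric] using ab(1-6) assms by simp
  ultimately show ?thesis by simp
qed

lemma null_zarr:
  assumes "zarr f"
  shows "null f"
proof -
  obtain N where N: "N \<in> Obj C" "is_zero_obj C N" by (rule zero_objE)
  have "null (Zero C N (Cod C f) \<cdot> Zero C (Dom C f) N)"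
    by (rule nullI) (use N zarr_arr[OF assms] L_zero in simp_all)
  then show ?thesis using assms N zarr_arr[OF assms] by (simp add: zarr_def)
qed

text \<open>Let \<open>m \<cdot> e\<close> factor as \<open>b \<cdot> a\<close> through an object of
  \<open>L\<close>. The image of \<open>b\<close> is a quotient of that object, and the image
  \<open>Dom C y2\<close> of \<open>a\<close> in it is a subobject of that quotient, so it lies in
  \<open>L\<close>. Both \<open>e\<close> and \<open>y1\<close> are epi parts of the same arrow, so
  they have the same kernel and \<open>e\<close> descends to an epi \<open>\<theta>\<close> from
  \<open>Dom C y2\<close> onto \<open>Dom C m\<close>.\<close>

lemma null_image:
  assumes "is_epi C e" "is_mono C m" "Cod C e = Dom C m" "null (m \<cdot> e)"
  shows "Dom C m \<in> L"
proof -
  have ar: "e \<in> Arr C" "m \<in> Arr C" using assms by simp_all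
  obtain a b where ab: "a \<in> Arr C" "b \<in> Arr C" "Dom C a = Dom C e" "Cod C a = Dom C b"
    "Cod C b = Cod C m" "Dom C b \<in> L" "b \<cdot> a = m \<cdot> e" 
    using assms(3,4) ar unfolding null_def by auto
  obtain b1 b2 where b: "is_epi C b1" "is_mono C b2" "Dom C b1 = Dom C b" "Cod C b2 = Cod C b"
    "Cod C b1 = Dom C b2" "b2 \<cdot> b1 = b"
    using image_factorization[OF ab(2)] by metis
  have ba: "b1 \<cdot> a \<in> Arr C" "Dom C (b1 \<cdot> a) = Dom C e" "Cod C (b1 \<cdot> a) = Cod C b1" using ab b by simp_all
  obtain y1 y2 where y: "is_epi C y1" "is_mono C y2" "Dom C y1 = Dom C e" "Cod C y2 = Cod C b1"
    "Cod C y1 = Dom C y2" "y2 \<cdot> y1 = b1 \<cdot> a"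
    using image_factorization[OF ba(1)] ba(2,3) by metis
  have "Cod C b1 \<in> L" using L_quot[OF b(1)] b ab by simp
  then have yL: "Dom C y2 \<in> L" using L_sub[OF y(2)] y by simp
  have eq: "m \<cdot> e = (b2 \<cdot> y2) \<cdot> y1"
  proof -
    have "(b2 \<cdot> y2) \<cdot> y1 = b2 \<cdot> (b1 \<cdot> a)" using y b by simp
    also have "\<dots> = b \<cdot> a" using b ab comp_rw[OF b(6), of a] by simp
    finally show ?thesis using ab by simp
  qed
  have m2: "is_mono C (b2 \<cdot> y2)" by (rule mono_comp) (use b y in simp_all)
  obtain \<theta> where t: "\<theta> \<in> Arr C" "Cod C \<theta> = Cod C e" "Dom C \<theta> = Cod C y1" "\<theta> \<cdot> y1 = e"
  proof (rule epi_factor[OF y(1) ar(1) y(3)[symmetric]])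
    fix w assume w: "w \<in> Arr C" "Cod C w = Dom C y1" "zarr (y1 \<cdot> w)"
    have "zarr ((b2 \<cdot> y2) \<cdot> y1 \<cdot> w)"
      by (rule zarr_comp_left[OF w(3)]) (use w b y in simp_all)
    moreover have "(m \<cdot> e) \<cdot> w = (b2 \<cdot> y2) \<cdot> y1 \<cdot> w" unfolding eq using w b(1-5) y(1-5) by simp
    ultimately have "zarr ((m \<cdot> e) \<cdot> w)" by simp
    then have "zarr (m \<cdot> (e \<cdot> w))" using ar assms(3) w y by simp
    then show "zarr (e \<cdot> w)" by (rule mono_zeroD[OF assms(2)]) (use ar assms(3) w y in simp_all)
  qed
  have "is_epi C \<theta>" by (rule epi_cancel[of \<theta> y1]) (use t assms(1) y in simp_all)
  then show ?thesis using L_quot[of \<theta>] t y yL assms(3) by simp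
qed

lemma null_mono:
  assumes "is_mono C m" "null m"
  shows "Dom C m \<in> L"
  using null_image[of "Ident C (Dom C m)" m] assms by simp

lemma null_epi:
  assumes "is_epi C e" "null e"
  shows "Cod C e \<in> L"
  using null_image[of e "Ident C (Cod C e)"] assms by simp

text \<open>The image of \<open>w\<close> is an extension of its image under \<open>s\<close>, which
  lies in \<open>L\<close> because \<open>s \<cdot> w\<close> is null, by its part killed by
  \<open>s\<close>, which lies in \<open>L\<close> by \<open>ker\<close>.\<close>

lemma kernel_null_cancel:
  assumes s: "s \<in> Arr C" and ker: "\<And>w. w \<in> Arr C \<Longrightarrow> Cod C w = Dom C s \<Longrightarrow> zarr (s \<cdot> w) \<Longrightarrow> null w"
    and w: "w \<in> Arr C" "Cod C w = Dom C s" and n: "null (s \<cdot> w)"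
  shows "null w"
proof -
  obtain e m where em: "is_epi C e" "is_mono C m" "Dom C e = Dom C w" "Cod C m = Dom C s"
    "Cod C e = Dom C m" "m \<cdot> e = w"
    using image_factorization[OF w(1)] w(2) by metis
  have sm: "s \<cdot> m \<in> Arr C" "Dom C (s \<cdot> m) = Dom C m" "Cod C (s \<cdot> m) = Cod C s" using s em by simp_all
  obtain \<epsilon> \<mu> where f: "is_epi C \<epsilon>" "is_mono C \<mu>" "Dom C \<epsilon> = Dom C m" "Cod C \<mu> = Cod C s"
    "Cod C \<epsilon> = Dom C \<mu>" "\<mu> \<cdot> \<epsilon> = s \<cdot> m"
    using image_factorization[OF sm(1)] sm by metis
  have "\<mu> \<cdot> (\<epsilon> \<cdot> e) = s \<cdot> w" using comp_rw[OF f(6), of e] f em s by simp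
  moreover have "is_epi C (\<epsilon> \<cdot> e)" by (rule epi_comp) (use em f in simp_all)
  ultimately have 1: "Dom C \<mu> \<in> L" using null_image[of "\<epsilon> \<cdot> e" \<mu>] f em n by simp
  obtain \<kappa> where k: "is_kernel C \<kappa> \<epsilon>" "\<kappa> \<in> Arr C" "Cod C \<kappa> = Dom C \<epsilon>" "zarr (\<epsilon> \<cdot> \<kappa>)" "is_mono C \<kappa>"
    by (rule kernelE[of \<epsilon>]) (use f in auto)
  have mk: "is_mono C (m \<cdot> \<kappa>)" by (rule mono_comp) (use k em f in simp_all)
  have "zarr (\<mu> \<cdot> (\<epsilon> \<cdot> \<kappa>))" by (rule zarr_comp_left[OF k(4)]) (use f k in simp_all)
  then have "zarr (s \<cdot> (m \<cdot> \<kappa>))" using comp_rw[OF f(6), of \<kappa>] f k em s by simp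
  then have "null (m \<cdot> \<kappa>)" using ker[of "m \<cdot> \<kappa>"] k f em by simp
  then have 2: "Dom C \<kappa> \<in> L" using null_mono[OF mk] k em f by simp
  have "short_exact C \<kappa> \<epsilon>" using epi_cokernel_kernel[OF f(1) k(1)] k(1) by (simp add: short_exact_def)
  then have "Cod C e \<in> L" using L_ext[of \<kappa> \<epsilon>] 1 2 k f em by simp
  then show ?thesis using nullI[of e m] em by simp
qed

text \<open>Dually, the image of \<open>w\<close> contains the image of \<open>w \<cdot> s\<close>,
  which lies in \<open>L\<close>; the quotient by it receives an epi from \<open>Cod C s\<close>
  that kills \<open>s\<close>, so it lies in \<open>L\<close> by \<open>cok\<close>.\<close>

lemma cokernel_null_cancel:
  assumes s: "s \<in> Arr C" and cok: "\<And>w. w \<in> Arr C \<Longrightarrow> Dom C w = Cod C s \<Longrightarrow> zarr (w \<cdot> s) \<Longrightarrow> null w"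
    and w: "w \<in> Arr C" "Dom C w = Cod C s" and n: "null (w \<cdot> s)"
  shows "null w"
proof -
  obtain e m where em: "is_epi C e" "is_mono C m" "Dom C e = Cod C s" "Cod C m = Cod C w"
    "Cod C e = Dom C m" "m \<cdot> e = w"
    using image_factorization[OF w(1)] w(2) by metis
  have sm: "e \<cdot> s \<in> Arr C" "Dom C (e \<cdot> s) = Dom C s" "Cod C (e \<cdot> s) = Cod C e" using s em by simp_all
  obtain \<epsilon> \<mu> where f: "is_epi C \<epsilon>" "is_mono C \<mu>" "Dom C \<epsilon> = Dom C s" "Cod C \<mu> = Cod C e"
    "Cod C \<epsilon> = Dom C \<mu>" "\<mu> \<cdot> \<epsilon> = e \<cdot> s"
    using image_factorization[OF sm(1)] sm by metis
  have "(m \<cdot> \<mu>) \<cdot> \<epsilon> = w \<cdot> s" using f em s comp_rw[OF em(6), of s] by simp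
  moreover have "is_mono C (m \<cdot> \<mu>)" by (rule mono_comp) (use em f in simp_all)
  ultimately have 1: "Dom C \<mu> \<in> L" using null_image[of \<epsilon> "m \<cdot> \<mu>"] f em n by simp
  obtain \<pi> where k: "is_cokernel C \<pi> \<mu>" "\<pi> \<in> Arr C" "Dom C \<pi> = Cod C \<mu>" "zarr (\<pi> \<cdot> \<mu>)" "is_epi C \<pi>"
    by (rule cokernelE[of \<mu>]) (use f in auto)
  have pe: "is_epi C (\<pi> \<cdot> e)" by (rule epi_comp) (use k em f in simp_all)
  have "zarr ((\<pi> \<cdot> \<mu>) \<cdot> \<epsilon>)" by (rule zarr_comp_right[OF k(4)]) (use f k in simp_all)
  then have "zarr ((\<pi> \<cdot> e) \<cdot> s)" using f k em s by simp
  then have "null (\<pi> \<cdot> e)" using cok[of "\<pi> \<cdot> e"] k f em by simp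
  then have 2: "Cod C \<pi> \<in> L" using null_epi[OF pe] k em f by simp
  have "short_exact C \<mu> \<pi>" using mono_kernel_cokernel[OF f(2) k(1)] k(1) by (simp add: short_exact_def)
  then have "Cod C e \<in> L" using L_ext[of \<mu> \<pi>] 1 2 k f em by simp
  then show ?thesis using nullI[of e m] em by simp
qed

text \<open>Together with \<open>L_isosD\<close> this replaces the kernels and cokernels in
  \<open>L_isos\<close> by tests on arrows, so that arguments about ordinary monos and epis carry
  over.\<close>

lemma L_isosI:
  assumes s: "s \<in> Arr C"
    and ker: "\<And>w. w \<in> Arr C \<Longrightarrow> Cod C w = Dom C s \<Longrightarrow> zarr (s \<cdot> w) \<Longrightarrow> null w"
    and cok: "\<And>w. w \<in> Arr C \<Longrightarrow> Dom C w = Cod C s \<Longrightarrow> zarr (w \<cdot> s) \<Longrightarrow> null w"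
  shows "s \<in> L_isos C L"
proof -
  obtain k where k: "is_kernel C k s" "k \<in> Arr C" "Cod C k = Dom C s" "zarr (s \<cdot> k)" "is_mono C k"
    using kernelE[OF s] by metis
  obtain p where p: "is_cokernel C p s" "p \<in> Arr C" "Dom C p = Cod C s" "zarr (p \<cdot> s)" "is_epi C p"
    using cokernelE[OF s] by metis
  have "Dom C k \<in> L" using null_mono[OF k(5) ker[OF k(2-4)]] .
  moreover have "Cod C p \<in> L" using null_epi[OF p(5) cok[OF p(2-4)]] .
  ultimately show ?thesis using k p s unfolding L_isos_def by blast
qed

text \<open>Closure under extensions upgrades the condition on kernel and cokernel to cancellation
  from null composites on either side: \<open>s\<close> acts as a mono and an epi modulo
  \<open>L\<close>.\<close>

lemma L_isosD:
  assumes "s \<in> L_isos C L"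
  shows "s \<in> Arr C"
    and "w \<in> Arr C \<Longrightarrow> Cod C w = Dom C s \<Longrightarrow> null (s \<cdot> w) \<Longrightarrow> null w"
    and "w \<in> Arr C \<Longrightarrow> Dom C w = Cod C s \<Longrightarrow> null (w \<cdot> s) \<Longrightarrow> null w"
proof -
  obtain k p where k: "is_kernel C k s" "Dom C k \<in> L" and p: "is_cokernel C p s" "Cod C p \<in> L"
    using assms unfolding L_isos_def by blast
  show s: "s \<in> Arr C" using assms by (simp add: L_isos_def)
  show "null w" if w: "w \<in> Arr C" "Cod C w = Dom C s" "null (s \<cdot> w)" for w
  proof (rule kernel_null_cancel[OF s _ w])
    fix v assume v: "v \<in> Arr C" "Cod C v = Dom C s" "zarr (s \<cdot> v)"
    obtain h where "h \<in> Arr C" "Cod C h = Dom C k" "k \<cdot> h = v" using kernel_factor[OF k(1) v] by metis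
    then show "null v" using nullI[of h k] k kernelD[OF k(1)] by simp
  qed
  show "null w" if w: "w \<in> Arr C" "Dom C w = Cod C s" "null (w \<cdot> s)" for w
  proof (rule cokernel_null_cancel[OF s _ w])
    fix v assume v: "v \<in> Arr C" "Dom C v = Cod C s" "zarr (v \<cdot> s)"
    obtain h where h: "h \<in> Arr C" "Dom C h = Cod C p" "h \<cdot> p = v" using cokernel_factor[OF p(1) v] by metis
    then have "null h" using null_dom p by simp
    then show "null v" using null_comp_right[of h p] p h cokernelD[OF p(1)] by simp
  qed
qed

lemma L_isos_arr [simp]: "s \<in> L_isos C L \<Longrightarrow> s \<in> Arr C"
  by (rule L_isosD)

lemma L_isos_ident [simp]: "X \<in> Obj C \<Longrightarrow> Ident C X \<in> L_isos C L"
  by (rule L_isosI) (auto intro: null_zarr)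

lemma L_isos_comp:
  assumes "s \<in> L_isos C L" "t \<in> L_isos C L" "Cod C s = Dom C t"
  shows "t \<cdot> s \<in> L_isos C L"
proof (rule L_isosI)
  fix w assume w: "w \<in> Arr C" "Cod C w = Dom C (t \<cdot> s)" "zarr ((t \<cdot> s) \<cdot> w)"
  have "null (t \<cdot> (s \<cdot> w))" using w assms null_zarr by simp
  then have "null (s \<cdot> w)" by (rule L_isosD(2)[OF assms(2), rotated 2]) (use w assms in simp_all)
  then show "null w" by (rule L_isosD(2)[OF assms(1), rotated 2]) (use w assms in simp_all)
next
  fix w assume w: "w \<in> Arr C" "Dom C w = Cod C (t \<cdot> s)" "zarr (w \<cdot> (t \<cdot> s))"
  have "null ((w \<cdot> t) \<cdot> s)" using w assms null_zarr by simp
  then have "null (w \<cdot> t)" by (rule L_isosD(3)[OF assms(1), rotated 2]) (use w assms in simp_all)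
  then show "null w" by (rule L_isosD(3)[OF assms(2), rotated 2]) (use w assms in simp_all)
qed (use assms in simp)

text \<open>The cokernel of \<open>k\<close> is the coimage of \<open>f\<close>, hence isomorphic to
  its image, which lies in \<open>L\<close>; the kernel of \<open>k\<close> is zero.\<close>

lemma null_kernel_iso:
  assumes "null f" "is_kernel C k f"
  shows "k \<in> L_isos C L"
proof (rule L_isosI)
  note kD = kernelD[OF assms(2)]
  fix w assume "w \<in> Arr C" "Cod C w = Dom C k" "zarr (k \<cdot> w)"
  then show "null w" using mono_zeroD[OF kD(5)] null_zarr by blast
next
  note kD = kernelD[OF assms(2)]
  obtain e m where em: "is_epi C e" "is_mono C m" "Dom C e = Dom C f" "Cod C m = Cod C f"
    "Cod C e = Dom C m" "m \<cdot> e = f"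
    using image_factorization[OF kD(2)] by metis
  have dm: "Dom C m \<in> L" using null_image[of e m] assms(1) em by simp
  fix w assume w: "w \<in> Arr C" "Dom C w = Cod C k" "zarr (w \<cdot> k)"
  obtain h where h: "h \<in> Arr C" "Cod C h = Cod C w" "Dom C h = Cod C e" "h \<cdot> e = w"
  proof (rule epi_factor[OF em(1) w(1)])
    show "Dom C w = Dom C e" using w em kD by simp
    fix v assume v: "v \<in> Arr C" "Cod C v = Dom C e" "zarr (e \<cdot> v)"
    have "zarr (m \<cdot> (e \<cdot> v))" by (rule zarr_comp_left[OF v(3)]) (use v em in simp_all)
    then have "zarr (f \<cdot> v)" using comp_rw[OF em(6), of v] v em by simp
    then obtain g where g: "g \<in> Arr C" "Cod C g = Dom C k" "k \<cdot> g = v"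
      using kernel_factor[OF assms(2) v(1)] v em by metis
    have "w \<cdot> v = (w \<cdot> k) \<cdot> g" unfolding g(3)[symmetric] using w(1,2) g(1,2) kD(1) by simp
    then show "zarr (w \<cdot> v)" using zarr_comp_right[OF w(3), of g] w(1,2) g(1,2) kD(1) by simp
  qed
  then show "null w" using null_comp_right[OF null_dom[of h], of e] dm em by simp
qed (use kernelD[OF assms(2)] in simp)

text \<open>The way back from \<open>null\<close> to exact equations in \<open>C\<close>: a null
  arrow becomes zero after composition with an arrow that \<open>C / L\<close> inverts.\<close>

lemma null_restrict:
  assumes "null f"
  obtains k where "k \<in> L_isos C L" "Cod C k = Dom C f" "zarr (f \<cdot> k)" "is_mono C k"
  using kernelE[OF null_arr[OF assms]] null_kernel_iso[OF assms] by metis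

text \<open>Since \<open>m\<close> is monic, the cokernel of \<open>t'\<close> embeds in that of
  \<open>m \<cdot> t'\<close>: it is the image of \<open>p \<cdot> m\<close>. The latter cokernel
  lies in \<open>L\<close> by \<open>cok\<close>, so \<open>w'\<close>, which factors through the
  former, is null.\<close>

lemma cokernel_null_restrict:
  assumes m: "is_mono C m" and t': "t' \<in> Arr C" "Cod C t' = Dom C m"
    and cok: "\<And>w. w \<in> Arr C \<Longrightarrow> Dom C w = Cod C m \<Longrightarrow> zarr (w \<cdot> (m \<cdot> t')) \<Longrightarrow> null w"
    and w': "w' \<in> Arr C" "Dom C w' = Dom C m" "zarr (w' \<cdot> t')"
  shows "null w'"
proof -
  have mA: "m \<in> Arr C" using m by simp
  obtain t1 t2 where t: "is_epi C t1" "is_mono C t2" "Dom C t1 = Dom C t'" "Cod C t2 = Dom C m"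
    "Cod C t1 = Dom C t2" "t2 \<cdot> t1 = t'"
    using image_factorization[OF t'(1)] t'(2) by metis
  have mt: "is_mono C (m \<cdot> t2)" by (rule mono_comp) (use t m in simp_all)
  obtain p where p: "is_cokernel C p (m \<cdot> t2)" "p \<in> Arr C" "Dom C p = Cod C m" "zarr (p \<cdot> (m \<cdot> t2))"
    by (rule cokernelE[of "m \<cdot> t2"]) (use m t in auto)
  have "zarr ((p \<cdot> (m \<cdot> t2)) \<cdot> t1)" by (rule zarr_comp_right[OF p(4)]) (use t m p in simp_all)
  then have np: "null p" using cok[OF p(2,3)] p t mA by simp
  then have npm: "null (p \<cdot> m)" by (rule null_comp_right) (use p m in simp_all)
  obtain \<epsilon> \<mu> where f: "is_epi C \<epsilon>" "is_mono C \<mu>" "Dom C \<epsilon> = Dom C (p \<cdot> m)" "Cod C \<mu> = Cod C (p \<cdot> m)"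
    "Cod C \<epsilon> = Dom C \<mu>" "\<mu> \<cdot> \<epsilon> = p \<cdot> m"
    using image_factorization[OF null_arr[OF npm]] by metis
  have d: "Dom C \<epsilon> = Dom C m" using f p m by simp
  have "Cod C \<epsilon> \<in> L" using null_image[of \<epsilon> \<mu>] f npm by simp
  have z: "zarr (w' \<cdot> t2)"
  proof (rule epi_zeroD[OF t(1)])
    show "zarr ((w' \<cdot> t2) \<cdot> t1)" using w' t by simp
  qed (use w' t in simp_all)
  obtain h where h: "h \<in> Arr C" "Cod C h = Cod C w'" "Dom C h = Cod C \<epsilon>" "h \<cdot> \<epsilon> = w'"
  proof (rule epi_factor[OF f(1) w'(1)])
    show "Dom C w' = Dom C \<epsilon>" using w' d by simp
    fix v assume v: "v \<in> Arr C" "Cod C v = Dom C \<epsilon>" "zarr (\<epsilon> \<cdot> v)"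
    have "zarr (\<mu> \<cdot> (\<epsilon> \<cdot> v))" by (rule zarr_comp_left[OF v(3)]) (use v f in simp_all)
    then have "zarr (p \<cdot> (m \<cdot> v))" using comp_rw[OF f(6), of v] v f(1,2,5) d p(2,3) mA by simp
    then obtain y where y: "y \<in> Arr C" "Dom C y = Dom C (m \<cdot> v)" "Cod C y = Dom C (m \<cdot> t2)" "(m \<cdot> t2) \<cdot> y = m \<cdot> v"
      using kernel_factor[OF mono_kernel_cokernel[OF mt p(1)], of "m \<cdot> v"] v d p(3) mA by auto
    have "m \<cdot> (t2 \<cdot> y) = m \<cdot> v" using y t mA by simp
    then have "t2 \<cdot> y = v" by (rule monoD[OF m]) (use y t mA v d in simp_all)
    then have "w' \<cdot> v = (w' \<cdot> t2) \<cdot> y" using y t mA v d w' by auto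
    then show "zarr (w' \<cdot> v)" using zarr_comp_right[OF z, of y] w' y t mA by simp
  qed
  then show ?thesis using null_comp_right[OF null_dom[of h], of \<epsilon>] \<open>Cod C \<epsilon> \<in> L\<close> f by simp
qed

text \<open>This is the Ore condition. If \<open>u \<cdot> w\<close> is zero, then so is
  \<open>t \<cdot> v \<cdot> w\<close>, whence \<open>v \<cdot> w\<close> is null and vanishes after
  some \<open>k\<close> inverted modulo \<open>L\<close>; joint monicity gives
  \<open>w \<cdot> k = 0\<close>, and \<open>k\<close> is cancelled. The cokernel of
  \<open>u\<close> is controlled by the second property of \<open>ex_pullback\<close>, which turns a
  \<open>w\<close> killing \<open>u\<close> into a \<open>w'\<close> killing
  \<open>t'\<close>.\<close>

lemma ex_pullback_iso:
  assumes f: "f \<in> Arr C" and t: "t \<in> L_isos C L" and e: "Cod C f = Cod C t"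
  obtains u v where "pullback f t u v" "u \<in> L_isos C L"
proof -
  have tA: "t \<in> Arr C" using t by simp
  obtain u v where pb: "pullback f t u v"
    and epi: "\<forall>w. w \<in> Arr C \<and> Dom C w = Cod C u \<and> zarr (w \<cdot> u) \<longrightarrow>
       (\<exists>m f' t' w'. is_mono C m \<and> f' \<in> Arr C \<and> t' \<in> Arr C \<and> w' \<in> Arr C \<and> Cod C f' = Dom C m \<and>
         Cod C t' = Dom C m \<and> Dom C w' = Dom C m \<and> m \<cdot> f' = f \<and> m \<cdot> t' = t \<and> w' \<cdot> f' = w \<and> zarr (w' \<cdot> t'))"
    by (rule ex_pullback[OF f tA e])
  note uv = pullbackD[OF pb]
  have "u \<in> L_isos C L"
  proof (rule L_isosI[OF uv(1)])
    fix w assume w: "w \<in> Arr C" "Cod C w = Dom C u" "zarr (u \<cdot> w)"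
    have "f \<cdot> (u \<cdot> w) = t \<cdot> (v \<cdot> w)" by (rule comp_reassoc[OF uv(6)]) (use f tA uv w in simp_all)
    moreover have "zarr (f \<cdot> (u \<cdot> w))" by (rule zarr_comp_left[OF w(3)]) (use f uv w in simp_all)
    ultimately have "null (t \<cdot> (v \<cdot> w))" using null_zarr by simp
    then have "null (v \<cdot> w)" by (rule L_isosD(2)[OF t, rotated 2]) (use uv w in simp_all)
    then obtain k where k: "k \<in> L_isos C L" "Cod C k = Dom C (v \<cdot> w)" "zarr ((v \<cdot> w) \<cdot> k)"
      using null_restrict by metis
    have dk: "Cod C k = Dom C w" using k uv w by simp
    have zvk: "zarr (v \<cdot> w \<cdot> k)" using k(3) k(1) dk uv(1-5) w by simp
    have "zarr ((u \<cdot> w) \<cdot> k)" by (rule zarr_comp_right[OF w(3)]) (use k dk uv w in simp_all)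
    then have "zarr (w \<cdot> k)" using pullback_jointly_mono[OF pb, of "w \<cdot> k"] zvk k dk uv(1-5) w by simp
    then show "null w" by (rule L_isosD(3)[OF k(1) w(1) _ null_zarr, rotated 1]) (simp add: dk)
  next
    fix w assume w: "w \<in> Arr C" "Dom C w = Cod C u" "zarr (w \<cdot> u)"
    obtain m f' t' w' where m: "is_mono C m" "f' \<in> Arr C" "t' \<in> Arr C" "w' \<in> Arr C" "Cod C f' = Dom C m"
         "Cod C t' = Dom C m" "Dom C w' = Dom C m" "m \<cdot> f' = f" "m \<cdot> t' = t" "w' \<cdot> f' = w" "zarr (w' \<cdot> t')"
      using epi w by blast
    have "null w'"
    proof (rule cokernel_null_restrict[OF m(1,3,6) _ m(4,7,11)])
      fix x assume x: "x \<in> Arr C" "Dom C x = Cod C m" "zarr (x \<cdot> (m \<cdot> t'))"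
      have "Cod C m = Cod C t" using m(1,3,6,9) arr_comp(3)[of t' m] by simp
      then show "null x" using L_isosD(3)[OF t x(1)] x null_zarr m by simp
    qed
    then show "null w" using null_comp_right[of w' f'] m by simp
  qed
  then show ?thesis using that[OF pb] by blast
qed

text \<open>For the cokernel, complete \<open>s\<close> and \<open>s \<cdot> u\<close> to an Ore
  square \<open>s \<cdot> a = s \<cdot> u \<cdot> b\<close>. Then \<open>a\<close> and
  \<open>u \<cdot> b\<close> differ by a null arrow, so an arrow \<open>w\<close> killing
  \<open>u\<close> has \<open>w \<cdot> a\<close> null, and \<open>a\<close> can be
  cancelled.\<close>

lemma L_isos_cancel_left:
  assumes s: "s \<in> L_isos C L" and su: "s \<cdot> u \<in> L_isos C L" and u: "u \<in> Arr C" "Cod C u = Dom C s"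
  shows "u \<in> L_isos C L"
proof (rule L_isosI[OF u(1)])
  have sA: "s \<in> Arr C" using s by simp
  fix w assume w: "w \<in> Arr C" "Cod C w = Dom C u" "zarr (u \<cdot> w)"
  have "zarr (s \<cdot> (u \<cdot> w))" by (rule zarr_comp_left[OF w(3)]) (use sA u w in simp_all)
  then have "null ((s \<cdot> u) \<cdot> w)" using null_zarr sA u w by simp
  then show "null w" by (rule L_isosD(2)[OF su, rotated 2]) (use w u sA in simp_all)
next
  have sA: "s \<in> Arr C" using s by simp
  fix w assume w: "w \<in> Arr C" "Dom C w = Cod C u" "zarr (w \<cdot> u)"
  obtain a b where pb: "pullback s (s \<cdot> u) a b" and a: "a \<in> L_isos C L"
    by (rule ex_pullback_iso[OF sA su]) (use sA u in auto)
  note ab = a pullbackD(2-6)[OF pb]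
  have aA: "a \<in> Arr C" and bc: "Cod C b = Dom C u" using ab u sA by simp_all
  have "s \<cdot> diff a (u \<cdot> b) = diff (s \<cdot> a) (s \<cdot> (u \<cdot> b))"
    using ab(2-5) aA bc u sA by (simp add: comp_diff)
  then have "zarr (s \<cdot> diff a (u \<cdot> b))" using ab(2-6) aA bc u sA by (simp add: zarr_diff_iff)
  then have n: "null (diff a (u \<cdot> b))"
    by (rule L_isosD(2)[OF s _ _ null_zarr, rotated 2]) (use ab(2-5) aA bc u in simp_all)
  have "zarr ((w \<cdot> u) \<cdot> b)" by (rule zarr_comp_right[OF w(3)]) (use bc ab(2) w u in simp_all)
  then have z: "zarr (w \<cdot> (u \<cdot> b))" using bc ab(2) w u by simp
  have "w \<cdot> diff a (u \<cdot> b) = diff (w \<cdot> a) (w \<cdot> (u \<cdot> b))"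
    using ab(2-5) aA bc u w by (simp add: comp_diff)
  also have "\<dots> = w \<cdot> a" using z ab(2-5) aA bc u w by (simp add: zarr_def diff_def neg_zero)
  finally have "null (w \<cdot> a)" using null_comp_left[OF n, of w] ab(2-5) aA bc u w by simp
  then show "null w" by (rule L_isosD(3)[OF ab(1) w(1), rotated]) (use ab(4) u w in simp)
qed

text \<open>The cancellation axiom of the calculus of right fractions: \<open>f - g\<close> is null
  because \<open>t\<close> kills it, and \<open>null_restrict\<close> supplies
  \<open>c\<close>.\<close>

lemma L_isos_equalize:
  assumes t: "t \<in> L_isos C L" and eq: "t \<cdot> f = t \<cdot> g" and f: "f \<in> Arr C" "Cod C f = Dom C t"
    and g: "g \<in> Arr C" "Cod C g = Dom C t" "Dom C f = Dom C g"
  obtains c where "c \<in> L_isos C L" "Cod C c = Dom C g" "f \<cdot> c = g \<cdot> c"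
proof -
  have tA: "t \<in> Arr C" using t by simp
  have "zarr (t \<cdot> diff f g)" using eq f g tA by (simp add: comp_diff zarr_diff_iff)
  then have n: "null (diff f g)" by (rule L_isosD(2)[OF t _ _ null_zarr, rotated 2]) (use f g in simp_all)
  obtain c where c: "c \<in> L_isos C L" "Cod C c = Dom C (diff f g)" "zarr (diff f g \<cdot> c)"
    using null_restrict[OF n] by metis
  have cA: "c \<in> Arr C" and cc: "Cod C c = Dom C g" using c f g by simp_all
  have "f \<cdot> c = g \<cdot> c" using c(3) f g cA cc by (simp add: diff_comp zarr_diff_iff)
  then show ?thesis using that c cc by blast
qed

lemma mono_isoI:
  assumes "is_mono C m" "\<And>w. w \<in> Arr C \<Longrightarrow> Dom C w = Cod C m \<Longrightarrow> zarr (w \<cdot> m) \<Longrightarrow> null w"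
  shows "m \<in> L_isos C L"
proof (rule L_isosI)
  fix w assume "w \<in> Arr C" "Cod C w = Dom C m" "zarr (m \<cdot> w)"
  then show "null w" using mono_zeroD[OF assms(1)] null_zarr by blast
qed (use assms in auto)

lemma mono_iso_cokernel:
  assumes "is_mono C m" "is_cokernel C p m" "Cod C p \<in> L"
  shows "m \<in> L_isos C L"
proof (rule mono_isoI[OF assms(1)])
  fix w assume w: "w \<in> Arr C" "Dom C w = Cod C m" "zarr (w \<cdot> m)"
  obtain h where h: "h \<in> Arr C" "Dom C h = Cod C p" "h \<cdot> p = w" using cokernel_factor[OF assms(2) w] by metis
  have "null h" using null_dom h assms(3) by simp
  then have "null (h \<cdot> p)" by (rule null_comp_right) (use cokernelD(1)[OF assms(2)] h in simp_all)
  then show "null w" using h by simp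
qed

end

text \<open>For this class \<open>null\<close> means zero, so results modulo \<open>L\<close>
  specialize to exactness statements in \<open>C\<close> itself.\<close>

lemma (in abelian_category) serre_zero: "serre_subcategory C {N. is_zero_obj C N}"
proof unfold_locales
  show "Dom C i \<in> {N. is_zero_obj C N}" if i: "is_mono C i" "Cod C i \<in> {N. is_zero_obj C N}" for i
  proof -
    have "zarr (Ident C (Cod C i))" using i zero_obj_iff[of "Cod C i"] by simp
    then have "zarr (Ident C (Cod C i) \<cdot> i)" by (rule zarr_comp_right) (use i in simp_all)
    then have "zarr (i \<cdot> Ident C (Dom C i))" using i(1) by simp
    then have "zarr (Ident C (Dom C i))" by (rule mono_zeroD[OF i(1)]) (use i(1) in simp_all)
    then show ?thesis using zero_obj_iff i by simp
  qed
  show "Cod C i \<in> {N. is_zero_obj C N}" if i: "is_epi C i" "Dom C i \<in> {N. is_zero_obj C N}" for i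
  proof -
    have "zarr (Ident C (Dom C i))" using i zero_obj_iff[of "Dom C i"] by simp
    then have "zarr (i \<cdot> Ident C (Dom C i))" by (rule zarr_comp_left) (use i in simp_all)
    then have "zarr (Ident C (Cod C i) \<cdot> i)" using i(1) by simp
    then have "zarr (Ident C (Cod C i))" by (rule epi_zeroD[OF i(1)]) (use i(1) in simp_all)
    then show ?thesis using zero_obj_iff i by simp
  qed
  show "Cod C i \<in> {N. is_zero_obj C N}"
    if ip: "short_exact C i p" "Dom C i \<in> {N. is_zero_obj C N}" "Cod C p \<in> {N. is_zero_obj C N}" for i p
  proof -
    have k: "is_kernel C i p" using ip by (simp add: short_exact_def)
    note kD = kernelD[OF k]
    have "zarr (Ident C (Cod C p) \<cdot> p)"
      by (rule zarr_comp_right) (use ip kD zero_obj_iff[of "Cod C p"] in simp_all)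
    then have "zarr (p \<cdot> Ident C (Cod C i))" using kD by simp
    then obtain h where h: "h \<in> Arr C" "Dom C h = Dom C (Ident C (Cod C i))" "Cod C h = Dom C i" "i \<cdot> h = Ident C (Cod C i)"
      by (rule kernel_factor[OF k, rotated 2]) (use kD in auto)
    have "zarr (Ident C (Dom C i) \<cdot> h)"
      by (rule zarr_comp_right) (use ip kD h zero_obj_iff[of "Dom C i"] in simp_all)
    then have "zarr h" using h by simp
    then have "zarr (i \<cdot> h)" by (rule zarr_comp_left) (use h kD in simp_all)
    then show ?thesis using h kD zero_obj_iff by simp
  qed
qed (simp add: is_zero_obj_def)+

section \<open>The quotient category\<close>

locale serre_quotient = serre_subcategory C L
  for C :: "('o, 'm) addcat" (structure) and L :: "'o set"
begin

abbreviation Q :: "('o, 'o \<times> 'o \<times> ('m \<times> 'm) set) addcat" where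
  "Q \<equiv> quotient_category C L"

text \<open>Unlike in \<open>roofs\<close>, no ends are prescribed: \<open>frac\<close> reads them
  off the two legs, so an arrow of the quotient is written with its representative only.\<close>

definition roof :: "'m \<Rightarrow> 'm \<Rightarrow> bool" where
  "roof s f \<longleftrightarrow> s \<in> L_isos C L \<and> f \<in> Arr C \<and> Dom C f = Dom C s"

definition frac :: "'m \<Rightarrow> 'm \<Rightarrow> 'o \<times> 'o \<times> ('m \<times> 'm) set" where
  "frac s f = (Cod C s, Cod C f, roof_class C L (Cod C s) (Cod C f) (s, f))"

lemma roofD:
  assumes "roof s f"
  shows "s \<in> L_isos C L" "s \<in> Arr C" "f \<in> Arr C" "Dom C f = Dom C s"
  using assms by (simp_all add: roof_def)

lemma in_roofs: "(s, f) \<in> roofs C L X Y \<longleftrightarrow> roof s f \<and> Cod C s = X \<and> Cod C f = Y"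
  by (auto simp: roofs_def roof_def in_hom)

lemma roof_eq_iff:
  "roof_eq C L (s, f) (t, g) \<longleftrightarrow> (\<exists>u v. u \<in> Arr C \<and> v \<in> Arr C \<and> Dom C u = Dom C v \<and> Cod C u = Dom C s \<and>
     Cod C v = Dom C t \<and> s \<cdot> u = t \<cdot> v \<and> s \<cdot> u \<in> L_isos C L \<and> f \<cdot> u = g \<cdot> v)" (is "?l \<longleftrightarrow> ?r")
proof
  assume ?l
  then obtain W u v where "u \<in> homset C W (Dom C s)" "v \<in> homset C W (Dom C t)" "s \<cdot> u = t \<cdot> v"
    "s \<cdot> u \<in> L_isos C L" "f \<cdot> u = g \<cdot> v" unfolding roof_eq_def by auto
  then show ?r unfolding in_hom by (intro exI[of _ u] exI[of _ v]) simp
next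
  assume ?r
  then obtain u v where "u \<in> Arr C" "v \<in> Arr C" "Dom C u = Dom C v" "Cod C u = Dom C s"
     "Cod C v = Dom C t" "s \<cdot> u = t \<cdot> v" "s \<cdot> u \<in> L_isos C L" "f \<cdot> u = g \<cdot> v" by blast
  then show ?l unfolding roof_eq_def in_hom split
    by (intro exI[of _ "Dom C v"] exI[of _ u] exI[of _ v]) (metis obj_dom_cod)
qed

lemma oreE:
  assumes "f \<in> Arr C" "t \<in> L_isos C L" "Cod C f = Cod C t"
  obtains u v where "u \<in> L_isos C L" "u \<in> Arr C" "v \<in> Arr C" "Dom C u = Dom C v" "Cod C u = Dom C f"
    "Cod C v = Dom C t" "f \<cdot> u = t \<cdot> v"
proof (rule ex_pullback_iso[OF assms])
  fix u v assume pb: "pullback f t u v" and u: "u \<in> L_isos C L"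
  show thesis by (rule that[OF u pullbackD[OF pb]])
qed

lemma roof_eqI:
  assumes "roof s f" "roof t g" "u \<in> Arr C" "v \<in> Arr C" "Dom C u = Dom C v" "Cod C u = Dom C s"
     "Cod C v = Dom C t" "s \<cdot> u = t \<cdot> v" "s \<cdot> u \<in> L_isos C L" "f \<cdot> u = g \<cdot> v"
  shows "roof_eq C L (s, f) (t, g)"
  unfolding roof_eq_iff using assms by blast

lemma roof_eq_refl:
  assumes "roof s f"
  shows "roof_eq C L (s, f) (s, f)"
  by (rule roof_eqI[OF assms assms, of "Ident C (Dom C s)" "Ident C (Dom C s)"])
    (use roofD[OF assms] in simp_all)

lemma roof_eq_sym:
  assumes "roof_eq C L (s, f) (t, g)"
  shows "roof_eq C L (t, g) (s, f)"
proof -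
  obtain u v where "u \<in> Arr C" "v \<in> Arr C" "Dom C u = Dom C v" "Cod C u = Dom C s"
     "Cod C v = Dom C t" "s \<cdot> u = t \<cdot> v" "s \<cdot> u \<in> L_isos C L" "f \<cdot> u = g \<cdot> v"
    using assms unfolding roof_eq_iff by blast
  then show ?thesis unfolding roof_eq_iff by (intro exI[of _ v] exI[of _ u]) simp
qed

text \<open>The Ore condition makes the two given refinements meet over the codomain of
  \<open>t\<close>, after \<open>a\<close> and \<open>b\<close>. As \<open>t\<close> need not be
  monic, a further \<open>c\<close> is required to make them meet over its domain.\<close>

lemma roof_eq_trans:
  assumes "roof_eq C L (s, f) (t, g)" "roof_eq C L (t, g) (r, h)" "roof s f" "roof t g" "roof r h"
  shows "roof_eq C L (s, f) (r, h)"
proof -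
  note sD = roofD[OF assms(3)] and tD = roofD[OF assms(4)] and rD = roofD[OF assms(5)]
  obtain u v where u: "u \<in> Arr C" "v \<in> Arr C" "Dom C u = Dom C v" "Cod C u = Dom C s"
     "Cod C v = Dom C t" "s \<cdot> u = t \<cdot> v" "s \<cdot> u \<in> L_isos C L" "f \<cdot> u = g \<cdot> v"
    using assms(1) unfolding roof_eq_iff by blast
  obtain u' v' where u': "u' \<in> Arr C" "v' \<in> Arr C" "Dom C u' = Dom C v'" "Cod C u' = Dom C t"
     "Cod C v' = Dom C r" "t \<cdot> u' = r \<cdot> v'" "t \<cdot> u' \<in> L_isos C L" "g \<cdot> u' = h \<cdot> v'"
    using assms(2) unfolding roof_eq_iff by blast
  have tv: "t \<cdot> v \<in> Arr C" "Dom C (t \<cdot> v) = Dom C v" "Cod C (t \<cdot> v) = Cod C t"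
    "t \<cdot> u' \<in> Arr C" "Dom C (t \<cdot> u') = Dom C v'" "Cod C (t \<cdot> u') = Cod C t"
    using u(1-5) u'(1-5) tD by simp_all
  obtain a b where a: "a \<in> L_isos C L" "a \<in> Arr C" "b \<in> Arr C" "Dom C a = Dom C b" "Cod C a = Dom C v"
    "Cod C b = Dom C v'" "(t \<cdot> v) \<cdot> a = (t \<cdot> u') \<cdot> b"
    using oreE[OF tv(1) u'(7)] tv by metis
  have "t \<cdot> (v \<cdot> a) = t \<cdot> (u' \<cdot> b)" using a u(1-5) u'(1-5) tD by simp
  then obtain c where c: "c \<in> L_isos C L" "Cod C c = Dom C (u' \<cdot> b)" "(v \<cdot> a) \<cdot> c = (u' \<cdot> b) \<cdot> c"
    by (rule L_isos_equalize[OF tD(1)]) (use a u u' tD in auto)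
  have cA: "c \<in> Arr C" and cc: "Cod C c = Dom C b" using c a u' by simp_all
  have e: "v \<cdot> a \<cdot> c = u' \<cdot> b \<cdot> c" using c(3) cA cc a u u' by simp
  show ?thesis
  proof (rule roof_eqI[OF assms(3,5)])
    show "u \<cdot> a \<cdot> c \<in> Arr C" "v' \<cdot> b \<cdot> c \<in> Arr C" "Dom C (u \<cdot> a \<cdot> c) = Dom C (v' \<cdot> b \<cdot> c)"
      "Cod C (u \<cdot> a \<cdot> c) = Dom C s" "Cod C (v' \<cdot> b \<cdot> c) = Dom C r"
      using cA cc a u u' by simp_all
    have "s \<cdot> u \<cdot> a \<cdot> c = t \<cdot> v \<cdot> a \<cdot> c"
      by (rule comp_reassoc[OF u(6)]) (use cA cc a u sD tD in simp_all)
    also have "\<dots> = t \<cdot> u' \<cdot> b \<cdot> c" by (simp add: e)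
    also have "\<dots> = r \<cdot> v' \<cdot> b \<cdot> c"
      by (rule comp_reassoc[OF u'(6)]) (use cA cc a u' rD tD in simp_all)
    finally show "s \<cdot> u \<cdot> a \<cdot> c = r \<cdot> v' \<cdot> b \<cdot> c" .
    have "(s \<cdot> u) \<cdot> a \<cdot> c \<in> L_isos C L"
      by (intro L_isos_comp u(7) a(1) c(1)) (use cA cc a u(1-5) sD in simp_all)
    then show "s \<cdot> u \<cdot> a \<cdot> c \<in> L_isos C L" using cA cc a u(1-5) sD by simp
    have "f \<cdot> u \<cdot> a \<cdot> c = g \<cdot> v \<cdot> a \<cdot> c"
      by (rule comp_reassoc[OF u(8)]) (use cA cc a u sD tD in simp_all)
    also have "\<dots> = g \<cdot> u' \<cdot> b \<cdot> c" by (simp add: e)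
    also have "\<dots> = h \<cdot> v' \<cdot> b \<cdot> c"
      by (rule comp_reassoc[OF u'(8)]) (use cA cc a u' rD tD in simp_all)
    finally show "f \<cdot> u \<cdot> a \<cdot> c = h \<cdot> v' \<cdot> b \<cdot> c" .
  qed
qed

lemma in_roof_class:
  "(s', f') \<in> roof_class C L X Y (s, f) \<longleftrightarrow>
     roof s' f' \<and> Cod C s' = X \<and> Cod C f' = Y \<and> roof_eq C L (s, f) (s', f')"
  by (auto simp: roof_class_def in_roofs)

lemma roof_class_eqI:
  assumes "roof_eq C L (s, f) (t, g)" "roof s f" "roof t g"
  shows "roof_class C L X Y (s, f) = roof_class C L X Y (t, g)"
proof -
  have "roof_eq C L (s, f) (r, h) \<longleftrightarrow> roof_eq C L (t, g) (r, h)" if "roof r h" for r h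
    using roof_eq_trans roof_eq_sym assms that by blast
  then show ?thesis by (auto simp: set_eq_iff in_roof_class)
qed

lemma frac_eq_iff:
  assumes "roof s f" "roof t g"
  shows "frac s f = frac t g \<longleftrightarrow> Cod C s = Cod C t \<and> Cod C f = Cod C g \<and> roof_eq C L (s, f) (t, g)"
proof
  assume eq: "frac s f = frac t g"
  have "(t, g) \<in> roof_class C L (Cod C t) (Cod C g) (t, g)"
    using assms roof_eq_refl by (simp add: in_roof_class)
  moreover have "roof_class C L (Cod C t) (Cod C g) (t, g) = roof_class C L (Cod C s) (Cod C f) (s, f)"
    using eq unfolding frac_def by (metis prod.inject)
  ultimately have "(t, g) \<in> roof_class C L (Cod C s) (Cod C f) (s, f)" by simp
  then show "Cod C s = Cod C t \<and> Cod C f = Cod C g \<and> roof_eq C L (s, f) (t, g)"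
    using eq by (simp add: in_roof_class frac_def)
next
  assume "Cod C s = Cod C t \<and> Cod C f = Cod C g \<and> roof_eq C L (s, f) (t, g)"
  then show "frac s f = frac t g" using roof_class_eqI[of s f t g] assms by (simp add: frac_def)
qed

lemma frac_expand:
  assumes "roof s f" "u \<in> Arr C" "Cod C u = Dom C s" "s \<cdot> u \<in> L_isos C L"
  shows "frac (s \<cdot> u) (f \<cdot> u) = frac s f" "roof (s \<cdot> u) (f \<cdot> u)"
proof -
  note sD = roofD[OF assms(1)]
  show r: "roof (s \<cdot> u) (f \<cdot> u)" using assms sD by (simp add: roof_def)
  have "roof_eq C L (s \<cdot> u, f \<cdot> u) (s, f)"
    by (rule roof_eqI[OF r assms(1), of "Ident C (Dom C u)" u]) (use assms sD in simp_all)
  then show "frac (s \<cdot> u) (f \<cdot> u) = frac s f" using frac_eq_iff[OF r assms(1)] assms sD by simp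
qed

text \<open>A common refinement gives \<open>s \<cdot> u = s \<cdot> v\<close> with possibly
  different \<open>u\<close> and \<open>v\<close>; \<open>e\<close> equalizes them, and
  \<open>f - g\<close> vanishes on \<open>u \<cdot> e\<close>, which is inverted modulo
  \<open>L\<close>. Conversely, restrict to the kernel of the difference. This reduces equality in
  the quotient to nullity in \<open>C\<close>.\<close>

lemma roof_eq_same_denominator:
  assumes r: "roof s f" "roof s g" and c: "Cod C f = Cod C g"
  shows "roof_eq C L (s, f) (s, g) \<longleftrightarrow> null (diff f g)"
proof
  note sD = roofD[OF r(1)] and gD = roofD[OF r(2)]
  assume "roof_eq C L (s, f) (s, g)"
  then obtain u v where u: "u \<in> Arr C" "v \<in> Arr C" "Dom C u = Dom C v" "Cod C u = Dom C s"
     "Cod C v = Dom C s" "s \<cdot> u = s \<cdot> v" "s \<cdot> u \<in> L_isos C L" "f \<cdot> u = g \<cdot> v"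
    unfolding roof_eq_iff by blast
  have us: "u \<in> L_isos C L" by (rule L_isos_cancel_left[OF sD(1) u(7)]) (use u in simp_all)
  obtain e where e: "e \<in> L_isos C L" "Cod C e = Dom C v" "u \<cdot> e = v \<cdot> e"
    using L_isos_equalize[OF sD(1) u(6) u(1,4,2,5,3)] by metis
  have eA: "e \<in> Arr C" using e by simp
  have "f \<cdot> (u \<cdot> e) = g \<cdot> (v \<cdot> e)" by (rule comp_reassoc[OF u(8)]) (use u e eA sD gD in simp_all)
  then have "zarr (diff f g \<cdot> (u \<cdot> e))"
    using u e eA sD gD c by (simp add: diff_comp zarr_diff_iff)
  then have "null (diff f g \<cdot> (u \<cdot> e))" by (rule null_zarr)
  moreover have "u \<cdot> e \<in> L_isos C L" by (rule L_isos_comp[OF e(1) us]) (use u e in simp)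
  ultimately show "null (diff f g)"
    by (rule L_isosD(3)[rotated -1]) (use u e eA sD gD c in simp_all)
next
  note sD = roofD[OF r(1)] and gD = roofD[OF r(2)]
  assume n: "null (diff f g)"
  obtain k where k: "k \<in> L_isos C L" "Cod C k = Dom C (diff f g)" "zarr (diff f g \<cdot> k)"
    using null_restrict[OF n] by metis
  have kA: "k \<in> Arr C" and kc: "Cod C k = Dom C s" using k sD gD c by simp_all
  have "f \<cdot> k = g \<cdot> k" using k(3) kA kc sD gD c by (simp add: diff_comp zarr_diff_iff)
  then show "roof_eq C L (s, f) (s, g)"
    by (intro roof_eqI[OF r, of k k] L_isos_comp) (use k kA kc sD in simp_all)
qed

lemma frac_eq_null:
  assumes "roof s f" "roof s g" "Cod C f = Cod C g"
  shows "frac s f = frac s g \<longleftrightarrow> null (diff f g)"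
  using frac_eq_iff[OF assms(1,2)] roof_eq_same_denominator[OF assms] assms(3) by simp

section \<open>Composition and addition of fractions\<close>

lemma Q_simps [simp]:
  "Obj Q = Obj C" "Dom Q (frac s f) = Cod C s" "Cod Q (frac s f) = Cod C f"
  by (simp_all add: quotient_category_def frac_def)

lemma Q_ident_zero:
  "Ident Q X = (X, X, roof_class C L X X (Ident C X, Ident C X))"
  "Zero Q X Y = (X, Y, roof_class C L X Y (Ident C X, Zero C X Y))"
  by (simp_all add: quotient_category_def)

lemma frac_arr [simp]:
  assumes "roof s f"
  shows "frac s f \<in> Arr Q"
proof -
  have "(s, f) \<in> roofs C L (Cod C s) (Cod C f)" using assms by (simp add: in_roofs)
  then show ?thesis using roofD[OF assms] unfolding quotient_category_def frac_def by fastforce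
qed

lemma fracE:
  assumes "a \<in> Arr Q"
  obtains s f where "roof s f" "a = frac s f"
  using assms that unfolding quotient_category_def by (auto simp: frac_def in_roofs)

lemma in_homset_frac:
  "a \<in> homset Q X Y \<longleftrightarrow> (\<exists>s f. roof s f \<and> Cod C s = X \<and> Cod C f = Y \<and> a = frac s f)"
proof
  assume a: "a \<in> homset Q X Y"
  then obtain s f where "roof s f" "a = frac s f" using fracE unfolding homset_def by blast
  then show "\<exists>s f. roof s f \<and> Cod C s = X \<and> Cod C f = Y \<and> a = frac s f"
    using a by (auto simp: homset_def)
qed (auto simp: homset_def)

text \<open>Refining both factors does not change the composite. The refined roofs are given by
  variables \<open>\<sigma>\<close>, \<open>\<phi>\<close>, \<open>\<tau>\<close>,
  \<open>\<gamma>\<close> with equations, so that one common refinement can be read as a refinement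
  of either representative.\<close>

lemma roof_comp_wd_aux:
  assumes r: "roof s f" "roof t g" "Cod C f = Cod C t"
    and ab: "a \<in> Arr C" "Cod C a = Dom C s" "b \<in> Arr C" "Cod C b = Dom C t"
    and sa: "s \<cdot> a = \<sigma>" "f \<cdot> a = \<phi>" "t \<cdot> b = \<tau>" "g \<cdot> b = \<gamma>" "\<sigma> \<in> L_isos C L" "\<tau> \<in> L_isos C L"
    and u: "u \<in> L_isos C L" "v \<in> Arr C" "Dom C u = Dom C v" "Cod C u = Dom C s" "Cod C v = Dom C t" "f \<cdot> u = t \<cdot> v"
    and u': "u' \<in> L_isos C L" "v' \<in> Arr C" "Dom C u' = Dom C v'" "Cod C u' = Dom C a" "Cod C v' = Dom C b"
      "\<phi> \<cdot> u' = \<tau> \<cdot> v'"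
  shows "roof_eq C L (s \<cdot> u, g \<cdot> v) (\<sigma> \<cdot> u', \<gamma> \<cdot> v')"
proof -
  note sD = roofD[OF r(1)] and tD = roofD[OF r(2)]
  have uA: "u \<in> Arr C" "u' \<in> Arr C" using u u' by simp_all
  have dc: "Dom C \<sigma> = Dom C a" "Cod C \<sigma> = Cod C s" "Dom C \<phi> = Dom C a" "Cod C \<phi> = Cod C f"
      "Dom C \<tau> = Dom C b" "Cod C \<tau> = Cod C t" "Dom C \<gamma> = Dom C b" "Cod C \<gamma> = Cod C g"
      "\<sigma> \<in> Arr C" "\<phi> \<in> Arr C" "\<tau> \<in> Arr C" "\<gamma> \<in> Arr C"
    unfolding sa(1-4)[symmetric] using ab sD tD by simp_all
  have su: "s \<cdot> u \<in> L_isos C L" by (rule L_isos_comp) (use u sD in simp_all)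
  have su': "\<sigma> \<cdot> u' \<in> L_isos C L" by (rule L_isos_comp) (use u' sa dc in simp_all)
  have "s \<cdot> u \<in> Arr C" "Dom C (s \<cdot> u) = Dom C v" "Cod C (s \<cdot> u) = Cod C (\<sigma> \<cdot> u')" "Dom C (\<sigma> \<cdot> u') = Dom C v'"
    using u u' uA sD dc by simp_all
  then obtain e e' where e: "e \<in> L_isos C L" "e \<in> Arr C" "e' \<in> Arr C" "Dom C e = Dom C e'" "Cod C e = Dom C v"
    "Cod C e' = Dom C v'" "(s \<cdot> u) \<cdot> e = (\<sigma> \<cdot> u') \<cdot> e'"
    using oreE[OF _ su', of "s \<cdot> u"] by metis
  have e7: "s \<cdot> u \<cdot> e = \<sigma> \<cdot> u' \<cdot> e'" using e u u' uA sD dc by simp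
  \<comment> \<open>Neither \<open>s\<close> nor, below, \<open>t\<close> need be monic: cancelling
    them costs the further refinements \<open>c\<close> and \<open>d\<close>.\<close>
  have "s \<cdot> (u \<cdot> e) = s \<cdot> (a \<cdot> u' \<cdot> e')"
    using e7 comp_rw[OF sa(1), of "u' \<cdot> e'"] ab sD u' uA e by simp
  then obtain c where c: "c \<in> L_isos C L" "Cod C c = Dom C (a \<cdot> u' \<cdot> e')" "(u \<cdot> e) \<cdot> c = (a \<cdot> u' \<cdot> e') \<cdot> c"
    by (rule L_isos_equalize[OF sD(1)]) (use e(2-6) u(2-5) u'(2-5) uA sD(2) ab in auto)
  have cA: "c \<in> Arr C" and cc: "Cod C c = Dom C e'" using c e u' uA ab by simp_all
  have c3: "u \<cdot> e \<cdot> c = a \<cdot> u' \<cdot> e' \<cdot> c" using c(3) cA cc e u u' uA ab by simp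
  have "t \<cdot> (v \<cdot> e \<cdot> c) = f \<cdot> (u \<cdot> e \<cdot> c)"
    by (rule comp_reassoc[OF u(6)[symmetric]]) (use cA cc e u uA sD tD in simp_all)
  also have "\<dots> = f \<cdot> a \<cdot> u' \<cdot> e' \<cdot> c" by (simp add: c3)
  also have "\<dots> = \<phi> \<cdot> u' \<cdot> e' \<cdot> c" by (rule comp_rw[OF sa(2)]) (use cA cc e u' uA ab sD in simp_all)
  also have "\<dots> = \<tau> \<cdot> v' \<cdot> e' \<cdot> c" by (rule comp_reassoc[OF u'(6)]) (use cA cc e u' uA dc in simp_all)
  also have "\<dots> = t \<cdot> (b \<cdot> v' \<cdot> e' \<cdot> c)"
    by (rule comp_rw[OF sa(3), symmetric]) (use cA cc e u' uA ab tD in simp_all)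
  finally obtain d where d: "d \<in> L_isos C L" "Cod C d = Dom C (b \<cdot> v' \<cdot> e' \<cdot> c)"
    "(v \<cdot> e \<cdot> c) \<cdot> d = (b \<cdot> v' \<cdot> e' \<cdot> c) \<cdot> d"
    by (rule L_isos_equalize[OF tD(1)]) (use cA cc e(2-6) u(2-5) u'(2-5) uA ab in auto)
  have dA: "d \<in> Arr C" and dd: "Cod C d = Dom C c" using d cA cc e u' uA ab by simp_all
  have d3: "v \<cdot> e \<cdot> c \<cdot> d = b \<cdot> v' \<cdot> e' \<cdot> c \<cdot> d" using d(3) dA dd cA cc e u u' uA ab by simp
  note all = dA dd cA cc e(2-6) u(2-5) u'(2-5) uA ab sD(2-4) tD(2-4) dc r(3)
  show ?thesis
  proof (rule roof_eqI)
    show "roof (s \<cdot> u) (g \<cdot> v)" "roof (\<sigma> \<cdot> u') (\<gamma> \<cdot> v')" using su su' all by (simp_all add: roof_def)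
    show "e \<cdot> c \<cdot> d \<in> Arr C" "e' \<cdot> c \<cdot> d \<in> Arr C" "Dom C (e \<cdot> c \<cdot> d) = Dom C (e' \<cdot> c \<cdot> d)"
      "Cod C (e \<cdot> c \<cdot> d) = Dom C (s \<cdot> u)" "Cod C (e' \<cdot> c \<cdot> d) = Dom C (\<sigma> \<cdot> u')"
      using all by simp_all
    have "(s \<cdot> u) \<cdot> e \<cdot> c \<cdot> d = (\<sigma> \<cdot> u') \<cdot> e' \<cdot> c \<cdot> d"
      by (rule comp_reassoc[OF e(7)]) (use all in simp_all)
    then show "(s \<cdot> u) \<cdot> (e \<cdot> c \<cdot> d) = (\<sigma> \<cdot> u') \<cdot> (e' \<cdot> c \<cdot> d)" using all by simp
    show "(s \<cdot> u) \<cdot> (e \<cdot> c \<cdot> d) \<in> L_isos C L"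
      by (intro L_isos_comp e(1) c(1) d(1) su) (use all in simp_all)
    have "g \<cdot> v \<cdot> e \<cdot> c \<cdot> d = g \<cdot> b \<cdot> v' \<cdot> e' \<cdot> c \<cdot> d" by (simp add: d3)
    also have "\<dots> = \<gamma> \<cdot> v' \<cdot> e' \<cdot> c \<cdot> d" by (rule comp_rw[OF sa(4)]) (use all in simp_all)
    finally show "(g \<cdot> v) \<cdot> (e \<cdot> c \<cdot> d) = (\<gamma> \<cdot> v') \<cdot> (e' \<cdot> c \<cdot> d)" using all by simp
  qed
qed

lemma roof_comp_wd:
  assumes r: "roof s f" "roof t g" "Cod C f = Cod C t" "roof s' f'" "roof t' g'" "Cod C f' = Cod C t'"
    and eq: "roof_eq C L (s, f) (s', f')" "roof_eq C L (t, g) (t', g')"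
    and u: "u \<in> L_isos C L" "v \<in> Arr C" "Dom C u = Dom C v" "Cod C u = Dom C s" "Cod C v = Dom C t" "f \<cdot> u = t \<cdot> v"
    and u': "u' \<in> L_isos C L" "v' \<in> Arr C" "Dom C u' = Dom C v'" "Cod C u' = Dom C s'" "Cod C v' = Dom C t'"
      "f' \<cdot> u' = t' \<cdot> v'"
  shows "roof_eq C L (s \<cdot> u, g \<cdot> v) (s' \<cdot> u', g' \<cdot> v')"
proof -
  note sD = roofD[OF r(1)] and tD = roofD[OF r(2)]
  note sD' = roofD[OF r(4)] and tD' = roofD[OF r(5)]
  have uA: "u \<in> Arr C" "u' \<in> Arr C" using u u' by simp_all
  obtain a a' where a: "a \<in> Arr C" "a' \<in> Arr C" "Dom C a = Dom C a'" "Cod C a = Dom C s"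
     "Cod C a' = Dom C s'" "s \<cdot> a = s' \<cdot> a'" "s \<cdot> a \<in> L_isos C L" "f \<cdot> a = f' \<cdot> a'"
    using eq(1) unfolding roof_eq_iff by blast
  obtain b b' where b: "b \<in> Arr C" "b' \<in> Arr C" "Dom C b = Dom C b'" "Cod C b = Dom C t"
     "Cod C b' = Dom C t'" "t \<cdot> b = t' \<cdot> b'" "t \<cdot> b \<in> L_isos C L" "g \<cdot> b = g' \<cdot> b'"
    using eq(2) unfolding roof_eq_iff by blast
  \<comment> \<open>A composite formed over the common refinements of both pairs serves as middle
    term; each of the two given composites equals it.\<close>
  have "f \<cdot> a \<in> Arr C" "Dom C (f \<cdot> a) = Dom C a" "Cod C (f \<cdot> a) = Cod C (t \<cdot> b)" "Dom C (t \<cdot> b) = Dom C b"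
    using a(1-5) b(1-5) sD tD r by simp_all
  then obtain x y where x: "x \<in> L_isos C L" "x \<in> Arr C" "y \<in> Arr C" "Dom C x = Dom C y" "Cod C x = Dom C a"
    "Cod C y = Dom C b" "(f \<cdot> a) \<cdot> x = (t \<cdot> b) \<cdot> y"
    using oreE[OF _ b(7), of "f \<cdot> a"] by metis
  have 1: "roof_eq C L (s \<cdot> u, g \<cdot> v) ((s \<cdot> a) \<cdot> x, (g \<cdot> b) \<cdot> y)"
    by (rule roof_comp_wd_aux[OF r(1-3) a(1,4) b(1,4) refl refl refl refl a(7) b(7) u]) (use x in simp_all)
  have 2: "roof_eq C L (s' \<cdot> u', g' \<cdot> v') ((s \<cdot> a) \<cdot> x, (g \<cdot> b) \<cdot> y)"
    by (rule roof_comp_wd_aux[OF r(4-6) a(2,5) b(2,5) a(6)[symmetric] a(8)[symmetric] b(6)[symmetric] b(8)[symmetric]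
          a(7) b(7) u']) (use x(1-6) a(3) b(3) x(7)[unfolded a(8) b(6)] in \<open>simp_all add: a(8) b(6)\<close>)
  have R: "roof (s \<cdot> u) (g \<cdot> v)" "roof (s' \<cdot> u') (g' \<cdot> v')"
    using u u' uA sD tD sD' tD' L_isos_comp[OF u(1) sD(1)] L_isos_comp[OF u'(1) sD'(1)] by (simp_all add: roof_def)
  have "(s \<cdot> a) \<cdot> x \<in> L_isos C L" by (rule L_isos_comp[OF x(1) a(7)]) (use a(1-5) x sD in simp)
  then have R3: "roof ((s \<cdot> a) \<cdot> x) ((g \<cdot> b) \<cdot> y)"
    unfolding roof_def using a(1-5) b(1-5) x(1-6) sD tD by simp
  show ?thesis using roof_eq_trans[OF 1 roof_eq_sym[OF 2] R(1) R3 R(2)] .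
qed

text \<open>By \<open>roof_comp_wd\<close> every admissible choice in the definition of
  \<open>Comp\<close> yields the same class, and the given square is one such choice, so the union
  is that class and not empty.\<close>

lemma frac_comp:
  assumes r: "roof s f" "roof t g" "Cod C f = Cod C t"
    and u: "u \<in> L_isos C L" "v \<in> Arr C" "Dom C u = Dom C v" "Cod C u = Dom C s" "Cod C v = Dom C t" "f \<cdot> u = t \<cdot> v"
  shows "frac t g \<cdot>\<^bsub>Q\<^esub> frac s f = frac (s \<cdot> u) (g \<cdot> v)" "roof (s \<cdot> u) (g \<cdot> v)"
proof -
  note sD = roofD[OF r(1)] and tD = roofD[OF r(2)]
  have uA: "u \<in> Arr C" using u by simp
  show R: "roof (s \<cdot> u) (g \<cdot> v)"
    using u uA sD tD L_isos_comp[OF u(1) sD(1)] by (simp add: roof_def)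
  let ?A = "roof_class C L (Cod C s) (Cod C f) (s, f)" and ?B = "roof_class C L (Cod C t) (Cod C g) (t, g)"
  let ?R = "roof_class C L (Cod C s) (Cod C g) (s \<cdot> u, g \<cdot> v)"
  let ?P = "\<lambda>s' f' t' g' u' v'. (s', f') \<in> ?A \<and> (t', g') \<in> ?B \<and> u' \<in> L_isos C L \<and> Cod C u' = Dom C f' \<and>
      v' \<in> homset C (Dom C u') (Dom C t') \<and> f' \<cdot> u' = t' \<cdot> v'"
  have cls: "roof_class C L (Cod C s) (Cod C g) (s' \<cdot> u', g' \<cdot> v') = ?R" if P: "?P s' f' t' g' u' v'" for s' f' t' g' u' v'
  proof -
    from P have P1: "roof s' f'" "Cod C s' = Cod C s" "Cod C f' = Cod C f" "roof_eq C L (s, f) (s', f')"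
       "roof t' g'" "Cod C t' = Cod C t" "Cod C g' = Cod C g" "roof_eq C L (t, g) (t', g')" 
       "u' \<in> L_isos C L" "Cod C u' = Dom C s'" "v' \<in> Arr C" "Dom C u' = Dom C v'" "Cod C v' = Dom C t'" "f' \<cdot> u' = t' \<cdot> v'"
      by (auto simp: in_roof_class in_hom roof_def)
    have e: "roof_eq C L (s \<cdot> u, g \<cdot> v) (s' \<cdot> u', g' \<cdot> v')"
      by (rule roof_comp_wd[OF r P1(1,5) _ P1(4,8) u P1(9,11,12,10,13,14)]) (use P1 r in simp)
    have R': "roof (s' \<cdot> u') (g' \<cdot> v')"
      using P1 roofD[OF P1(1)] roofD[OF P1(5)] L_isos_comp[OF P1(9)] by (simp add: roof_def)
    show ?thesis using roof_class_eqI[OF e R R'] by simp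
  qed
  have P0: "?P s f t g u v"
    using r roof_eq_refl u uA sD tD by (simp add: in_roof_class in_hom)
  have "(\<Union>{roof_class C L (Cod C s) (Cod C g) (s' \<cdot> u', g' \<cdot> v') | s' f' t' g' u' v'. ?P s' f' t' g' u' v'}) = ?R"
    (is "\<Union>?X = _")
  proof -
    have "?X = {?R}" using cls P0 by blast
    then show ?thesis by simp
  qed
  then show "frac t g \<cdot>\<^bsub>Q\<^esub> frac s f = frac (s \<cdot> u) (g \<cdot> v)"
    using u uA sD tD by (simp add: quotient_category_def frac_def)
qed

text \<open>The Ore square with \<open>u\<close> an identity: if the numerator passes through
  \<open>t\<close>, then \<open>t\<close> cancels. \<open>frac_liftE\<close> brings every
  composition into this form.\<close>

lemma frac_comp_lift:
  assumes "roof \<sigma> (t \<cdot> y)" "roof t g" "y \<in> Arr C" "Cod C y = Dom C t" "Dom C y = Dom C \<sigma>"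
  shows "frac t g \<cdot>\<^bsub>Q\<^esub> frac \<sigma> (t \<cdot> y) = frac \<sigma> (g \<cdot> y)"
proof -
  note tD = roofD[OF assms(2)] and sD = roofD[OF assms(1)]
  have "frac t g \<cdot>\<^bsub>Q\<^esub> frac \<sigma> (t \<cdot> y) = frac (\<sigma> \<cdot> Ident C (Dom C \<sigma>)) (g \<cdot> y)"
    by (rule frac_comp(1)[OF assms(1,2)]) (use assms tD sD in simp_all)
  then show ?thesis using sD by simp
qed

lemma frac_liftE:
  assumes "roof s f" "t \<in> L_isos C L" "Cod C f = Cod C t"
  obtains u y where "u \<in> L_isos C L" "y \<in> Arr C" "Cod C u = Dom C s" "Cod C y = Dom C t" "Dom C y = Dom C u"
    "f \<cdot> u = t \<cdot> y" "frac s f = frac (s \<cdot> u) (t \<cdot> y)" "roof (s \<cdot> u) (t \<cdot> y)"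
proof -
  note sD = roofD[OF assms(1)]
  obtain u y where u: "u \<in> L_isos C L" "u \<in> Arr C" "y \<in> Arr C" "Dom C u = Dom C y" "Cod C u = Dom C f"
    "Cod C y = Dom C t" "f \<cdot> u = t \<cdot> y"
    by (rule oreE[OF sD(3) assms(2,3)])
  have cu: "Cod C u = Dom C s" using u sD by simp
  have "s \<cdot> u \<in> L_isos C L" by (rule L_isos_comp[OF u(1) sD(1) cu])
  note e = frac_expand[OF assms(1) u(2) cu this]
  show ?thesis using that[OF u(1,3) cu u(6) u(4)[symmetric] u(7)] e unfolding u(7) by metis
qed

text \<open>An Ore square over the common codomain replaces \<open>s\<close> by a refinement of the
  prescribed \<open>t\<close>; this is the source of common denominators.\<close>

lemma frac_denominatorE:
  assumes "roof s f" "t \<in> L_isos C L" "Cod C s = Cod C t"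
  obtains u h where "u \<in> L_isos C L" "u \<in> Arr C" "Cod C u = Dom C t" "t \<cdot> u \<in> L_isos C L" "frac s f = frac (t \<cdot> u) h"
    "roof (t \<cdot> u) h" "Cod C h = Cod C f"
proof -
  note sD = roofD[OF assms(1)]
  have tA: "t \<in> Arr C" using assms by simp
  obtain u y where u: "u \<in> L_isos C L" "u \<in> Arr C" "y \<in> Arr C" "Dom C u = Dom C y" "Cod C u = Dom C t"
    "Cod C y = Dom C s" "t \<cdot> u = s \<cdot> y"
    by (rule oreE[OF tA sD(1) assms(3)[symmetric]])
  have tu: "t \<cdot> u \<in> L_isos C L" by (rule L_isos_comp[OF u(1) assms(2) u(5)])
  then have sy: "s \<cdot> y \<in> L_isos C L" using u(7) by simp
  note e = frac_expand[OF assms(1) u(3,6) sy]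
  show ?thesis
    by (rule that[OF u(1,2,5) tu, of "f \<cdot> y"]) (use e u sD in simp_all)
qed

lemma frac_commonE:
  assumes "a \<in> Arr Q" "b \<in> Arr Q" "Dom Q a = Dom Q b"
  obtains s f g where "roof s f" "roof s g" "a = frac s f" "b = frac s g"
proof -
  obtain s f where s: "roof s f" "a = frac s f" using assms(1) by (rule fracE)
  obtain t g where t: "roof t g" "b = frac t g" using assms(2) by (rule fracE)
  have c: "Cod C t = Cod C s" using assms(3) s t by simp
  note sD = roofD[OF s(1)]
  obtain u h where u: "u \<in> L_isos C L" "u \<in> Arr C" "Cod C u = Dom C s" "s \<cdot> u \<in> L_isos C L" "frac t g = frac (s \<cdot> u) h"
    "roof (s \<cdot> u) h" "Cod C h = Cod C g"
    by (rule frac_denominatorE[OF t(1) sD(1) c])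
  show ?thesis using that[of "s \<cdot> u" "f \<cdot> u" h] frac_expand[OF s(1) u(2-4)] u s t by simp
qed

lemma frac_common3E:
  assumes "a \<in> Arr Q" "b \<in> Arr Q" "c \<in> Arr Q" "Dom Q a = Dom Q b" "Dom Q b = Dom Q c"
  obtains s f g h where "roof s f" "roof s g" "roof s h" "a = frac s f" "b = frac s g" "c = frac s h"
proof -
  obtain s f g where s: "roof s f" "roof s g" "a = frac s f" "b = frac s g"
    by (rule frac_commonE[OF assms(1,2,4)])
  obtain t k where t: "roof t k" "c = frac t k" using assms(3) by (rule fracE)
  have c: "Cod C t = Cod C s" using assms(5) s t by simp
  note sD = roofD[OF s(1)]
  obtain u h where u: "u \<in> L_isos C L" "u \<in> Arr C" "Cod C u = Dom C s" "s \<cdot> u \<in> L_isos C L" "frac t k = frac (s \<cdot> u) h"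
    "roof (s \<cdot> u) h" "Cod C h = Cod C k"
    by (rule frac_denominatorE[OF t(1) sD(1) c])
  show ?thesis using that[of "s \<cdot> u" "f \<cdot> u" "g \<cdot> u" h]
      frac_expand[OF s(1) u(2-4)] frac_expand[OF s(2) u(2-4)] u s t by simp
qed

lemma roof_plus: "roof s f \<Longrightarrow> roof s g \<Longrightarrow> Cod C f = Cod C g \<Longrightarrow> roof s (Plus C f g)"
  by (simp add: roof_def)

lemma frac_plus:
  assumes r: "roof s f" "roof s g" and c: "Cod C f = Cod C g"
  shows "Plus Q (frac s f) (frac s g) = frac s (Plus C f g)"
proof -
  note sD = roofD[OF r(1)] and gD = roofD[OF r(2)]
  have R: "roof s (Plus C f g)" by (rule roof_plus[OF r c])
  let ?A = "roof_class C L (Cod C s) (Cod C f) (s, f)" and ?B = "roof_class C L (Cod C s) (Cod C g) (s, g)"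
  let ?R = "roof_class C L (Cod C s) (Cod C g) (s, Plus C f g)"
  have cls: "roof_class C L (Cod C s) (Cod C g) (s', Plus C f' g') = ?R"
    if P: "(s', f') \<in> ?A" "(s', g') \<in> ?B" for s' f' g'
  proof -
    from P have P1: "roof s' f'" "Cod C s' = Cod C s" "Cod C f' = Cod C f" "roof_eq C L (s, f) (s', f')"
       "roof s' g'" "Cod C g' = Cod C g" "roof_eq C L (s, g) (s', g')" 
      by (auto simp: in_roof_class)
    note sD' = roofD[OF P1(1)] and gD' = roofD[OF P1(5)]
    obtain a a' where a: "a \<in> Arr C" "a' \<in> Arr C" "Dom C a = Dom C a'" "Cod C a = Dom C s"
      "Cod C a' = Dom C s'" "s \<cdot> a = s' \<cdot> a'" "s \<cdot> a \<in> L_isos C L" "f \<cdot> a = f' \<cdot> a'"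
      using P1(4) unfolding roof_eq_iff by blast
    have sa': "s' \<cdot> a' \<in> L_isos C L" using a by simp
    note x = frac_expand[OF r(2) a(1,4,7)] and y = frac_expand[OF P1(5) a(2,5) sa']
    \<comment> \<open>The refinement \<open>a\<close>, \<open>a'\<close> was chosen for
      \<open>f\<close> and \<open>f'\<close>. Along it \<open>g\<close> and \<open>g'\<close> agree
      only up to a null arrow, which the restriction \<open>k\<close> kills.\<close>
    have "frac s g = frac s' g'" using frac_eq_iff[OF r(2) P1(5)] P1 by simp
    then have "frac (s \<cdot> a) (g \<cdot> a) = frac (s \<cdot> a) (g' \<cdot> a')" using x y a(6) by simp
    then have n: "null (diff (g \<cdot> a) (g' \<cdot> a'))"
      using frac_eq_null[OF x(2), of "g' \<cdot> a'"] y(2) a(6) P1(6) a gD gD' by simp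
    obtain k where k: "k \<in> L_isos C L" "Cod C k = Dom C (diff (g \<cdot> a) (g' \<cdot> a'))" "zarr (diff (g \<cdot> a) (g' \<cdot> a') \<cdot> k)"
      using null_restrict[OF n] by metis
    have kA: "k \<in> Arr C" and kc: "Cod C k = Dom C a'" using k a gD gD' P1 by simp_all
    have gk: "g \<cdot> a \<cdot> k = g' \<cdot> a' \<cdot> k" using k(3) kA kc a gD gD' P1 by (simp add: diff_comp zarr_diff_iff)
    have fk: "f \<cdot> a \<cdot> k = f' \<cdot> a' \<cdot> k" by (rule comp_reassoc[OF a(8)]) (use kA kc a sD sD' in simp_all)
    have sk: "s \<cdot> a \<cdot> k = s' \<cdot> a' \<cdot> k" by (rule comp_reassoc[OF a(6)]) (use kA kc a sD sD' in simp_all)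
    have R': "roof s' (Plus C f' g')" by (rule roof_plus[OF P1(1,5)]) (use P1 c in simp)
    have e: "roof_eq C L (s, Plus C f g) (s', Plus C f' g')"
    proof (rule roof_eqI[OF R R', of "a \<cdot> k" "a' \<cdot> k"])
      have "(s \<cdot> a) \<cdot> k \<in> L_isos C L" by (rule L_isos_comp[OF k(1) a(7)]) (use kA kc a(1-5) sD in simp)
      then show "s \<cdot> a \<cdot> k \<in> L_isos C L" using kA kc a(1-5) sD by simp
      show "Plus C f g \<cdot> a \<cdot> k = Plus C f' g' \<cdot> a' \<cdot> k"
        using gk fk kA kc a sD sD' gD gD' P1 c by simp
    qed (use sk kA kc a in simp_all)
    show ?thesis using roof_class_eqI[OF e R R'] by simp
  qed
  have P0: "(s, f) \<in> ?A" "(s, g) \<in> ?B" using r roof_eq_refl by (simp_all add: in_roof_class)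
  have "(\<Union>{roof_class C L (Cod C s) (Cod C g) (s', Plus C f' g') | s' f' g'. (s', f') \<in> ?A \<and> (s', g') \<in> ?B}) = ?R"
    (is "\<Union>?X = _")
  proof -
    have "?X = {?R}" using cls P0 by blast
    then show ?thesis by simp
  qed
  then show ?thesis using sD gD c by (simp add: quotient_category_def frac_def)
qed

lemma frac_ident:
  assumes "s \<in> L_isos C L" "Cod C s = X"
  shows "Ident Q X = frac s s"
proof -
  have X: "X \<in> Obj C" using assms by auto
  have r: "roof (Ident C X) (Ident C X)" using X by (simp add: roof_def)
  have "Ident Q X = frac (Ident C X) (Ident C X)" using X by (simp add: frac_def Q_ident_zero)
  also have "\<dots> = frac (Ident C X \<cdot> s) (Ident C X \<cdot> s)"
    by (rule frac_expand(1)[OF r, symmetric]) (use assms X in simp_all)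
  finally show ?thesis using assms X by simp
qed

lemma frac_zero:
  assumes "s \<in> L_isos C L" "Cod C s = X" "Y \<in> Obj C"
  shows "Zero Q X Y = frac s (Zero C (Dom C s) Y)"
proof -
  have X: "X \<in> Obj C" using assms by auto
  have r: "roof (Ident C X) (Zero C X Y)" using X assms by (simp add: roof_def)
  have "Zero Q X Y = frac (Ident C X) (Zero C X Y)" using X assms by (simp add: frac_def Q_ident_zero)
  also have "\<dots> = frac (Ident C X \<cdot> s) (Zero C X Y \<cdot> s)"
    by (rule frac_expand(1)[OF r, symmetric]) (use assms X in simp_all)
  finally show ?thesis using assms X by simp
qed

lemma Q_category: "category Q"
proof
  show "Dom Q a \<in> Obj Q" "Cod Q a \<in> Obj Q" if a: "a \<in> Arr Q" for a
  proof -
    obtain s f where "roof s f" "a = frac s f" using a by (rule fracE)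
    then show "Dom Q a \<in> Obj Q" "Cod Q a \<in> Obj Q" using roofD[of s f] by simp_all
  qed
  show "Ident Q X \<in> homset Q X X" if "X \<in> Obj Q" for X
  proof -
    have X: "X \<in> Obj C" using that by simp
    show ?thesis using frac_ident[of "Ident C X" X] X unfolding in_homset_frac
      by (intro exI[of _ "Ident C X"]) (simp add: roof_def)
  qed
  show "b \<cdot>\<^bsub>Q\<^esub> a \<in> homset Q X Z" if a: "a \<in> homset Q X Y" "b \<in> homset Q Y Z" for a b X Y Z
  proof -
    obtain s f where s: "roof s f" "Cod C s = X" "Cod C f = Y" "a = frac s f" using a(1) in_homset_frac by blast
    obtain t g where t: "roof t g" "Cod C t = Y" "Cod C g = Z" "b = frac t g" using a(2) in_homset_frac by blast
    note sD = roofD[OF s(1)] and tD = roofD[OF t(1)]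
    obtain u y where u: "u \<in> L_isos C L" "y \<in> Arr C" "Cod C u = Dom C s" "Cod C y = Dom C t" "Dom C y = Dom C u"
      "f \<cdot> u = t \<cdot> y" "frac s f = frac (s \<cdot> u) (t \<cdot> y)" "roof (s \<cdot> u) (t \<cdot> y)"
      by (rule frac_liftE[OF s(1) tD(1)]) (use s t in auto)
    have "b \<cdot>\<^bsub>Q\<^esub> a = frac (s \<cdot> u) (g \<cdot> y)" "roof (s \<cdot> u) (g \<cdot> y)"
      using frac_comp[OF s(1) t(1) _ u(1,2) u(5)[symmetric] u(3,4,6)] s t by simp_all
    then show ?thesis unfolding in_homset_frac using s t u(1-5) tD sD by (intro exI[of _ "s \<cdot> u"] exI[of _ "g \<cdot> y"]) simp
  qed
  show "a \<cdot>\<^bsub>Q\<^esub> Ident Q X = a" if a: "a \<in> homset Q X Y" for a X Y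
  proof -
    obtain s f where s: "roof s f" "Cod C s = X" "Cod C f = Y" "a = frac s f" using a in_homset_frac by blast
    note sD = roofD[OF s(1)]
    have "Ident Q X = frac s (s \<cdot> Ident C (Dom C s))" using frac_ident[OF sD(1) s(2)] sD by simp
    moreover have "roof s (s \<cdot> Ident C (Dom C s))" using sD by (simp add: roof_def)
    ultimately have "a \<cdot>\<^bsub>Q\<^esub> Ident Q X = frac s (f \<cdot> Ident C (Dom C s))"
      using frac_comp_lift[of s s "Ident C (Dom C s)" f] s sD by simp
    then show ?thesis using s sD by simp
  qed
  show "Ident Q Y \<cdot>\<^bsub>Q\<^esub> a = a" if a: "a \<in> homset Q X Y" for a X Y
  proof -
    obtain s f where s: "roof s f" "Cod C s = X" "Cod C f = Y" "a = frac s f" using a in_homset_frac by blast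
    note sD = roofD[OF s(1)]
    have Y: "Y \<in> Obj C" using s sD by auto
    have r: "roof (Ident C Y) (Ident C Y)" using Y by (simp add: roof_def)
    have "Ident Q Y = frac (Ident C Y) (Ident C Y)" using frac_ident[of "Ident C Y" Y] Y by simp
    moreover have "a = frac s (Ident C Y \<cdot> f)" using s sD by simp
    ultimately have "Ident Q Y \<cdot>\<^bsub>Q\<^esub> a = frac s (Ident C Y \<cdot> f)"
      using frac_comp_lift[OF _ r, of s f] s sD Y by simp
    then show ?thesis using s sD by simp
  qed
  show "(c \<cdot>\<^bsub>Q\<^esub> b) \<cdot>\<^bsub>Q\<^esub> a = c \<cdot>\<^bsub>Q\<^esub> (b \<cdot>\<^bsub>Q\<^esub> a)"
    if a: "a \<in> homset Q W X" "b \<in> homset Q X Y" "c \<in> homset Q Y Z" for a b c W X Y Z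
  proof -
    obtain s f where s: "roof s f" "Cod C s = W" "Cod C f = X" "a = frac s f" using a(1) in_homset_frac by blast
    obtain t g where t: "roof t g" "Cod C t = X" "Cod C g = Y" "b = frac t g" using a(2) in_homset_frac by blast
    obtain r h where r: "roof r h" "Cod C r = Y" "Cod C h = Z" "c = frac r h" using a(3) in_homset_frac by blast
    note sD = roofD[OF s(1)] and tD = roofD[OF t(1)] and rD = roofD[OF r(1)]
    \<comment> \<open>Lifting \<open>g\<close> through \<open>r\<close> and then \<open>f\<close>
      through \<open>t \<cdot> v\<close> turns both bracketings into fractions over the single
      denominator \<open>s \<cdot> u\<close>.\<close>
    obtain v z where v: "v \<in> L_isos C L" "z \<in> Arr C" "Cod C v = Dom C t" "Cod C z = Dom C r" "Dom C z = Dom C v"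
      "g \<cdot> v = r \<cdot> z" "frac t g = frac (t \<cdot> v) (r \<cdot> z)" "roof (t \<cdot> v) (r \<cdot> z)"
      by (rule frac_liftE[OF t(1) rD(1)]) (use r t in auto)
    have vA: "v \<in> Arr C" using v by simp
    have tv: "t \<cdot> v \<in> L_isos C L" by (rule L_isos_comp[OF v(1) tD(1) v(3)])
    obtain u y where u: "u \<in> L_isos C L" "y \<in> Arr C" "Cod C u = Dom C s" "Cod C y = Dom C (t \<cdot> v)" "Dom C y = Dom C u"
      "f \<cdot> u = (t \<cdot> v) \<cdot> y" "frac s f = frac (s \<cdot> u) ((t \<cdot> v) \<cdot> y)" "roof (s \<cdot> u) ((t \<cdot> v) \<cdot> y)"
      by (rule frac_liftE[OF s(1) tv]) (use s t v vA tD in auto)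
    have uA: "u \<in> Arr C" using u by simp
    have cy: "Cod C y = Dom C z" using u(4) v tD vA by simp
    have su: "s \<cdot> u \<in> L_isos C L" by (rule L_isos_comp[OF u(1) sD(1) u(3)])
    have r1: "roof (t \<cdot> v) (h \<cdot> z)" "roof (s \<cdot> u) (r \<cdot> z \<cdot> y)"
      using tv su v(2-5) u(2,3,5) cy vA uA tD sD rD by (simp_all add: roof_def)
    have cb: "c \<cdot>\<^bsub>Q\<^esub> b = frac (t \<cdot> v) (h \<cdot> z)"
      unfolding r(4) t(4) v(7) by (rule frac_comp_lift[OF v(8) r(1)]) (use v(2-5) vA tD in simp_all)
    have ba: "b \<cdot>\<^bsub>Q\<^esub> a = frac (s \<cdot> u) ((r \<cdot> z) \<cdot> y)"
      unfolding s(4) t(4) v(7) u(7) by (rule frac_comp_lift[OF u(8) v(8)]) (use u(2-5) uA sD in simp_all)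
    have "(c \<cdot>\<^bsub>Q\<^esub> b) \<cdot>\<^bsub>Q\<^esub> a = frac (s \<cdot> u) ((h \<cdot> z) \<cdot> y)"
      unfolding cb s(4) u(7) by (rule frac_comp_lift[OF u(8) r1(1)]) (use u(2-5) uA sD in simp_all)
    also have "\<dots> = frac (s \<cdot> u) (h \<cdot> (z \<cdot> y))" using v(2,4) u(2) cy rD by simp
    also have "\<dots> = c \<cdot>\<^bsub>Q\<^esub> frac (s \<cdot> u) (r \<cdot> (z \<cdot> y))"
      unfolding r(4) by (rule frac_comp_lift[OF r1(2) r(1), symmetric]) (use u(2,3,5) cy v(2,4) uA sD in simp_all)
    also have "frac (s \<cdot> u) (r \<cdot> (z \<cdot> y)) = b \<cdot>\<^bsub>Q\<^esub> a" using ba v(2,4) u(2) cy rD by simp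
    finally show ?thesis .
  qed
qed

lemma Q_preadditive: "preadditive_category Q"
proof (intro preadditive_category.intro Q_category preadditive_category_axioms.intro)
  fix X Y assume XY: "X \<in> Obj Q" "Y \<in> Obj Q"
  then have X: "X \<in> Obj C" and Y: "Y \<in> Obj C" by simp_all
  show "comm_group \<lparr>carrier = homset Q X Y, mult = Plus Q, one = Zero Q X Y\<rparr>"
  proof (rule comm_groupI; simp only: monoid.simps partial_object.simps)
    show "Plus Q a b \<in> homset Q X Y" "Plus Q a b = Plus Q b a"
      if a: "a \<in> homset Q X Y" and b: "b \<in> homset Q X Y" for a b
    proof -
      have ab: "a \<in> Arr Q" "b \<in> Arr Q" "Dom Q a = X" "Cod Q a = Y" "Dom Q b = X" "Cod Q b = Y"
        using a b by (simp_all add: homset_def)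
      obtain s f g where s: "roof s f" "roof s g" "a = frac s f" "b = frac s g"
        by (rule frac_commonE[OF ab(1,2)]) (use ab in simp)
      have c: "Cod C f = Y" "Cod C g = Y" "Cod C s = X" using ab s by simp_all
      note fD = roofD[OF s(1)] and gD = roofD[OF s(2)]
      have p: "Plus Q a b = frac s (Plus C f g)" using frac_plus[OF s(1,2)] s c by simp
      show "Plus Q a b \<in> homset Q X Y" unfolding p in_homset_frac
        using roof_plus[OF s(1,2)] c fD gD by (intro exI[of _ s] exI[of _ "Plus C f g"]) simp
      have "Plus C f g = Plus C g f" by (rule plus_comm) (use fD gD c in simp_all)
      then show "Plus Q a b = Plus Q b a" using p frac_plus[OF s(2,1)] s c by simp
    qed
    show z: "Zero Q X Y \<in> homset Q X Y"
      unfolding in_homset_frac using X Y frac_zero[of "Ident C X" X Y]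
      by (intro exI[of _ "Ident C X"] exI[of _ "Zero C X Y"]) (simp add: roof_def)
    show "Plus Q (Plus Q a b) c = Plus Q a (Plus Q b c)"
      if "a \<in> homset Q X Y" "b \<in> homset Q X Y" "c \<in> homset Q X Y" for a b c
    proof -
      have ab: "a \<in> Arr Q" "b \<in> Arr Q" "c \<in> Arr Q" "Dom Q a = X" "Cod Q a = Y" "Dom Q b = X" "Cod Q b = Y"
        "Dom Q c = X" "Cod Q c = Y"
        using that by (simp_all add: homset_def)
      obtain s f g h where s: "roof s f" "roof s g" "roof s h" "a = frac s f" "b = frac s g" "c = frac s h"
        by (rule frac_common3E[OF ab(1,2,3)]) (use ab in simp_all)
      have c: "Cod C f = Y" "Cod C g = Y" "Cod C h = Y" using ab s by simp_all
      note fD = roofD[OF s(1)] and gD = roofD[OF s(2)] and hD = roofD[OF s(3)]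
      have "Plus C (Plus C f g) h = Plus C f (Plus C g h)" by (rule plus_assoc) (use fD gD hD c in simp_all)
      then show ?thesis unfolding s(4-6)
        using frac_plus s(1-3) roof_plus c fD gD hD by simp
    qed
    show "Plus Q (Zero Q X Y) a = a" if a: "a \<in> homset Q X Y" for a
    proof -
      obtain s f where s: "roof s f" "Cod C s = X" "Cod C f = Y" "a = frac s f" using a in_homset_frac by blast
      note fD = roofD[OF s(1)]
      have "roof s (Zero C (Dom C s) Y)" using fD Y by (simp add: roof_def)
      then show ?thesis using frac_plus[of s "Zero C (Dom C s) Y" f] frac_zero[OF fD(1) s(2) Y] s fD Y by simp
    qed
    show "\<exists>b\<in>homset Q X Y. Plus Q b a = Zero Q X Y" if a: "a \<in> homset Q X Y" for a
    proof -
      obtain s f where s: "roof s f" "Cod C s = X" "Cod C f = Y" "a = frac s f" using a in_homset_frac by blast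
      note fD = roofD[OF s(1)]
      have r: "roof s (neg f)" using fD by (simp add: roof_def)
      have "Plus Q (frac s (neg f)) a = Zero Q X Y"
        using frac_plus[OF r s(1)] frac_zero[OF fD(1) s(2) Y] s fD by simp
      moreover have "frac s (neg f) \<in> homset Q X Y" unfolding in_homset_frac
        using r s fD by (intro exI[of _ s] exI[of _ "neg f"]) simp
      ultimately show ?thesis by blast
    qed
  qed
next
  fix a a' b X Y Z assume "a \<in> homset Q X Y" "a' \<in> homset Q X Y" and b: "b \<in> homset Q Y Z"
  then have ab: "a \<in> Arr Q" "a' \<in> Arr Q" "Dom Q a = X" "Cod Q a = Y" "Dom Q a' = X" "Cod Q a' = Y"
    by (simp_all add: homset_def)
  obtain t g where t: "roof t g" "Cod C t = Y" "Cod C g = Z" "b = frac t g" using b in_homset_frac by blast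
  obtain s f f' where s: "roof s f" "roof s f'" "a = frac s f" "a' = frac s f'"
    by (rule frac_commonE[OF ab(1,2)]) (use ab in simp)
  have c: "Cod C f = Y" "Cod C f' = Y" "Cod C s = X" using ab s by simp_all
  note fD = roofD[OF s(1)] and gD = roofD[OF s(2)] and tD = roofD[OF t(1)]
  obtain u y where u: "u \<in> L_isos C L" "y \<in> Arr C" "Cod C u = Dom C s" "Cod C y = Dom C t" "Dom C y = Dom C u"
    "f \<cdot> u = t \<cdot> y" "frac s f = frac (s \<cdot> u) (t \<cdot> y)" "roof (s \<cdot> u) (t \<cdot> y)"
    by (rule frac_liftE[OF s(1) tD(1)]) (use c t in auto)
  have uA: "u \<in> Arr C" using u by simp
  have su: "s \<cdot> u \<in> L_isos C L" by (rule L_isos_comp[OF u(1) fD(1) u(3)])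
  note e = frac_expand[OF s(2) uA u(3) su]
  \<comment> \<open>After this second refinement both numerators pass through the denominator
    \<open>t\<close> of \<open>b\<close>; so does their sum, and all three composites are given by
    \<open>frac_comp_lift\<close>.\<close>
  obtain u' y' where u': "u' \<in> L_isos C L" "y' \<in> Arr C" "Cod C u' = Dom C (s \<cdot> u)" "Cod C y' = Dom C t" "Dom C y' = Dom C u'"
    "(f' \<cdot> u) \<cdot> u' = t \<cdot> y'" "frac (s \<cdot> u) (f' \<cdot> u) = frac ((s \<cdot> u) \<cdot> u') (t \<cdot> y')" "roof ((s \<cdot> u) \<cdot> u') (t \<cdot> y')"
    by (rule frac_liftE[OF e(2) tD(1)]) (use c t u uA gD in auto)
  have uA': "u' \<in> Arr C" using u' by simp
  have suu: "(s \<cdot> u) \<cdot> u' \<in> L_isos C L" by (rule L_isos_comp[OF u'(1) su u'(3)])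
  define \<sigma> where "\<sigma> = (s \<cdot> u) \<cdot> u'"
  have du': "Cod C u' = Dom C u" using u' u fD uA by simp
  have d\<sigma>: "\<sigma> \<in> L_isos C L" "Dom C \<sigma> = Dom C u'" using suu u' du' u uA' uA fD by (simp_all add: \<sigma>_def)
  have a': "a' = frac \<sigma> (t \<cdot> y')" using s e u' by (simp add: \<sigma>_def)
  have "frac \<sigma> ((t \<cdot> y) \<cdot> u') = frac (s \<cdot> u) (t \<cdot> y)"
    unfolding \<sigma>_def by (rule frac_expand[OF u(8) uA' u'(3) suu])
  then have a: "a = frac \<sigma> (t \<cdot> (y \<cdot> u'))" using s u u' du' uA' tD by simp
  let ?y = "y \<cdot> u'"
  have y: "?y \<in> Arr C" "Dom C ?y = Dom C u'" "Cod C ?y = Dom C t" using u u' du' uA' by simp_all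
  have R: "roof \<sigma> (t \<cdot> ?y)" "roof \<sigma> (t \<cdot> y')" "roof \<sigma> (g \<cdot> ?y)" "roof \<sigma> (g \<cdot> y')" "roof \<sigma> (t \<cdot> Plus C ?y y')"
    using d\<sigma> y u' tD by (simp_all add: roof_def)
  have "Plus Q a a' = frac \<sigma> (t \<cdot> Plus C ?y y')"
    unfolding a a' using frac_plus[OF R(1,2)] y u' tD d\<sigma> by simp
  then have "b \<cdot>\<^bsub>Q\<^esub> Plus Q a a' = frac \<sigma> (g \<cdot> Plus C ?y y')"
    unfolding t(4) using frac_comp_lift[OF R(5) t(1)] y u' tD d\<sigma> by simp
  also have "\<dots> = Plus Q (frac \<sigma> (g \<cdot> ?y)) (frac \<sigma> (g \<cdot> y'))"
    using frac_plus[OF R(3,4)] y u' tD d\<sigma> by simp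
  also have "frac \<sigma> (g \<cdot> ?y) = b \<cdot>\<^bsub>Q\<^esub> a"
    unfolding a t(4) by (rule frac_comp_lift[OF R(1) t(1), symmetric]) (use y d\<sigma> in simp_all)
  also have "frac \<sigma> (g \<cdot> y') = b \<cdot>\<^bsub>Q\<^esub> a'"
    unfolding a' t(4) by (rule frac_comp_lift[OF R(2) t(1), symmetric]) (use u' d\<sigma> in simp_all)
  finally show "b \<cdot>\<^bsub>Q\<^esub> Plus Q a a' = Plus Q (b \<cdot>\<^bsub>Q\<^esub> a) (b \<cdot>\<^bsub>Q\<^esub> a')" .
next
  fix a b b' X Y Z assume "a \<in> homset Q X Y" and "b \<in> homset Q Y Z" "b' \<in> homset Q Y Z"
  then have ab: "a \<in> homset Q X Y" "b \<in> Arr Q" "b' \<in> Arr Q" "Dom Q b = Y" "Cod Q b = Z" "Dom Q b' = Y" "Cod Q b' = Z"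
    by (simp_all add: homset_def)
  obtain t g g' where t: "roof t g" "roof t g'" "b = frac t g" "b' = frac t g'"
    by (rule frac_commonE[OF ab(2,3)]) (use ab in simp)
  have c: "Cod C g = Z" "Cod C g' = Z" "Cod C t = Y" using ab t by simp_all
  obtain s f where s: "roof s f" "Cod C s = X" "Cod C f = Y" "a = frac s f" using ab(1) in_homset_frac by blast
  note sD = roofD[OF s(1)] and tD = roofD[OF t(1)] and tD' = roofD[OF t(2)]
  obtain u y where u: "u \<in> L_isos C L" "y \<in> Arr C" "Cod C u = Dom C s" "Cod C y = Dom C t" "Dom C y = Dom C u"
    "f \<cdot> u = t \<cdot> y" "frac s f = frac (s \<cdot> u) (t \<cdot> y)" "roof (s \<cdot> u) (t \<cdot> y)"
    by (rule frac_liftE[OF s(1) tD(1)]) (use s c in auto)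
  have uA: "u \<in> Arr C" using u by simp
  have su: "s \<cdot> u \<in> L_isos C L" "Dom C (s \<cdot> u) = Dom C y" 
    using L_isos_comp[OF u(1) sD(1) u(3)] u(3,5) uA sD by simp_all
  have R: "roof (s \<cdot> u) (g \<cdot> y)" "roof (s \<cdot> u) (g' \<cdot> y)" using su u(2,4) tD tD' by (simp_all add: roof_def)
  have 1: "b \<cdot>\<^bsub>Q\<^esub> a = frac (s \<cdot> u) (g \<cdot> y)" unfolding t(3) s(4) u(7)
    by (rule frac_comp_lift[OF u(8) t(1) u(2,4) su(2)[symmetric]])
  have 2: "b' \<cdot>\<^bsub>Q\<^esub> a = frac (s \<cdot> u) (g' \<cdot> y)" unfolding t(4) s(4) u(7)
    by (rule frac_comp_lift[OF u(8) t(2) u(2,4) su(2)[symmetric]])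
  have P: "roof t (Plus C g g')" by (rule roof_plus[OF t(1,2)]) (use c in simp)
  have 3: "Plus Q b b' = frac t (Plus C g g')" unfolding t(3,4) by (rule frac_plus[OF t(1,2)]) (use c in simp)
  have "Plus Q b b' \<cdot>\<^bsub>Q\<^esub> a = frac (s \<cdot> u) (Plus C g g' \<cdot> y)" unfolding 3 s(4) u(7)
    by (rule frac_comp_lift[OF u(8) P u(2,4) su(2)[symmetric]])
  also have "\<dots> = frac (s \<cdot> u) (Plus C (g \<cdot> y) (g' \<cdot> y))" using tD tD' c u(2,4) by simp
  also have "\<dots> = Plus Q (b \<cdot>\<^bsub>Q\<^esub> a) (b' \<cdot>\<^bsub>Q\<^esub> a)" unfolding 1 2
    by (rule frac_plus[OF R, symmetric]) (use tD tD' c u(2,4) in simp)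
  finally show "Plus Q b b' \<cdot>\<^bsub>Q\<^esub> a = Plus Q (b \<cdot>\<^bsub>Q\<^esub> a) (b' \<cdot>\<^bsub>Q\<^esub> a)" .
qed

end

section \<open>The center\<close>

context preadditive_category
begin

lemma center_carrier:
  "z \<in> carrier (center C) \<longleftrightarrow> z \<in> extensional (Obj C) \<and> (\<forall>X\<in>Obj C. z X \<in> homset C X X) \<and>
     (\<forall>a\<in>Arr C. z (Cod C a) \<cdot> a = a \<cdot> z (Dom C a))"
  by (simp add: center_def nat_trans_def)

lemma center_arr:
  assumes "z \<in> carrier (center C)" "X \<in> Obj C"
  shows "z X \<in> Arr C" "Dom C (z X) = X" "Cod C (z X) = X"
  using assms by (simp_all add: center_carrier in_hom)

lemma center_nat:
  assumes "z \<in> carrier (center C)" "a \<in> Arr C" "Dom C a = X" "Cod C a = Y"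
  shows "z Y \<cdot> a = a \<cdot> z X"
  using assms by (auto simp: center_carrier)

lemma center_eqI:
  assumes "z \<in> carrier (center C)" "w \<in> carrier (center C)" "\<And>X. X \<in> Obj C \<Longrightarrow> z X = w X"
  shows "z = w"
  using assms by (intro extensionalityI[of z "Obj C" w]) (simp_all add: center_carrier)

lemma center_simps:
  "z \<oplus>\<^bsub>center C\<^esub> w = (\<lambda>X\<in>Obj C. Plus C (z X) (w X))"
  "z \<otimes>\<^bsub>center C\<^esub> w = (\<lambda>X\<in>Obj C. z X \<cdot> w X)"
  "\<zero>\<^bsub>center C\<^esub> = (\<lambda>X\<in>Obj C. Zero C X X)"
  "\<one>\<^bsub>center C\<^esub> = (\<lambda>X\<in>Obj C. Ident C X)"
  by (simp_all add: center_def)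

lemma center_closed:
  assumes z: "z \<in> carrier (center C)" and w: "w \<in> carrier (center C)"
  shows "z \<oplus>\<^bsub>center C\<^esub> w \<in> carrier (center C)" "z \<otimes>\<^bsub>center C\<^esub> w \<in> carrier (center C)"
proof -
  note zA = center_arr[OF z] and wA = center_arr[OF w]
  have nz: "z (Cod C a) \<cdot> a = a \<cdot> z (Dom C a)" and nw: "w (Cod C a) \<cdot> a = a \<cdot> w (Dom C a)" if "a \<in> Arr C" for a
    using center_nat[OF z that] center_nat[OF w that] by auto
  show "z \<oplus>\<^bsub>center C\<^esub> w \<in> carrier (center C)"
    using zA wA nz nw by (simp add: center_simps center_carrier in_hom)
  have "z (Cod C a) \<cdot> w (Cod C a) \<cdot> a = a \<cdot> z (Dom C a) \<cdot> w (Dom C a)" if a: "a \<in> Arr C" for a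
    using comp_reassoc[OF nz[OF a], of "w (Dom C a)"] nw[OF a] a zA wA by simp
  then show "z \<otimes>\<^bsub>center C\<^esub> w \<in> carrier (center C)"
    using zA wA by (simp add: center_simps center_carrier in_hom)
qed

lemma center_const_closed:
  "\<zero>\<^bsub>center C\<^esub> \<in> carrier (center C)" "\<one>\<^bsub>center C\<^esub> \<in> carrier (center C)"
  by (simp_all add: center_simps center_carrier in_hom)

lemma center_cring: "cring (center C)"
proof (rule cringI)
  show "abelian_group (center C)"
  proof (rule abelian_groupI)
    fix z w assume z: "z \<in> carrier (center C)" and w: "w \<in> carrier (center C)"
    note zA = center_arr[OF z] and wA = center_arr[OF w]
    show "z \<oplus>\<^bsub>center C\<^esub> w \<in> carrier (center C)" using center_closed z w by blast
    show "z \<oplus>\<^bsub>center C\<^esub> w = w \<oplus>\<^bsub>center C\<^esub> z"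
      unfolding center_simps by (rule restrict_ext, rule plus_comm) (use zA wA in simp_all)
  next
    fix x y z assume xyz: "x \<in> carrier (center C)" "y \<in> carrier (center C)" "z \<in> carrier (center C)"
    show "x \<oplus>\<^bsub>center C\<^esub> y \<oplus>\<^bsub>center C\<^esub> z = x \<oplus>\<^bsub>center C\<^esub> (y \<oplus>\<^bsub>center C\<^esub> z)"
      unfolding center_simps
    proof (rule restrict_ext)
      fix X assume X: "X \<in> Obj C"
      show "Plus C ((\<lambda>X\<in>Obj C. Plus C (x X) (y X)) X) (z X) = Plus C (x X) ((\<lambda>X\<in>Obj C. Plus C (y X) (z X)) X)"
        using X plus_assoc[of "x X" "y X" "z X"] xyz[THEN center_arr(1), OF X] xyz[THEN center_arr(2), OF X]
          xyz[THEN center_arr(3), OF X] by simp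
    qed
  next
    fix z assume z: "z \<in> carrier (center C)"
    note zA = center_arr[OF z]
    show "\<zero>\<^bsub>center C\<^esub> \<oplus>\<^bsub>center C\<^esub> z = z"
      by (rule center_eqI[OF center_closed(1)[OF center_const_closed(1) z] z]) (simp add: center_simps zA)
    have n: "z (Cod C a) \<cdot> a = a \<cdot> z (Dom C a)" if "a \<in> Arr C" for a
      using center_nat[OF z that] by auto
    have "(\<lambda>X\<in>Obj C. neg (z X)) \<in> carrier (center C)"
      using zA n by (simp add: center_carrier in_hom)
    moreover have "(\<lambda>X\<in>Obj C. neg (z X)) \<oplus>\<^bsub>center C\<^esub> z = \<zero>\<^bsub>center C\<^esub>"
      unfolding center_simps by (rule restrict_ext) (simp add: zA)
    ultimately show "\<exists>w\<in>carrier (center C). w \<oplus>\<^bsub>center C\<^esub> z = \<zero>\<^bsub>center C\<^esub>" by blast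
  qed (rule center_const_closed)
  show "Group.comm_monoid (center C)"
  proof (rule comm_monoidI)
    fix z w assume z: "z \<in> carrier (center C)" and w: "w \<in> carrier (center C)"
    note zA = center_arr[OF z] and wA = center_arr[OF w]
    show "z \<otimes>\<^bsub>center C\<^esub> w \<in> carrier (center C)" using center_closed z w by blast
    show "z \<otimes>\<^bsub>center C\<^esub> w = w \<otimes>\<^bsub>center C\<^esub> z"
      \<comment> \<open>Commutativity is naturality of \<open>z\<close> at the endomorphism
        \<open>w X\<close>.\<close>
      unfolding center_simps by (rule restrict_ext, rule center_nat[OF z]) (use wA in simp_all)
  next
    fix x y z assume xyz: "x \<in> carrier (center C)" "y \<in> carrier (center C)" "z \<in> carrier (center C)"
    show "x \<otimes>\<^bsub>center C\<^esub> y \<otimes>\<^bsub>center C\<^esub> z = x \<otimes>\<^bsub>center C\<^esub> (y \<otimes>\<^bsub>center C\<^esub> z)"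
      unfolding center_simps
      by (rule restrict_ext) (use center_arr[OF xyz(1)] center_arr[OF xyz(2)] center_arr[OF xyz(3)] in simp)
  next
    fix z assume z: "z \<in> carrier (center C)"
    show "\<one>\<^bsub>center C\<^esub> \<otimes>\<^bsub>center C\<^esub> z = z"
      by (rule center_eqI[OF center_closed(2)[OF center_const_closed(2) z] z])
        (simp add: center_simps center_arr[OF z])
  qed (rule center_const_closed)
  fix x y z assume xyz: "x \<in> carrier (center C)" "y \<in> carrier (center C)" "z \<in> carrier (center C)"
  show "(x \<oplus>\<^bsub>center C\<^esub> y) \<otimes>\<^bsub>center C\<^esub> z = x \<otimes>\<^bsub>center C\<^esub> z \<oplus>\<^bsub>center C\<^esub> y \<otimes>\<^bsub>center C\<^esub> z"
    unfolding center_simps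
    by (rule restrict_ext) (use center_arr[OF xyz(1)] center_arr[OF xyz(2)] center_arr[OF xyz(3)] in simp)
qed

end

text \<open>The factorization does not depend on \<open>L\<close>, so one image decides nullity
  modulo several subcategories at once.\<close>

lemma (in serre_subcategory) null_iff_image:
  assumes "is_epi C e" "is_mono C m" "Cod C e = Dom C m"
  shows "null (m \<cdot> e) \<longleftrightarrow> Dom C m \<in> L"
  using null_image[OF assms] nullI[OF epi_arr[OF assms(1)] mono_arr[OF assms(2)] assms(3)] by blast

section \<open>Functors between quotients and restriction of central elements\<close>

locale serre_quotient_pair = A: serre_quotient C L + B: serre_quotient C L'
  for C :: "('o, 'm) addcat" (structure) and L L' :: "'o set" +
  assumes sub: "L \<subseteq> L'"
begin

abbreviation F :: "'o \<times> 'o \<times> ('m \<times> 'm) set \<Rightarrow> 'o \<times> 'o \<times> ('m \<times> 'm) set" where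
  "F \<equiv> quotient_functor C L L'"

lemma L_isos_mono: "L_isos C L \<subseteq> L_isos C L'"
  unfolding L_isos_def using sub by blast

lemma roof_mono: "A.roof s f \<Longrightarrow> B.roof s f"
  using L_isos_mono by (auto simp: A.roof_def B.roof_def)

text \<open>Roofs equivalent modulo \<open>L\<close> stay equivalent modulo the larger
  \<open>L'\<close>, so all classes in the union defining \<open>F\<close> coincide and any
  representative computes it.\<close>

lemma F_frac:
  assumes "A.roof s f"
  shows "F (A.frac s f) = B.frac s f"
proof -
  have r: "B.roof s f" by (rule roof_mono[OF assms])
  have "roof_class C L' X Y (s', f') = roof_class C L' X Y (s, f)"
    if "(s', f') \<in> roof_class C L X Y (s, f)" for s' f' X Y
  proof (rule B.roof_class_eqI)
    have 1: "A.roof s' f'" "roof_eq C L (s, f) (s', f')" using that by (simp_all add: A.in_roof_class)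
    show "B.roof s' f'" by (rule roof_mono[OF 1(1)])
    have "roof_eq C L' (s, f) (s', f')"
      using 1(2) L_isos_mono unfolding A.roof_eq_iff B.roof_eq_iff by blast
    then show "roof_eq C L' (s', f') (s, f)" by (rule B.roof_eq_sym)
  qed (rule r)
  moreover have "(s, f) \<in> roof_class C L (Cod C s) (Cod C f) (s, f)"
    using assms A.roof_eq_refl by (simp add: A.in_roof_class)
  ultimately show ?thesis unfolding quotient_functor_def A.frac_def B.frac_def by fast
qed

lemma F_hom: "a \<in> homset A.Q X Y \<Longrightarrow> F a \<in> homset B.Q X Y"
  unfolding A.in_homset_frac B.in_homset_frac using F_frac roof_mono by blast

lemma F_arr: "a \<in> Arr A.Q \<Longrightarrow> F a \<in> Arr B.Q \<and> Dom B.Q (F a) = Dom A.Q a \<and> Cod B.Q (F a) = Cod A.Q a"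
  using F_hom[of a "Dom A.Q a" "Cod A.Q a"] by (simp add: homset_def)

lemma F_ident: "X \<in> Obj C \<Longrightarrow> F (Ident A.Q X) = Ident B.Q X"
  using A.frac_ident[of "Ident C X" X] B.frac_ident[of "Ident C X" X] F_frac[of "Ident C X" "Ident C X"]
  by (simp add: A.roof_def)

lemma F_comp:
  assumes "a \<in> Arr A.Q" "b \<in> Arr A.Q" "Cod A.Q a = Dom A.Q b"
  shows "F (b \<cdot>\<^bsub>A.Q\<^esub> a) = F b \<cdot>\<^bsub>B.Q\<^esub> F a"
proof -
  obtain s f where s: "A.roof s f" "a = A.frac s f" using assms(1) by (rule A.fracE)
  obtain t g where t: "A.roof t g" "b = A.frac t g" using assms(2) by (rule A.fracE)
  note sD = A.roofD[OF s(1)] and tD = A.roofD[OF t(1)]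
  have c: "Cod C f = Cod C t" using assms(3) s t by simp
  obtain u y where u: "u \<in> L_isos C L" "y \<in> Arr C" "Cod C u = Dom C s" "Cod C y = Dom C t" "Dom C y = Dom C u"
    "f \<cdot> u = t \<cdot> y" "A.frac s f = A.frac (s \<cdot> u) (t \<cdot> y)" "A.roof (s \<cdot> u) (t \<cdot> y)"
    by (rule A.frac_liftE[OF s(1) tD(1) c])
  have d: "Dom C y = Dom C (s \<cdot> u)" using u(1,3,5) sD A.L_isos_arr by simp
  have r: "A.roof (s \<cdot> u) (g \<cdot> y)" using A.roofD(1)[OF u(8)] d u(2,4) tD by (simp add: A.roof_def)
  have "F (b \<cdot>\<^bsub>A.Q\<^esub> a) = B.frac (s \<cdot> u) (g \<cdot> y)"
    unfolding s t u(7) A.frac_comp_lift[OF u(8) t(1) u(2,4) d] by (rule F_frac[OF r])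
  also have "\<dots> = B.frac t g \<cdot>\<^bsub>B.Q\<^esub> B.frac (s \<cdot> u) (t \<cdot> y)"
    by (rule B.frac_comp_lift[OF roof_mono[OF u(8)] roof_mono[OF t(1)] u(2,4) d, symmetric])
  also have "\<dots> = F b \<cdot>\<^bsub>B.Q\<^esub> F a" using F_frac[OF u(8)] F_frac[OF t(1)] s t u(7) by simp
  finally show ?thesis .
qed

lemma F_plus:
  assumes "a \<in> Arr A.Q" "b \<in> Arr A.Q" "Dom A.Q a = Dom A.Q b" "Cod A.Q a = Cod A.Q b"
  shows "F (Plus A.Q a b) = Plus B.Q (F a) (F b)"
proof -
  obtain s f g where s: "A.roof s f" "A.roof s g" "a = A.frac s f" "b = A.frac s g"
    by (rule A.frac_commonE[OF assms(1-3)])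
  have c: "Cod C f = Cod C g" using assms(4) s by simp
  show ?thesis unfolding s(3,4) A.frac_plus[OF s(1,2) c] F_frac[OF A.roof_plus[OF s(1,2) c]] F_frac[OF s(1)] F_frac[OF s(2)]
    by (rule B.frac_plus[OF s(1,2)[THEN roof_mono] c, symmetric])
qed

text \<open>An arrow of \<open>C / L'\<close> need not come from \<open>C / L\<close>, but it is
  \<open>p \<cdot> i\<close> where \<open>i\<close> is inverse to \<open>q\<close> and
  \<open>p\<close>, \<open>q\<close> are images of arrows of \<open>C\<close>. Naturality at
  \<open>p\<close> and \<open>q\<close> is transported by \<open>F\<close>, and naturality at an
  isomorphism implies it at the inverse.\<close>

lemma center_restrict_closed:
  assumes z: "z \<in> carrier (center A.Q)"
  shows "center_restrict C L L' z \<in> carrier (center B.Q)"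
proof -
  interpret QA: preadditive_category A.Q by (rule A.Q_preadditive)
  interpret QB: preadditive_category B.Q by (rule B.Q_preadditive)
  have zA: "z X \<in> Arr A.Q" "Dom A.Q (z X) = X" "Cod A.Q (z X) = X" if "X \<in> Obj C" for X
    using QA.center_arr[OF z] that by simp_all
  have FA: "F (z X) \<in> Arr B.Q" "Dom B.Q (F (z X)) = X" "Cod B.Q (F (z X)) = X" if "X \<in> Obj C" for X
    using F_arr[OF zA(1)[OF that]] zA[OF that] by simp_all
  have nat: "F (z (Cod B.Q b)) \<cdot>\<^bsub>B.Q\<^esub> b = b \<cdot>\<^bsub>B.Q\<^esub> F (z (Dom B.Q b))" if b: "b \<in> Arr B.Q" for b
  proof -
    obtain s f where s: "B.roof s f" "b = B.frac s f" using b by (rule B.fracE)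
    note sD = B.roofD[OF s(1)]
    let ?I = "Ident C (Dom C s)"
    have W: "Dom C s \<in> Obj C" using sD by simp
    have ra: "A.roof ?I s" "A.roof ?I f" using sD by (simp_all add: A.roof_def)
    have rb: "B.roof s ?I" "B.roof s s" "B.roof ?I ?I" using sD by (simp_all add: B.roof_def)
    define q where "q = B.frac ?I s"
    define p where "p = B.frac ?I f"
    define i where "i = B.frac s ?I"
    have qA: "q \<in> Arr B.Q" "Dom B.Q q = Dom C s" "Cod B.Q q = Cod C s"
      and pA: "p \<in> Arr B.Q" "Dom B.Q p = Dom C s" "Cod B.Q p = Cod C f"
      and iA: "i \<in> Arr B.Q" "Dom B.Q i = Cod C s" "Cod B.Q i = Dom C s"
      using ra[THEN roof_mono] rb sD by (simp_all add: q_def p_def i_def)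
    have iq: "i \<cdot>\<^bsub>B.Q\<^esub> q = Ident B.Q (Dom C s)"
    proof -
      have "i \<cdot>\<^bsub>B.Q\<^esub> B.frac ?I (s \<cdot> ?I) = B.frac ?I (?I \<cdot> ?I)"
        unfolding i_def by (rule B.frac_comp_lift) (use ra rb sD roof_mono in simp_all)
      then show ?thesis using B.frac_ident[of ?I "Dom C s"] sD by (simp add: q_def)
    qed
    have pi: "p \<cdot>\<^bsub>B.Q\<^esub> i = b"
    proof -
      have "p \<cdot>\<^bsub>B.Q\<^esub> B.frac s (?I \<cdot> ?I) = B.frac s (f \<cdot> ?I)"
        unfolding p_def by (rule B.frac_comp_lift) (use ra rb sD roof_mono in simp_all)
      then show ?thesis using sD by (simp add: i_def s(2))
    qed
    have qi: "q \<cdot>\<^bsub>B.Q\<^esub> i = Ident B.Q (Cod C s)"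
    proof -
      have "q \<cdot>\<^bsub>B.Q\<^esub> B.frac s (?I \<cdot> ?I) = B.frac s (s \<cdot> ?I)"
        unfolding q_def by (rule B.frac_comp_lift) (use ra rb sD roof_mono in simp_all)
      then show ?thesis using B.frac_ident[OF sD(1) refl] sD by (simp add: i_def)
    qed
    have Fn: "F (z (Cod C g)) \<cdot>\<^bsub>B.Q\<^esub> B.frac ?I g = B.frac ?I g \<cdot>\<^bsub>B.Q\<^esub> F (z (Dom C s))"
      if g: "A.roof ?I g" for g
    proof -
      have gD: "g \<in> Arr C" "Dom C g = Dom C s" using A.roofD[OF g] sD by simp_all
      have "z (Cod C g) \<cdot>\<^bsub>A.Q\<^esub> A.frac ?I g = A.frac ?I g \<cdot>\<^bsub>A.Q\<^esub> z (Dom C s)"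
        by (rule QA.center_nat[OF z]) (use g gD W in simp_all)
      then have "F (z (Cod C g) \<cdot>\<^bsub>A.Q\<^esub> A.frac ?I g) = F (A.frac ?I g \<cdot>\<^bsub>A.Q\<^esub> z (Dom C s))" by simp
      then show ?thesis using F_comp zA g gD W by (simp add: F_frac)
    qed
    let ?x = "F (z (Cod C s))" and ?w = "F (z (Dom C s))" and ?y = "F (z (Cod C f))"
    note A = FA[of "Cod C s"] FA[OF W] FA[of "Cod C f"] qA pA iA sD W
    have "?x = ?x \<cdot>\<^bsub>B.Q\<^esub> (q \<cdot>\<^bsub>B.Q\<^esub> i)" using A by (simp add: qi)
    also have "\<dots> = q \<cdot>\<^bsub>B.Q\<^esub> (?w \<cdot>\<^bsub>B.Q\<^esub> i)"
      using QB.comp_reassoc[OF Fn[OF ra(1), folded q_def], of i] A by simp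
    finally have "i \<cdot>\<^bsub>B.Q\<^esub> ?x = i \<cdot>\<^bsub>B.Q\<^esub> (q \<cdot>\<^bsub>B.Q\<^esub> (?w \<cdot>\<^bsub>B.Q\<^esub> i))" by simp
    also have "\<dots> = ?w \<cdot>\<^bsub>B.Q\<^esub> i" using QB.comp_rw[OF iq, of "?w \<cdot>\<^bsub>B.Q\<^esub> i"] A by simp
    finally have ix: "i \<cdot>\<^bsub>B.Q\<^esub> ?x = ?w \<cdot>\<^bsub>B.Q\<^esub> i" .
    have "b \<cdot>\<^bsub>B.Q\<^esub> ?x = p \<cdot>\<^bsub>B.Q\<^esub> (i \<cdot>\<^bsub>B.Q\<^esub> ?x)" using QB.comp_rw[OF pi, of ?x] A by simp
    also have "\<dots> = p \<cdot>\<^bsub>B.Q\<^esub> (?w \<cdot>\<^bsub>B.Q\<^esub> i)" by (simp add: ix)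
    also have "\<dots> = ?y \<cdot>\<^bsub>B.Q\<^esub> (p \<cdot>\<^bsub>B.Q\<^esub> i)"
      by (rule QB.comp_reassoc[OF Fn[OF ra(2), folded p_def, symmetric]]) (use A in simp_all)
    finally show ?thesis using pi s(2) by simp
  qed
  have "Dom B.Q b \<in> Obj C" "Cod B.Q b \<in> Obj C" if "b \<in> Arr B.Q" for b
    using QB.obj_dom_cod[OF that] by simp_all
  then show ?thesis
    unfolding QB.center_carrier center_restrict_def using FA nat by (simp add: QB.in_hom)
qed

lemma center_restrict_ring_hom: "center_restrict C L L' \<in> ring_hom (center A.Q) (center B.Q)"
proof -
  interpret QA: preadditive_category A.Q by (rule A.Q_preadditive)
  interpret QB: preadditive_category B.Q by (rule B.Q_preadditive)
  show ?thesis
  proof (rule ring_hom_memI)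
    fix z w assume z: "z \<in> carrier (center A.Q)" and w: "w \<in> carrier (center A.Q)"
    note zA = QA.center_arr[OF z, simplified] and wA = QA.center_arr[OF w, simplified]
    show "center_restrict C L L' (z \<otimes>\<^bsub>center A.Q\<^esub> w) =
        center_restrict C L L' z \<otimes>\<^bsub>center B.Q\<^esub> center_restrict C L L' w"
      unfolding center_restrict_def QA.center_simps QB.center_simps
      using zA wA by (simp add: F_comp restrict_def fun_eq_iff)
    show "center_restrict C L L' (z \<oplus>\<^bsub>center A.Q\<^esub> w) =
        center_restrict C L L' z \<oplus>\<^bsub>center B.Q\<^esub> center_restrict C L L' w"
      unfolding center_restrict_def QA.center_simps QB.center_simps
      using zA wA by (simp add: F_plus restrict_def fun_eq_iff)
  next
    show "center_restrict C L L' \<one>\<^bsub>center A.Q\<^esub> = \<one>\<^bsub>center B.Q\<^esub>"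
      unfolding center_restrict_def QA.center_simps QB.center_simps
      by (simp add: F_ident restrict_def fun_eq_iff)
  qed (rule center_restrict_closed)
qed

end

context serre_quotient
begin

lemma pair_refl: "serre_quotient_pair C L L"
  by unfold_locales simp

lemma quotient_functor_refl:
  assumes "a \<in> Arr Q"
  shows "quotient_functor C L L a = a"
proof -
  interpret P: serre_quotient_pair C L L by (rule pair_refl)
  obtain s f where "roof s f" "a = frac s f" using assms by (rule fracE)
  then show ?thesis using P.F_frac by simp
qed

end

lemma quotient_functor_trans:
  fixes C :: "('o, 'm) addcat"
  assumes "serre_quotient C L1" "serre_quotient C L2" "serre_quotient C L3" "L1 \<subseteq> L2" "L2 \<subseteq> L3"
    and a: "a \<in> Arr (quotient_category C L1)"
  shows "quotient_functor C L2 L3 (quotient_functor C L1 L2 a) = quotient_functor C L1 L3 a"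
proof -
  interpret P12: serre_quotient_pair C L1 L2
    using assms by (simp add: serre_quotient_pair_def serre_quotient_pair_axioms_def)
  interpret P23: serre_quotient_pair C L2 L3
    using assms by (simp add: serre_quotient_pair_def serre_quotient_pair_axioms_def)
  interpret P13: serre_quotient_pair C L1 L3
    using assms by (auto simp: serre_quotient_pair_def serre_quotient_pair_axioms_def)
  obtain s f where s: "P12.A.roof s f" "a = P12.A.frac s f" using a by (rule P12.A.fracE)
  show ?thesis unfolding s(2) P12.F_frac[OF s(1)] P13.F_frac[OF s(1)]
    by (rule P23.F_frac[OF P12.roof_mono[OF s(1)]])
qed

text \<open>Over a common denominator in \<open>C / L\<close>, both arrows have numerators in
  \<open>C\<close> whose difference has a single image there. Equality modulo \<open>Ls i\<close>
  puts this image into \<open>Ls i\<close>, so altogether into \<open>L\<close>.\<close>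

lemma quotient_functor_jointly_faithful:
  fixes C :: "('o, 'm) addcat"
  assumes L: "serre_quotient C L" and Ls: "\<And>i. i \<in> I \<Longrightarrow> serre_quotient C (Ls i)"
    and eqL: "L = Obj C \<inter> (\<Inter>i\<in>I. Ls i)"
    and ab: "a \<in> Arr (quotient_category C L)" "b \<in> Arr (quotient_category C L)"
      "Dom (quotient_category C L) a = Dom (quotient_category C L) b"
      "Cod (quotient_category C L) a = Cod (quotient_category C L) b"
    and eq: "\<And>i. i \<in> I \<Longrightarrow> quotient_functor C L (Ls i) a = quotient_functor C L (Ls i) b"
  shows "a = b"
proof -
  interpret A: serre_quotient C L by (rule L)
  obtain s f g where s: "A.roof s f" "A.roof s g" "a = A.frac s f" "b = A.frac s g"
    by (rule A.frac_commonE[OF ab(1-3)])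
  note fD = A.roofD[OF s(1)] and gD = A.roofD[OF s(2)]
  have c: "Cod C f = Cod C g" using ab(4) s by simp
  have d: "A.diff f g \<in> Arr C" using fD gD c by simp
  obtain e m where em: "is_epi C e" "is_mono C m" "Dom C e = Dom C (A.diff f g)"
    "Cod C m = Cod C (A.diff f g)" "Cod C e = Dom C m" "m \<cdot>\<^bsub>C\<^esub> e = A.diff f g"
    using A.image_factorization[OF d] by metis
  have "Dom C m \<in> Ls i" if i: "i \<in> I" for i
  proof -
    interpret P: serre_quotient_pair C L "Ls i"
      using L Ls[OF i] i eqL by (auto simp: serre_quotient_pair_def serre_quotient_pair_axioms_def)
    have "P.B.frac s f = P.B.frac s g" using eq[OF i] s P.F_frac by simp
    then have "P.B.null (m \<cdot>\<^bsub>C\<^esub> e)"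
      unfolding em(6) using P.B.frac_eq_null[OF s(1,2)[THEN P.roof_mono] c] by simp
    then show ?thesis by (rule P.B.null_image[OF em(1,2,5)])
  qed
  \<comment> \<open>\<open>em(2)\<close> supplies membership in \<open>Obj C\<close>, the only
    condition left when \<open>I\<close> is empty.\<close>
  then have "Dom C m \<in> L" using eqL em(2) by simp
  then have "A.null (A.diff f g)" using A.null_iff_image[OF em(1,2,5)] em(6) by simp
  then show ?thesis using A.frac_eq_null[OF s(1,2) c] s(3,4) by simp
qed

text \<open>Zero objects belong to \<open>L\<close> as coproducts of the empty family; the other
  closure properties are part of \<open>localizing\<close>.\<close>

lemma localizing_serre_quotient:
  fixes U :: "'u itself" and C :: "('o, 'm) addcat"
  assumes U: "grothendieck_universe U" and G: "grothendieck_category U C" and L: "localizing U C L"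
  shows "serre_quotient C L"
proof -
  interpret grothendieck_category U C by (rule G)
  note l = L[unfolded localizing_def]
  have sm: "small U ({} :: 'u set)"
  proof -
    have "|UNIV :: nat set| <o |UNIV :: 'u set|" using U by (simp add: grothendieck_universe_def small_def)
    moreover have "|{} :: 'u set| \<le>o |UNIV :: nat set|" by (rule card_of_empty)
    ultimately show ?thesis unfolding small_def by (rule ordLeq_ordLess_trans[rotated])
  qed
  show ?thesis
  proof unfold_locales
    show "N \<in> L" if N: "is_zero_obj C N" for N
    proof -
      have "is_coproduct C ({} :: 'u set) (\<lambda>_. N) N (\<lambda>_. Ident C N)"
        using N by (auto simp: is_coproduct_def is_zero_obj_def)
      then show ?thesis using l sm by fast
    qed
  qed (use l in blast)+
qed

section \<open>Essential complements\<close>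

lemma small_inj:
  assumes "small U B" "inj_on f A" "f ` A \<subseteq> B"
  shows "small U A"
proof -
  have "|A| \<le>o |B|" using assms(2,3) card_of_ordLeq by blast
  then show ?thesis using assms(1) unfolding small_def by (rule ordLeq_ordLess_trans)
qed

lemma small_subset: "small U B \<Longrightarrow> A \<subseteq> B \<Longrightarrow> small U A"
  by (rule small_inj[of U B id]) simp_all

text \<open>Coproducts and diagrams are indexed by sets of elements of \<open>'u\<close>; such an
  injection codes small sets of other types in this form.\<close>

lemma small_ex_inj:
  fixes U :: "'u itself"
  assumes "small U A"
  obtains e :: "'a \<Rightarrow> 'u" where "inj_on e A"
  using assms ordLess_imp_ordLeq card_of_ordLeq unfolding small_def by metis

lemma universe_infinite:
  fixes U :: "'u itself"
  assumes "grothendieck_universe U"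
  shows "infinite (UNIV :: 'u set)"
proof -
  have "|UNIV :: nat set| <o |UNIV :: 'u set|" using assms by (simp add: grothendieck_universe_def small_def)
  then show ?thesis using card_of_ordLeq_infinite ordLess_imp_ordLeq infinite_UNIV_nat by blast
qed

lemma small_image: "small U A \<Longrightarrow> small U (f ` A)"
  using card_of_image ordLeq_ordLess_trans unfolding small_def by blast

lemma small_UN:
  fixes U :: "'u itself" and A :: "'u set" and F :: "'u \<Rightarrow> 'u set"
  assumes "grothendieck_universe U" "small U A" "\<And>a. a \<in> A \<Longrightarrow> small U (F a)"
  shows "small U (\<Union>a\<in>A. F a)"
  using assms by (simp add: grothendieck_universe_def)

text \<open>The universe axiom concerns sets of elements of \<open>'u\<close>; it is transported
  along an injective coding.\<close>

lemma small_Pow: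
  fixes U :: "'u itself"
  assumes "grothendieck_universe U" "small U A"
  shows "small U (Pow A)"
proof -
  obtain e :: "'a \<Rightarrow> 'u" where e: "inj_on e A" by (rule small_ex_inj[OF assms(2)])
  have "small U (e ` A)" by (rule small_image[OF assms(2)])
  then have "small U (Pow (e ` A))" using assms(1) by (simp add: grothendieck_universe_def)
  then show ?thesis
    by (rule small_inj[of U _ "image e"]) (use e inj_on_image_Pow in auto)
qed

section \<open>Maximal complements of subobjects\<close>

locale grothendieck_universe_category = grothendieck_category U C
  for U :: "'u itself" and C :: "('o, 'm) addcat" (structure) +
  assumes universe: "grothendieck_universe U"
begin

text \<open>For monos with a common codomain this is inclusion of subobjects; it is a preorder only,
  as isomorphic subobjects are not identified.\<close>

definition factors :: "'m \<Rightarrow> 'm \<Rightarrow> bool" where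
  "factors f g \<longleftrightarrow> (\<exists>h. h \<in> Arr C \<and> Dom C h = Dom C f \<and> Cod C h = Dom C g \<and> g \<cdot> h = f)"

lemma factors_refl: "f \<in> Arr C \<Longrightarrow> factors f f"
  unfolding factors_def by (intro exI[of _ "Ident C (Dom C f)"]) simp

lemma factors_trans:
  assumes "factors f g" "factors g h" "h \<in> Arr C"
  shows "factors f h"
proof -
  obtain x where x: "x \<in> Arr C" "Dom C x = Dom C f" "Cod C x = Dom C g" "g \<cdot> x = f"
    using assms(1) unfolding factors_def by blast
  obtain y where y: "y \<in> Arr C" "Dom C y = Dom C g" "Cod C y = Dom C h" "h \<cdot> y = g"
    using assms(2) unfolding factors_def by blast
  have "h \<cdot> y \<cdot> x = f" using comp_rw[OF y(4), of x] x y assms(3) by simp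
  then show ?thesis unfolding factors_def by (intro exI[of _ "y \<cdot> x"]) (use x y in simp)
qed

text \<open>
  An upper bound of a directed small family of subobjects \<open>k i\<close> of \<open>X\<close> on which \<open>q\<close> is injective is
  its colimit; exactness, applied to the sequences \<open>k i \<rightarrow> Cod q \<rightarrow> coker (q k i)\<close>, shows that \<open>q\<close>
  stays injective.
\<close>

lemma directed_mono_upper_bound:
  fixes I :: "'u set" and k :: "'u \<Rightarrow> 'm"
  assumes q: "q \<in> Arr C" and I: "small U I" "I \<noteq> {}"
    and k: "\<And>i. i \<in> I \<Longrightarrow> k i \<in> Arr C" "\<And>i. i \<in> I \<Longrightarrow> Cod C (k i) = Dom C q"
      "\<And>i. i \<in> I \<Longrightarrow> is_mono C (q \<cdot> k i)"
    and dir: "\<And>i j. i \<in> I \<Longrightarrow> j \<in> I \<Longrightarrow> \<exists>l\<in>I. factors (k i) (k l) \<and> factors (k j) (k l)"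
  shows "\<exists>\<kappa>. \<kappa> \<in> Arr C \<and> Cod C \<kappa> = Dom C q \<and> is_mono C (q \<cdot> \<kappa>) \<and> (\<forall>i\<in>I. factors (k i) \<kappa>)"
proof -
  \<comment> \<open>The diagram must have its arrows in \<open>'u\<close>. Since \<open>'u\<close>
    is infinite, an injective pairing codes the arrow from \<open>i\<close> to \<open>j\<close> of a
    preorder as an element of \<open>'u\<close>.\<close>
  have "|UNIV \<times> UNIV :: ('u \<times> 'u) set| \<le>o |UNIV :: 'u set|"
    using card_of_Times_same_infinite[OF universe_infinite[OF universe]] ordIso_imp_ordLeq by blast
  then obtain pr :: "'u \<times> 'u \<Rightarrow> 'u" where "inj_on pr (UNIV \<times> UNIV)" using card_of_ordLeq by metis
  then have pr: "inj pr" by simp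
  define un where "un = inv_into UNIV pr"
  have un [simp]: "un (pr x) = x" for x using pr by (simp add: un_def)
  define R where "R = {(i, j). i \<in> I \<and> j \<in> I \<and> factors (k i) (k j)}"
  define J where "J = \<lparr>Obj = I, Arr = pr ` R, Dom = (\<lambda>a. fst (un a)), Cod = (\<lambda>a. snd (un a)),
    Ident = (\<lambda>i. pr (i, i)), Comp = (\<lambda>b a. pr (fst (un a), snd (un b)))\<rparr>"
  have J [simp]: "Obj J = I" "Dom J (pr x) = fst x" "Cod J (pr x) = snd x" "Ident J i = pr (i, i)"
    "pr y \<cdot>\<^bsub>J\<^esub> pr x = pr (fst x, snd y)" for x y i
    by (simp_all add: J_def)
  have ArrJ: "a \<in> Arr J \<longleftrightarrow> (\<exists>i j. a = pr (i, j) \<and> i \<in> I \<and> j \<in> I \<and> factors (k i) (k j))" for a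
    by (auto simp: J_def R_def)
  have homJ: "homset J i j = (if i \<in> I \<and> j \<in> I \<and> factors (k i) (k j) then {pr (i, j)} else {})" for i j
    unfolding homset_def ArrJ by auto
  have smA: "small U (Arr J)"
  proof (rule small_subset)
    show "small U (\<Union>i\<in>I. (\<lambda>j. pr (i, j)) ` I)"
      by (intro small_UN[OF universe I(1)] small_image I(1))
    show "Arr J \<subseteq> (\<Union>i\<in>I. (\<lambda>j. pr (i, j)) ` I)" unfolding ArrJ subset_iff by blast
  qed
  have smO: "small U (Obj J)" using I by simp
  have tr: "factors (k i) (k l)" if "factors (k i) (k j)" "factors (k j) (k l)" "l \<in> I" for i j l
    using factors_trans[OF that(1,2)] k(1) that(3) by blast
  have catJ: "category J"
  proof
    show "Dom J f \<in> Obj J" "Cod J f \<in> Obj J" if "f \<in> Arr J" for f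
      using that by (auto simp: ArrJ)
    show "Ident J X \<in> homset J X X" if "X \<in> Obj J" for X
      using that factors_refl k(1) by (simp add: homJ)
    show "g \<cdot>\<^bsub>J\<^esub> f \<in> homset J X Z" if "f \<in> homset J X Y" "g \<in> homset J Y Z" for f g X Y Z
    proof -
      have x: "f = pr (X, Y)" "g = pr (Y, Z)" "X \<in> I" "Y \<in> I" "Z \<in> I" "factors (k X) (k Y)" "factors (k Y) (k Z)"
        using that by (simp_all add: homJ split: if_splits)
      then show ?thesis using tr[OF x(6,7,5)] by (simp add: homJ)
    qed
  qed (auto simp: homJ split: if_splits)
  have filt: "filtered J"
    unfolding filtered_def
  proof (intro conjI ballI)
    fix i j assume "i \<in> Obj J" "j \<in> Obj J"
    then show "\<exists>l\<in>Obj J. homset J i l \<noteq> {} \<and> homset J j l \<noteq> {}"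
      using dir[of i j] by (auto simp: homJ)
  next
    fix i j a b assume "i \<in> Obj J" "j \<in> Obj J" "a \<in> homset J i j" "b \<in> homset J i j"
    then show "\<exists>l\<in>Obj J. \<exists>c\<in>homset J j l. c \<cdot>\<^bsub>J\<^esub> a = c \<cdot>\<^bsub>J\<^esub> b"
      using factors_refl k(1) by (intro bexI[of _ j] bexI[of _ "pr (j, j)"]) (auto simp: homJ split: if_splits)
  qed (use catJ I in auto)
  define h where "h i j = (SOME x. x \<in> Arr C \<and> Dom C x = Dom C (k i) \<and> Cod C x = Dom C (k j) \<and> k j \<cdot> x = k i)" for i j
  have h: "h i j \<in> Arr C" "Dom C (h i j) = Dom C (k i)" "Cod C (h i j) = Dom C (k j)" "k j \<cdot> h i j = k i"
    if "factors (k i) (k j)" for i j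
    using someI_ex[OF that[unfolded factors_def], folded h_def] by blast+
  have km: "is_mono C (k i)" if "i \<in> I" for i
    using mono_cancel[OF k(3)[OF that]] k(1,2)[OF that] q by simp
  have hu: "h i j = x" if "i \<in> I" "j \<in> I" "factors (k i) (k j)"
    "x \<in> Arr C" "Dom C x = Dom C (k i)" "Cod C x = Dom C (k j)" "k j \<cdot> x = k i" for i j x
    by (rule monoD[OF km[OF that(2)]]) (use h[OF that(3)] that in simp_all)
  have "\<forall>i\<in>I. \<exists>p. is_cokernel C p (q \<cdot> k i)" using k q ex_cokernel by simp
  then obtain p where p0: "\<And>i. i \<in> I \<Longrightarrow> is_cokernel C (p i) (q \<cdot> k i)" by metis
  have p: "p i \<in> Arr C" "Dom C (p i) = Cod C q" "zarr (p i \<cdot> q \<cdot> k i)" "is_epi C (p i)" if "i \<in> I" for i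
    using cokernelD[OF p0[OF that]] k[OF that] q by simp_all
  have "\<exists>g. g \<in> Arr C \<and> Dom C g = Cod C (p i) \<and> Cod C g = Cod C (p j) \<and> g \<cdot> p i = p j"
    if "i \<in> I" "j \<in> I" "factors (k i) (k j)" for i j
  proof -
    have "p j \<cdot> q \<cdot> k i = (p j \<cdot> q \<cdot> k j) \<cdot> h i j"
      unfolding h(4)[OF that(3), symmetric] using h(1-3)[OF that(3)] p(1,2)[OF that(2)] q k(1,2)[OF that(2)] by simp
    then have "zarr (p j \<cdot> q \<cdot> k i)"
      using zarr_comp_right[OF p(3)[OF that(2)] h(1)[OF that(3)]] h(3)[OF that(3)] p(1,2)[OF that(2)] q k(1,2)[OF that(2)]
      by simp
    then show ?thesis using cokernel_factor[OF p0[OF that(1)] p(1)[OF that(2)]] p(2)[OF that(2)] q k(1,2)[OF that(1)]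
      by (metis arr_comp(3))
  qed
  then obtain g where g: "\<And>i j. \<lbrakk>i \<in> I; j \<in> I; factors (k i) (k j)\<rbrakk> \<Longrightarrow>
      g i j \<in> Arr C \<and> Dom C (g i j) = Cod C (p i) \<and> Cod C (g i j) = Cod C (p j) \<and> g i j \<cdot> p i = p j"
    by metis
  have gu: "g i j = x" if "i \<in> I" "j \<in> I" "factors (k i) (k j)"
    "x \<in> Arr C" "Dom C x = Cod C (p i)" "Cod C x = Cod C (p j)" "x \<cdot> p i = p j" for i j x
    by (rule epiD[OF p(4)[OF that(1)]]) (use g[OF that(1-3)] that in simp_all)
  define Fo where "Fo i = Dom C (k i)" for i
  define Fa where "Fa a = h (fst (un a)) (snd (un a))" for a
  define Go where "Go = (\<lambda>i :: 'u. Cod C q)"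
  define Ga where "Ga = (\<lambda>a :: 'u. Ident C (Cod C q))"
  define Ho where "Ho i = Cod C (p i)" for i
  define Ha where "Ha a = g (fst (un a)) (snd (un a))" for a
  have Y: "Cod C q \<in> Obj C" using q by simp
  have FF: "is_functor J C Fo Fa"
    unfolding is_functor_def
  proof (intro conjI ballI impI)
    fix i assume "i \<in> Obj J"
    then have i: "i \<in> I" by simp
    show "Fo i \<in> Obj C" using k(1)[OF i] by (simp add: Fo_def)
    show "Fa (Ident J i) = Ident C (Fo i)"
      using k(1)[OF i] by (simp add: Fa_def Fo_def) (rule hu[OF i i], simp_all add: factors_refl)
  next
    fix a assume "a \<in> Arr J"
    then show "Fa a \<in> homset C (Fo (Dom J a)) (Fo (Cod J a))"
      using h k(1) by (auto simp: ArrJ in_hom Fa_def Fo_def)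
  next
    fix a b assume ab: "a \<in> Arr J" "b \<in> Arr J" "Cod J a = Dom J b"
    then obtain i j l where x: "a = pr (i, j)" "b = pr (j, l)" "i \<in> I" "j \<in> I" "l \<in> I"
      "factors (k i) (k j)" "factors (k j) (k l)" by (auto simp: ArrJ)
    have "k l \<cdot> h j l \<cdot> h i j = k i"
      using comp_rw[OF h(4)[OF x(7)], of "h i j"] h[OF x(6)] h[OF x(7)] k(1)[OF x(5)] by simp
    then show "Fa (b \<cdot>\<^bsub>J\<^esub> a) = Fa b \<cdot> Fa a"
      unfolding Fa_def x by (simp, intro hu x tr[OF x(6,7,5)]) (use h(1-3)[OF x(6)] h(1-3)[OF x(7)] in simp_all)
  qed
  have FG: "is_functor J C Go Ga"
    using Y by (simp add: is_functor_def Go_def Ga_def in_hom)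
  have FH: "is_functor J C Ho Ha"
    unfolding is_functor_def
  proof (intro conjI ballI impI)
    fix i assume "i \<in> Obj J"
    then have i: "i \<in> I" by simp
    show "Ho i \<in> Obj C" using p(1)[OF i] by (simp add: Ho_def)
    show "Ha (Ident J i) = Ident C (Ho i)"
      using p(1)[OF i] k(1)[OF i] by (simp add: Ha_def Ho_def) (rule gu[OF i i], simp_all add: factors_refl)
  next
    fix a assume "a \<in> Arr J"
    then show "Ha a \<in> homset C (Ho (Dom J a)) (Ho (Cod J a))"
      using g p(1) by (auto simp: ArrJ in_hom Ha_def Ho_def)
  next
    fix a b assume ab: "a \<in> Arr J" "b \<in> Arr J" "Cod J a = Dom J b"
    then obtain i j l where x: "a = pr (i, j)" "b = pr (j, l)" "i \<in> I" "j \<in> I" "l \<in> I"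
      "factors (k i) (k j)" "factors (k j) (k l)" by (auto simp: ArrJ)
    note g1 = g[OF x(3,4,6)] and g2 = g[OF x(4,5,7)]
    have "(g j l \<cdot> g i j) \<cdot> p i = p l" using g1 g2 p(1)[OF x(3)] by simp
    then show "Ha (b \<cdot>\<^bsub>J\<^esub> a) = Ha b \<cdot> Ha a"
      unfolding Ha_def x by (simp, intro gu x tr[OF x(6,7,5)]) (use g1 g2 in simp_all)
  qed
  have na: "nat_trans J C Fo Fa Go Ga (\<lambda>i. q \<cdot> k i)"
    unfolding nat_trans_def
  proof (intro conjI ballI)
    fix i assume "i \<in> Obj J"
    then show "q \<cdot> k i \<in> homset C (Fo i) (Go i)" using k q by (simp add: in_hom Fo_def Go_def)
  next
    fix a assume "a \<in> Arr J"
    then obtain i j where x: "a = pr (i, j)" "i \<in> I" "j \<in> I" "factors (k i) (k j)" by (auto simp: ArrJ)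
    show "(q \<cdot> k (Cod J a)) \<cdot> Fa a = Ga a \<cdot> q \<cdot> k (Dom J a)"
      using h[OF x(4)] k(1,2) x q by (simp add: Fa_def Ga_def)
  qed
  have nb: "nat_trans J C Go Ga Ho Ha p"
    unfolding nat_trans_def
  proof (intro conjI ballI)
    fix i assume "i \<in> Obj J"
    then show "p i \<in> homset C (Go i) (Ho i)" using p Y by (simp add: in_hom Ho_def Go_def)
  next
    fix a assume "a \<in> Arr J"
    then obtain i j where x: "a = pr (i, j)" "i \<in> I" "j \<in> I" "factors (k i) (k j)" by (auto simp: ArrJ)
    show "p (Cod J a) \<cdot> Ga a = Ha a \<cdot> p (Dom J a)"
      using g[OF x(2-4)] p x by (simp add: Ha_def Ga_def)
  qed
  have se: "short_exact C (q \<cdot> k i) (p i)" if "i \<in> Obj J" for i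
    using that p0 mono_kernel_cokernel[OF k(3) p0] by (simp add: short_exact_def)
  obtain K l where K: "is_colimit J C Fo Fa K l" using filtered_colimits[OF filt smO smA FF] by blast
  obtain Z n where Z: "is_colimit J C Ho Ha Z n" using filtered_colimits[OF filt smO smA FH] by blast
  \<comment> \<open>The index category is connected, as any two indices have an upper bound. Hence
    the constant diagram on \<open>Cod C q\<close> has colimit \<open>Cod C q\<close>, and the
    arrows \<open>n i \<cdot> p i\<close> all coincide.\<close>
  have const: "m i = m j" if c: "\<And>a. a \<in> Arr J \<Longrightarrow> m (Cod J a) = m (Dom J a)" and ij: "i \<in> I" "j \<in> I" for m :: "'u \<Rightarrow> 'm" and i j
  proof -
    obtain l where l: "l \<in> I" "factors (k i) (k l)" "factors (k j) (k l)" using dir[OF ij] by blast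
    then have "pr (i, l) \<in> Arr J" "pr (j, l) \<in> Arr J" using ij unfolding ArrJ by blast+
    then show ?thesis using c[of "pr (i, l)"] c[of "pr (j, l)"] by simp
  qed
  obtain i0 where i0: "i0 \<in> I" using I by blast
  have G: "is_colimit J C Go Ga (Cod C q) (\<lambda>_. Ident C (Cod C q))"
    unfolding is_colimit_def
  proof (intro conjI allI impI)
    show "is_cocone J C Go Ga (Cod C q) (\<lambda>_. Ident C (Cod C q))"
      using Y by (simp add: is_cocone_def Go_def Ga_def in_hom)
    fix W m assume "is_cocone J C Go Ga W m"
    then have m: "m i \<in> homset C (Cod C q) W" "a \<in> Arr J \<Longrightarrow> m (Cod J a) \<cdot> Ident C (Cod C q) = m (Dom J a)"
      if "i \<in> I" for i a using that unfolding is_cocone_def Go_def Ga_def by auto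
    have "m (Cod J a) = m (Dom J a)" if a: "a \<in> Arr J" for a
    proof -
      have "Cod J a \<in> I" using a by (auto simp: ArrJ)
      then show ?thesis using m(1)[of "Cod J a"] m(2)[OF i0 a] by (simp add: in_hom)
    qed
    then have "m i = m i0" if "i \<in> I" for i using const[of m] that i0 by blast
    moreover have "m i0 \<cdot> Ident C (Cod C q) = m i0" using m(1)[OF i0] by (simp add: in_hom)
    moreover have "x = m i0" if "x \<in> homset C (Cod C q) W" "\<forall>i\<in>Obj J. x \<cdot> Ident C (Cod C q) = m i" for x
      using that i0 by (simp add: in_hom)
    ultimately show "\<exists>!x. x \<in> homset C (Cod C q) W \<and> (\<forall>i\<in>Obj J. x \<cdot> Ident C (Cod C q) = m i)"
      using m(1)[OF i0] J(1) by metis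
  qed
  have "is_cocone J C Fo Fa (Dom C q) k"
    unfolding is_cocone_def using q k h by (auto simp: Fo_def Fa_def in_hom ArrJ)
  then obtain \<kappa> where "\<kappa> \<in> homset C K (Dom C q)" "\<forall>i\<in>Obj J. \<kappa> \<cdot> l i = k i"
    using K unfolding is_colimit_def by blast
  then have \<kappa>: "\<kappa> \<in> Arr C" "Dom C \<kappa> = K" "Cod C \<kappa> = Dom C q" "\<And>i. i \<in> I \<Longrightarrow> \<kappa> \<cdot> l i = k i"
    by (simp_all add: in_hom)
  have l: "l i \<in> Arr C" "Dom C (l i) = Dom C (k i)" "Cod C (l i) = K" if "i \<in> I" for i
    using K that unfolding is_colimit_def is_cocone_def by (auto simp: in_hom Fo_def)
  have n: "n i \<in> Arr C" "Dom C (n i) = Cod C (p i)" "Cod C (n i) = Z" if "i \<in> I" for i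
    using Z that unfolding is_colimit_def is_cocone_def by (auto simp: in_hom Ho_def)
  have nH: "n (Cod J a) \<cdot> Ha a = n (Dom J a)" if "a \<in> Arr J" for a
    using Z that unfolding is_colimit_def is_cocone_def by blast
  have "n (Cod J a) \<cdot> p (Cod J a) = n (Dom J a) \<cdot> p (Dom J a)" if "a \<in> Arr J" for a
  proof -
    obtain i j where x: "a = pr (i, j)" "i \<in> I" "j \<in> I" "factors (k i) (k j)" using \<open>a \<in> Arr J\<close> by (auto simp: ArrJ)
    note g1 = g[OF x(2-4)]
    have "n j \<cdot> g i j = n i" using nH[OF that] by (simp add: x Ha_def)
    then have "n j \<cdot> g i j \<cdot> p i = n i \<cdot> p i"
      using comp_rw[of "n j" "g i j" "n i" "p i"] g1 n[OF x(3)] p(1)[OF x(2)] by simp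
    then show ?thesis using g1 x by simp
  qed
  then have bc: "n i \<cdot> p i = n i0 \<cdot> p i0" if "i \<in> I" for i
    using const[of "\<lambda>i. n i \<cdot> p i"] that i0 by blast
  have "short_exact C (q \<cdot> \<kappa>) (n i0 \<cdot> p i0)"
  proof (rule filtered_colimits_exact[OF filt smO smA FF FG FH na nb se K G Z])
    show "q \<cdot> \<kappa> \<in> homset C K (Cod C q)" using q \<kappa>(1-3) by (auto simp: in_hom)
    show "n i0 \<cdot> p i0 \<in> homset C (Cod C q) Z" using n[OF i0] p[OF i0] Y by (auto simp: in_hom)
    fix i assume "i \<in> Obj J"
    then have i: "i \<in> I" by simp
    show "(q \<cdot> \<kappa>) \<cdot> l i = Ident C (Cod C q) \<cdot> (q \<cdot> k i)" using q \<kappa>(1-3) \<kappa>(4)[OF i] l[OF i] k[OF i] by simp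
    show "(n i0 \<cdot> p i0) \<cdot> Ident C (Cod C q) = n i \<cdot> p i" using bc[OF i] n[OF i0] p[OF i0] by simp
  qed
  then have "is_mono C (q \<cdot> \<kappa>)" using kernelD(5) by (auto simp: short_exact_def)
  moreover have "factors (k i) \<kappa>" if "i \<in> I" for i
    unfolding factors_def using l[OF that] \<kappa>(4)[OF that] \<kappa>(2) by (intro exI[of _ "l i"]) simp
  ultimately show ?thesis using \<kappa>(1,3) by blast
qed

text \<open>Zorn's lemma is applied to the sets \<open>S k\<close> of points of \<open>k\<close>
  with values at a generator, not to the arrows \<open>k\<close>. By \<open>S1\<close> and
  \<open>S2\<close> inclusion of these sets is \<open>factors\<close>, and since they are subsets of
  one small hom-set, every chain of them is small and can be indexed in \<open>'u\<close>.\<close>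

lemma ex_maximal_mono:
  assumes q: "q \<in> Arr C"
  shows "\<exists>k. k \<in> Arr C \<and> Cod C k = Dom C q \<and> is_mono C (q \<cdot> k) \<and>
    (\<forall>j. j \<in> Arr C \<and> Cod C j = Dom C q \<and> is_mono C (q \<cdot> j) \<and> factors k j \<longrightarrow> factors j k)"
proof -
  obtain G where G: "is_generator C G" using ex_generator by blast
  then have GO: "G \<in> Obj C" by (simp add: is_generator_def)
  define P where "P = {k \<in> Arr C. Cod C k = Dom C q \<and> is_mono C (q \<cdot> k)}"
  define S where "S k = {g \<in> homset C G (Dom C q). \<exists>h\<in>homset C G (Dom C k). g = k \<cdot> h}" for k
  have Pm: "is_mono C k" if "k \<in> P" for k
    using that mono_cancel[of q k] q by (simp add: P_def)
  have Pa: "k \<in> Arr C" "Cod C k = Dom C q" if "k \<in> P" for k using that by (simp_all add: P_def)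
  have S1: "factors k k'" if k: "k \<in> P" "k' \<in> P" "S k \<subseteq> S k'" for k k'
  proof -
    have "Cod C k = Cod C k'" using Pa k by simp
    then obtain x where "x \<in> Arr C" "Dom C x = Dom C k" "Cod C x = Dom C k'" "k' \<cdot> x = k"
    proof (rule mono_factor[OF Pm[OF k(2)] Pa(1)[OF k(1)]])
      fix w assume w: "w \<in> Arr C" "Dom C w = Cod C k'" "zarr (w \<cdot> k')"
      note wk = w(1,2) Pa[OF k(1)] Pa[OF k(2)]
      show "zarr (w \<cdot> k)"
      proof (rule ccontr)
        assume "\<not> zarr (w \<cdot> k)"
        then have "w \<cdot> k \<noteq> Zero C (Dom C k) (Cod C w)" using wk by (simp add: zarr_def)
        moreover have "w \<cdot> k \<in> homset C (Dom C k) (Cod C w)" "Zero C (Dom C k) (Cod C w) \<in> homset C (Dom C k) (Cod C w)"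
          "Dom C k \<in> Obj C" "Cod C w \<in> Obj C"
          using wk by (simp_all add: in_hom)
        \<comment> \<open>The generator provides a point of \<open>k\<close> that \<open>w\<close>
          does not kill; it is also a point of \<open>k'\<close>, which \<open>w\<close>
          kills.\<close>
        ultimately obtain g where g: "g \<in> homset C G (Dom C k)" "(w \<cdot> k) \<cdot> g \<noteq> Zero C (Dom C k) (Cod C w) \<cdot> g"
          using G unfolding is_generator_def by blast
        have "k \<cdot> g \<in> S k" using g wk q by (auto simp: S_def in_hom)
        then obtain g' where g': "g' \<in> homset C G (Dom C k')" "k \<cdot> g = k' \<cdot> g'" using k(3) by (auto simp: S_def)
        have "(w \<cdot> k) \<cdot> g = (w \<cdot> k') \<cdot> g'" using g' g wk by (simp add: in_hom)
        moreover have "zarr ((w \<cdot> k') \<cdot> g')" by (rule zarr_comp_right[OF w(3)]) (use g' wk in \<open>simp_all add: in_hom\<close>)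
        ultimately show False using g g' wk by (simp add: zarr_def in_hom)
      qed
    qed
    then show ?thesis unfolding factors_def by blast
  qed
  have S2: "S k \<subseteq> S k'" if k: "k \<in> P" "k' \<in> P" "factors k k'" for k k'
  proof
    fix g assume "g \<in> S k"
    then obtain y where y: "g \<in> homset C G (Dom C q)" "y \<in> homset C G (Dom C k)" "g = k \<cdot> y" by (auto simp: S_def)
    obtain x where x: "x \<in> Arr C" "Dom C x = Dom C k" "Cod C x = Dom C k'" "k' \<cdot> x = k"
      using k(3) unfolding factors_def by blast
    have "k \<cdot> y = k' \<cdot> (x \<cdot> y)" using comp_rw[OF x(4), of y] y x Pa k by (simp add: in_hom)
    moreover have "x \<cdot> y \<in> homset C G (Dom C k')" using x y Pa[OF k(2)] by (simp add: in_hom)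
    ultimately show "g \<in> S k'" using y by (auto simp: S_def)
  qed
  have smS: "small U (Pow (homset C G (Dom C q)))"
    by (rule small_Pow[OF universe locally_small]) (use GO q in simp_all)
  then obtain enc :: "'m set \<Rightarrow> 'u" where enc: "inj_on enc (Pow (homset C G (Dom C q)))" by (rule small_ex_inj)
  have "\<exists>M\<in>S ` P. \<forall>X\<in>S ` P. M \<subseteq> X \<longrightarrow> X = M"
  proof (rule subset_Zorn)
    fix \<C> assume "subset.chain (S ` P) \<C>"
    then have ch: "\<C> \<subseteq> S ` P" "\<And>x y. x \<in> \<C> \<Longrightarrow> y \<in> \<C> \<Longrightarrow> x \<subseteq> y \<or> y \<subseteq> x"
      by (auto simp: subset_chain_def)
    show "\<exists>M\<in>S ` P. \<forall>X\<in>\<C>. X \<subseteq> M"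
    proof (cases "\<C> = {}")
      case True
      \<comment> \<open>The empty chain needs some member of \<open>P\<close>: the zero
        subobject.\<close>
      obtain N where N: "N \<in> Obj C" "is_zero_obj C N" by (rule zero_objE)
      have "is_mono C (Zero C N (Cod C q))"
      proof (rule mono_zeroI)
        fix w assume w: "w \<in> Arr C" "Cod C w = Dom C (Zero C N (Cod C q))"
        have "zarr (Ident C N \<cdot> w)" by (rule zarr_comp_right) (use N w q zero_obj_iff in simp_all)
        then show "zarr w" using w N q by simp
      qed (use N q in simp)
      then have "Zero C N (Dom C q) \<in> P" using N q by (simp add: P_def)
      then show ?thesis using True by blast
    next
      case False
      have CP: "\<C> \<subseteq> Pow (homset C G (Dom C q))" using ch(1) by (auto simp: S_def)
      define I where "I = enc ` \<C>"
      have "inj_on (inv_into \<C> enc) I" "inv_into \<C> enc ` I \<subseteq> Pow (homset C G (Dom C q))"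
        using inv_into_into[of _ enc \<C>] CP by (auto simp: I_def intro!: inj_on_inv_into)
      then have smI: "small U I" by (rule small_inj[OF smS])
      have encC: "inj_on enc \<C>" using enc CP by (rule inj_on_subset)
      have "\<forall>X\<in>\<C>. \<exists>k\<in>P. S k = X" using ch(1) by blast
      then obtain \<kappa> where \<kappa>: "\<And>X. X \<in> \<C> \<Longrightarrow> \<kappa> X \<in> P" "\<And>X. X \<in> \<C> \<Longrightarrow> S (\<kappa> X) = X" by metis
      define k where "k i = \<kappa> (inv_into \<C> enc i)" for i
      have ke: "k (enc X) = \<kappa> X" if "X \<in> \<C>" for X using inv_into_f_f[OF encC that] by (simp add: k_def)
      have kP: "k i \<in> P" if "i \<in> I" for i using that ke \<kappa> by (auto simp: I_def)
      have "\<exists>\<mu>. \<mu> \<in> Arr C \<and> Cod C \<mu> = Dom C q \<and> is_mono C (q \<cdot> \<mu>) \<and> (\<forall>i\<in>I. factors (k i) \<mu>)"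
      proof (rule directed_mono_upper_bound[OF q smI])
        show "I \<noteq> {}" using False by (simp add: I_def)
        fix i assume "i \<in> I"
        then show "k i \<in> Arr C" "Cod C (k i) = Dom C q" "is_mono C (q \<cdot> k i)" using kP by (simp_all add: P_def)
      next
        fix i j assume "i \<in> I" "j \<in> I"
        then obtain X Y where XY: "X \<in> \<C>" "Y \<in> \<C>" "i = enc X" "j = enc Y" by (auto simp: I_def)
        have kk: "factors (\<kappa> X) (\<kappa> X)" "factors (\<kappa> Y) (\<kappa> Y)" using \<kappa>(1) XY Pa factors_refl by blast+
        have "factors (\<kappa> X) (\<kappa> Y) \<or> factors (\<kappa> Y) (\<kappa> X)" using ch(2)[OF XY(1,2)] S1 \<kappa> XY by metis
        then show "\<exists>l\<in>I. factors (k i) (k l) \<and> factors (k j) (k l)"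
          using XY ke kk by (auto simp: I_def)
      qed
      then obtain \<mu> where \<mu>: "\<mu> \<in> P" "\<And>i. i \<in> I \<Longrightarrow> factors (k i) \<mu>" by (auto simp: P_def)
      have "X \<subseteq> S \<mu>" if X: "X \<in> \<C>" for X
      proof -
        have "factors (\<kappa> X) \<mu>" using \<mu>(2)[of "enc X"] ke[OF X] X by (simp add: I_def)
        then show ?thesis using S2[OF \<kappa>(1)[OF X] \<mu>(1)] \<kappa>(2)[OF X] by simp
      qed
      then show ?thesis using \<mu>(1) by blast
    qed
  qed
  then obtain k where k: "k \<in> P" "\<And>j. j \<in> P \<Longrightarrow> S k \<subseteq> S j \<Longrightarrow> S j = S k" by blast
  have "factors j k" if "j \<in> P" "factors k j" for j
    using S1[OF that(1) k(1)] k(2)[OF that(1) S2[OF k(1) that]] by simp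
  then show ?thesis using k(1) by (intro exI[of _ k]) (auto simp: P_def)
qed

end

section \<open>Pullbacks of epis and quotients of subobjects\<close>

context abelian_category
begin

text \<open>The cokernel half of the Ore condition for the Serre class of zero objects. It stands in
  for choosing preimages: an arrow into \<open>Cod C t\<close> lifts through \<open>t\<close> after
  composition with an epi.\<close>

lemma ex_pullback_epi:
  assumes f: "f \<in> Arr C" and t: "is_epi C t" and e: "Cod C f = Cod C t"
  obtains u v where "pullback f t u v" "is_epi C u"
proof -
  have tA: "t \<in> Arr C" using t by simp
  interpret Z: serre_subcategory C "{N. is_zero_obj C N}" by (rule serre_zero)
  have nz: "zarr g" if "Z.null g" for g
  proof -
    obtain a b where ab: "a \<in> Arr C" "b \<in> Arr C" "Dom C a = Dom C g" "Cod C a = Dom C b"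
      "Cod C b = Cod C g" "is_zero_obj C (Dom C b)" "b \<cdot> a = g"
      using \<open>Z.null g\<close> unfolding Z.null_def by blast
    have "zarr (Ident C (Dom C b) \<cdot> a)" by (rule zarr_comp_right) (use ab zero_obj_iff in simp_all)
    then have "zarr a" using ab by simp
    then have "zarr (b \<cdot> a)" by (rule zarr_comp_left) (use ab in simp_all)
    then show ?thesis using ab by simp
  qed
  obtain u v where pb: "pullback f t u v"
    and epi: "\<forall>w. w \<in> Arr C \<and> Dom C w = Cod C u \<and> zarr (w \<cdot> u) \<longrightarrow>
       (\<exists>m f' t' w'. is_mono C m \<and> f' \<in> Arr C \<and> t' \<in> Arr C \<and> w' \<in> Arr C \<and> Cod C f' = Dom C m \<and>
         Cod C t' = Dom C m \<and> Dom C w' = Dom C m \<and> m \<cdot> f' = f \<and> m \<cdot> t' = t \<and> w' \<cdot> f' = w \<and> zarr (w' \<cdot> t'))"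
    by (rule ex_pullback[OF f tA e])
  have "is_epi C u"
  proof (rule epi_zeroI[OF pullbackD(1)[OF pb]])
    fix w assume w: "w \<in> Arr C" "Dom C w = Cod C u" "zarr (w \<cdot> u)"
    obtain m f' t' w' where m: "is_mono C m" "f' \<in> Arr C" "t' \<in> Arr C" "w' \<in> Arr C" "Cod C f' = Dom C m"
         "Cod C t' = Dom C m" "Dom C w' = Dom C m" "m \<cdot> f' = f" "m \<cdot> t' = t" "w' \<cdot> f' = w" "zarr (w' \<cdot> t')"
      using epi w by blast
    have "Z.null w'"
    proof (rule Z.cokernel_null_restrict[OF m(1,3,6) _ m(4,7,11)])
      fix x assume x: "x \<in> Arr C" "Dom C x = Cod C m" "zarr (x \<cdot> (m \<cdot> t'))"
      have "Cod C m = Cod C t" using m(1,3,6,9) arr_comp(3)[of t' m] by simp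
      then show "Z.null x" using epi_zeroD[OF t _ x(1)] x m(9) Z.null_zarr by simp
    qed
    then have "zarr (w' \<cdot> f')" by (intro zarr_comp_right nz) (use m in simp_all)
    then show "zarr w" using m by simp
  qed
  then show thesis using that[OF pb] by blast
qed

text \<open>This is the inclusion \<open>Y / K \<rightarrow> X / K\<close> for
  \<open>K \<le> Y \<le> X\<close>. An arrow \<open>y\<close> killed by \<open>\<mu>\<close> lifts
  along \<open>e\<close> to some \<open>v\<close>; since \<open>c\<close> kills
  \<open>\<sigma> \<cdot> v\<close>, the lift lies in \<open>K\<close>, and \<open>e\<close> kills
  it.\<close>

lemma cokernel_restrict_mono:
  assumes \<sigma>: "is_mono C \<sigma>" and e: "is_epi C e" "Dom C e = Dom C \<sigma>" and k: "is_kernel C k e"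
    and c: "is_cokernel C c (\<sigma> \<cdot> k)"
  obtains \<mu> where "is_mono C \<mu>" "Dom C \<mu> = Cod C e" "Cod C \<mu> = Cod C c" "\<mu> \<cdot> e = c \<cdot> \<sigma>"
proof -
  note kD = kernelD[OF k] and cD = cokernelD[OF c]
  have A: "\<sigma> \<in> Arr C" "e \<in> Arr C" using \<sigma> e by simp_all
  have sk: "is_mono C (\<sigma> \<cdot> k)" by (rule mono_comp) (use \<sigma> kD e in simp_all)
  have dc: "Dom C c = Cod C \<sigma>" using cD kD A e by simp
  have z: "zarr ((c \<cdot> \<sigma>) \<cdot> k)" using cD kD A e dc by simp
  obtain \<mu> where m: "\<mu> \<in> Arr C" "Cod C \<mu> = Cod C (c \<cdot> \<sigma>)" "Dom C \<mu> = Cod C e" "\<mu> \<cdot> e = c \<cdot> \<sigma>"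
    by (rule cokernel_factor[OF epi_cokernel_kernel[OF e(1) k], of "c \<cdot> \<sigma>"]) (use z cD(1) kD(3) A e dc in auto)
  have "is_mono C \<mu>"
  proof (rule mono_zeroI[OF m(1)])
    fix y assume y: "y \<in> Arr C" "Cod C y = Dom C \<mu>" "zarr (\<mu> \<cdot> y)"
    obtain u v where uv: "pullback y e u v" "is_epi C u"
      by (rule ex_pullback_epi[OF y(1) e(1)]) (use y m in auto)
    note d = pullbackD[OF uv(1)]
    have "c \<cdot> \<sigma> \<cdot> v = \<mu> \<cdot> e \<cdot> v"
      using comp_rw[OF m(4), of v] d(2,5) A m(1,3) cD(1) dc e by simp
    also have "\<dots> = (\<mu> \<cdot> y) \<cdot> u" using d(1-5) d(6)[symmetric] m(1,3) y(1,2) by simp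
    finally have "zarr (c \<cdot> \<sigma> \<cdot> v)" using zarr_comp_right[OF y(3) d(1)] d(4) y m(1) by simp
    moreover have "\<sigma> \<cdot> v \<in> Arr C" "Cod C (\<sigma> \<cdot> v) = Dom C c" using d A e dc by simp_all
    ultimately obtain h where h: "h \<in> Arr C" "Dom C h = Dom C (\<sigma> \<cdot> v)" "Cod C h = Dom C (\<sigma> \<cdot> k)" "(\<sigma> \<cdot> k) \<cdot> h = \<sigma> \<cdot> v"
      using kernel_factor[OF mono_kernel_cokernel[OF sk c], of "\<sigma> \<cdot> v"] by metis
    have h': "Dom C h = Dom C v" "Cod C h = Dom C k" using h d A e kD by simp_all
    have "\<sigma> \<cdot> (k \<cdot> h) = \<sigma> \<cdot> v" using h h' A e kD by simp
    then have kh: "k \<cdot> h = v" by (rule monoD[OF \<sigma>]) (use h h' A e kD d in simp_all)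
    have "zarr ((e \<cdot> k) \<cdot> h)" by (rule zarr_comp_right[OF kD(4)]) (use h h' A e kD in simp_all)
    then have "zarr (y \<cdot> u)" using d(6) kh h(1) h' A e kD by simp
    then show "zarr y" by (rule epi_zeroD[OF uv(2)]) (use y d in simp_all)
  qed
  then show ?thesis using that[of \<mu>] m A cD(1) dc by simp
qed

end

context grothendieck_universe_category
begin

text \<open>With \<open>q\<close> the quotient by \<open>A\<close>, the condition
  \<open>K \<inter> A = 0\<close> becomes monicity of \<open>q \<cdot> k\<close>, so
  \<open>ex_maximal_mono\<close> applies. The preimage of a nonzero subobject of
  \<open>X / K\<close> is strictly larger than \<open>K\<close>, hence meets \<open>A\<close>, and
  the intersection embeds in both. The last property expresses \<open>K \<inter> A = 0\<close> on
  arrows.\<close>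

lemma ex_essential_complement:
  assumes a: "is_mono C a"
  obtains k p where "is_mono C k" "Cod C k = Cod C a" "is_cokernel C p k" "is_essential C (p \<cdot> a)"
    "\<And>v w. \<lbrakk>v \<in> Arr C; w \<in> Arr C; Cod C v = Dom C a; Cod C w = Dom C k; a \<cdot> v = k \<cdot> w\<rbrakk> \<Longrightarrow> zarr w"
proof -
  have aA: "a \<in> Arr C" using a by simp
  obtain q where q: "is_cokernel C q a" "q \<in> Arr C" "Dom C q = Cod C a" "zarr (q \<cdot> a)" "is_epi C q"
    using cokernelE[OF aA] by metis
  obtain k where k: "k \<in> Arr C" "Cod C k = Dom C q" "is_mono C (q \<cdot> k)"
    "\<And>j. \<lbrakk>j \<in> Arr C; Cod C j = Dom C q; is_mono C (q \<cdot> j); factors k j\<rbrakk> \<Longrightarrow> factors j k"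
    using ex_maximal_mono[OF q(2)] by blast
  have km: "is_mono C k" using mono_cancel[OF k(3)] k q by simp
  obtain p where p: "is_cokernel C p k" "p \<in> Arr C" "Dom C p = Cod C k" "zarr (p \<cdot> k)" "is_epi C p"
    using cokernelE[OF k(1)] by metis
  have int: "zarr w" if "v \<in> Arr C" "w \<in> Arr C" "Cod C v = Dom C a" "Cod C w = Dom C k" "a \<cdot> v = k \<cdot> w" for v w
  proof (rule mono_zeroD[OF k(3)])
    have "zarr ((q \<cdot> a) \<cdot> v)" by (rule zarr_comp_right[OF q(4)]) (use that q aA in simp_all)
    then show "zarr ((q \<cdot> k) \<cdot> w)" using that q aA k by simp
  qed (use that q k in simp_all)
  have pa: "is_mono C (p \<cdot> a)"
  proof (rule mono_zeroI)
    fix w assume w: "w \<in> Arr C" "Cod C w = Dom C (p \<cdot> a)" "zarr ((p \<cdot> a) \<cdot> w)"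
    have w': "Cod C w = Dom C a" using w p k q aA by simp
    have "zarr (p \<cdot> (a \<cdot> w))" using w(1,3) w' p k q aA by simp
    moreover have "a \<cdot> w \<in> Arr C" "Cod C (a \<cdot> w) = Dom C p" using w w' aA p k q by simp_all
    ultimately obtain h where h: "h \<in> Arr C" "Cod C h = Dom C k" "k \<cdot> h = a \<cdot> w"
      using kernel_factor[OF mono_kernel_cokernel[OF km p(1)]] by metis
    have "zarr h" by (rule int[OF w(1) h(1) w' h(2) h(3)[symmetric]])
    then have "zarr (k \<cdot> h)" by (rule zarr_comp_left) (use h k in simp_all)
    then have "zarr (a \<cdot> w)" using h by simp
    then show "zarr w" by (rule mono_zeroD[OF a]) (use w w' in simp_all)
  qed (use p k q aA in simp)
  have "is_essential C (p \<cdot> a)"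
    unfolding is_essential_def
  proof (intro conjI allI impI pa)
    fix j assume j': "is_mono C j \<and> Cod C j = Cod C (p \<cdot> a) \<and> \<not> is_zero_obj C (Dom C j)"
    then have j: "is_mono C j" "j \<in> Arr C" "Cod C j = Cod C p" "\<not> is_zero_obj C (Dom C j)"
      using p k q aA by simp_all
    obtain u v where uv: "pullback j p u v" "is_epi C u"
      by (rule ex_pullback_epi[OF j(2) p(5) j(3)])
    note d = pullbackD[OF uv(1)]
    have vm: "is_mono C v" by (rule pullback_mono_right[OF uv(1) j(1) p(2)])
    have dv: "Cod C v = Dom C q" using d p k by simp
    \<comment> \<open>Otherwise maximality puts the preimage \<open>v\<close> of \<open>j\<close>
      inside \<open>k\<close>, so \<open>p \<cdot> v = j \<cdot> u\<close> is zero, and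
      \<open>u\<close> being epi makes \<open>Dom C j\<close> a zero object.\<close>
    have "\<not> is_mono C (q \<cdot> v)"
    proof
      assume m: "is_mono C (q \<cdot> v)"
      have "j \<cdot> Zero C (Dom C k) (Dom C j) = p \<cdot> k" using p k j by (simp add: zarr_def)
      then obtain h where h: "h \<in> Arr C" "Dom C h = Dom C k" "Cod C h = Dom C v" "v \<cdot> h = k"
        by (rule pullback_factor[OF uv(1)]) (use p k j in auto)
      have "factors k v" using h unfolding factors_def by blast
      then have "factors v k" using k(4) d dv m by blast
      then obtain h' where h': "h' \<in> Arr C" "Cod C h' = Dom C k" "k \<cdot> h' = v" unfolding factors_def by blast
      have "zarr ((p \<cdot> k) \<cdot> h')" by (rule zarr_comp_right[OF p(4)]) (use h' p k in simp_all)
      then have "zarr (j \<cdot> u)" using d(6) h' p k by simp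
      then have "zarr u" by (rule mono_zeroD[OF j(1)]) (use d in simp_all)
      then have "zarr (Ident C (Dom C j) \<cdot> u)" using d by simp
      then have "zarr (Ident C (Dom C j))" by (rule epi_zeroD[OF uv(2)]) (use d j in simp_all)
      then show False using j zero_obj_iff by simp
    qed
    then obtain w where w: "w \<in> Arr C" "Cod C w = Dom C (q \<cdot> v)" "zarr ((q \<cdot> v) \<cdot> w)" "\<not> zarr w"
      using mono_zeroI[of "q \<cdot> v"] q d dv by auto
    \<comment> \<open>\<open>Dom C x\<close> is the intersection of \<open>A\<close> with the
      preimage of \<open>j\<close>: it maps to \<open>A\<close> by the \<open>y\<close> below and to
      \<open>Dom C j\<close> by \<open>u \<cdot> x\<close>.\<close>
    obtain x where x: "is_kernel C x (q \<cdot> v)" "x \<in> Arr C" "Cod C x = Dom C (q \<cdot> v)" "zarr ((q \<cdot> v) \<cdot> x)" "is_mono C x"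
      by (rule kernelE[of "q \<cdot> v"]) (use q d dv in auto)
    have cx: "Cod C x = Dom C v" using x d dv q by simp
    obtain h where h: "h \<in> Arr C" "Cod C h = Dom C x" "x \<cdot> h = w"
      using kernel_factor[OF x(1) w(1-3)] by metis
    have nz: "\<not> is_zero_obj C (Dom C x)"
    proof
      assume "is_zero_obj C (Dom C x)"
      then have "zarr (Ident C (Dom C x))" using zero_obj_iff x by simp
      then have "zarr (x \<cdot> Ident C (Dom C x))" by (rule zarr_comp_left) (use x in simp_all)
      then have "zarr x" using x by simp
      then have "zarr (x \<cdot> h)" by (rule zarr_comp_right) (use h in simp_all)
      then show False using h w by simp
    qed
    have vx: "v \<cdot> x \<in> Arr C" "Dom C (v \<cdot> x) = Dom C x" "Cod C (v \<cdot> x) = Dom C q" using x cx d dv by simp_all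
    have "zarr (q \<cdot> (v \<cdot> x))" using x cx d dv q by simp
    then obtain y where y: "y \<in> Arr C" "Dom C y = Dom C x" "Cod C y = Dom C a" "a \<cdot> y = v \<cdot> x"
      using kernel_factor[OF mono_kernel_cokernel[OF a q(1)] vx(1)] vx by metis
    have "is_mono C (a \<cdot> y)" unfolding y(4) by (rule mono_comp[OF x(5) vm cx])
    then have ym: "is_mono C y" by (rule mono_cancel) (use y aA in simp_all)
    have eq: "(p \<cdot> a) \<cdot> y = j \<cdot> (u \<cdot> x)"
    proof -
      have "j \<cdot> (u \<cdot> x) = p \<cdot> (v \<cdot> x)" by (rule comp_reassoc[OF d(6)]) (use d x cx j p in simp_all)
      then show ?thesis using y p k q aA by simp
    qed
    have "is_mono C (j \<cdot> (u \<cdot> x))" unfolding eq[symmetric] by (rule mono_comp[OF ym pa]) (use y p k q aA in simp)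
    then have um: "is_mono C (u \<cdot> x)" by (rule mono_cancel) (use d x cx j in simp_all)
    show "\<exists>W b c. W \<in> Obj C \<and> \<not> is_zero_obj C W \<and> is_mono C b \<and> is_mono C c \<and>
           b \<in> homset C W (Dom C (p \<cdot> a)) \<and> c \<in> homset C W (Dom C j) \<and> (p \<cdot> a) \<cdot> b = j \<cdot> c"
      by (rule exI[of _ "Dom C x"], rule exI[of _ y], rule exI[of _ "u \<cdot> x"])
        (use nz ym um eq x cx y d j p k q aA in \<open>simp add: in_hom\<close>)
  qed
  then show ?thesis using that[OF km _ p(1)] int k q by metis
qed

lemma stable_serre:
  assumes "L \<in> stable_localizing U C"
  shows "serre_quotient C L"
  using assms localizing_serre_quotient[OF universe grothendieck_category_axioms] by (simp add: stable_localizing_def)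

lemma stable_complementE:
  assumes L: "L \<in> stable_localizing U C" and a: "is_mono C a" "Dom C a \<in> L"
  obtains k where "is_mono C k" "k \<in> L_isos C L" "Cod C k = Cod C a"
    "\<And>v w. \<lbrakk>v \<in> Arr C; w \<in> Arr C; Cod C v = Dom C a; Cod C w = Dom C k; a \<cdot> v = k \<cdot> w\<rbrakk> \<Longrightarrow> zarr w"
proof -
  interpret S: serre_quotient C L by (rule stable_serre[OF L])
  show thesis
  proof (rule ex_essential_complement[OF a(1)])
    fix k p assume k: "is_mono C k" "Cod C k = Cod C a" "is_cokernel C p k" "is_essential C (p \<cdot> a)"
      "\<And>v w. \<lbrakk>v \<in> Arr C; w \<in> Arr C; Cod C v = Dom C a; Cod C w = Dom C k; a \<cdot> v = k \<cdot> w\<rbrakk> \<Longrightarrow> zarr w"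
    have pa: "p \<in> Arr C" "Dom C p = Cod C a" using cokernelD[OF k(3)] k by simp_all
    have "Dom C (p \<cdot> a) \<in> L" using pa a by simp
    then have "Cod C (p \<cdot> a) \<in> L" using L k(4) by (simp add: stable_localizing_def)
    then have "Cod C p \<in> L" using pa a by simp
    then have "k \<in> L_isos C L" by (rule S.mono_iso_cokernel[OF k(1,3)])
    then show thesis using that[of k] k(1,2,5) by blast
  qed
qed

end

section \<open>Gluing\<close>

lemma serre_quotient_pairI:
  "serre_quotient C L \<Longrightarrow> serre_quotient C L' \<Longrightarrow> L \<subseteq> L' \<Longrightarrow> serre_quotient_pair C L L'"
  by (simp add: serre_quotient_pair_def serre_quotient_pair_axioms_def)

lemma coproduct_desc:
  assumes "is_coproduct C I X S \<iota>" "Y \<in> Obj C" "\<And>i. i \<in> I \<Longrightarrow> f i \<in> homset C (X i) Y"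
  obtains h where "h \<in> homset C S Y" "\<And>i. i \<in> I \<Longrightarrow> h \<cdot>\<^bsub>C\<^esub> \<iota> i = f i"
  using assms unfolding is_coproduct_def by metis

lemma (in category) coproduct_unique:
  assumes "is_coproduct C I X S \<iota>" "g \<in> homset C S Y" "h \<in> homset C S Y"
    "\<And>i. i \<in> I \<Longrightarrow> g \<cdot> \<iota> i = h \<cdot> \<iota> i"
  shows "g = h"
proof -
  have Y: "Y \<in> Obj C" and i: "\<forall>i\<in>I. h \<cdot> \<iota> i \<in> homset C (X i) Y"
    using assms(1,3) by (auto simp: in_hom is_coproduct_def)
  have u: "\<forall>f. (\<forall>i\<in>I. f i \<in> homset C (X i) Y) \<longrightarrow> (\<exists>!x. x \<in> homset C S Y \<and> (\<forall>i\<in>I. x \<cdot> \<iota> i = f i))"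
    using assms(1) Y unfolding is_coproduct_def by blast
  have "\<exists>!x. x \<in> homset C S Y \<and> (\<forall>i\<in>I. x \<cdot> \<iota> i = h \<cdot> \<iota> i)"
    using spec[OF u, of "\<lambda>i. h \<cdot> \<iota> i"] i by (rule mp)
  then show ?thesis using assms(2-4) by blast
qed

lemma localizing_coproduct:
  fixes U :: "'u itself" and I :: "'u set"
  assumes "localizing U C L" "small U I" "\<And>i. i \<in> I \<Longrightarrow> X i \<in> L" "is_coproduct C I X S \<iota>"
  shows "S \<in> L"
  using assms unfolding localizing_def by (elim conjE) (metis Pi_I)

section \<open>Joins of stable localizing subcategories as classes of extensions\<close>

context grothendieck_universe_category
begin

lemma localizing_serre: "localizing U C L \<Longrightarrow> serre_quotient C L"
  using localizing_serre_quotient[OF universe grothendieck_category_axioms] .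

lemma stable_localizingD: "L \<in> stable_localizing U C \<Longrightarrow> localizing U C L"
  by (simp add: stable_localizing_def)

text \<open>
  For monic \<open>i\<close>, membership in \<open>L_isos C L2\<close> says that the cokernel of \<open>i\<close> lies in \<open>L2\<close>.
\<close>

definition ext_class :: "'o set \<Rightarrow> 'o set \<Rightarrow> 'o set" where
  "ext_class L1 L2 = {X \<in> Obj C. \<exists>i. is_mono C i \<and> Cod C i = X \<and> Dom C i \<in> L1 \<and> i \<in> L_isos C L2}"

lemma ext_classI: "is_mono C i \<Longrightarrow> Dom C i \<in> L1 \<Longrightarrow> i \<in> L_isos C L2 \<Longrightarrow> Cod C i \<in> ext_class L1 L2"
  unfolding ext_class_def by auto

text \<open>For \<open>A \<le> X\<close> with \<open>A\<close> in \<open>L1\<close> and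
  \<open>X / A\<close> in \<open>L2\<close>, a subobject \<open>Y\<close> contains
  \<open>Y \<inter> A\<close> in \<open>L1\<close>, and \<open>Y / (Y \<inter> A)\<close> embeds in
  \<open>X / A\<close>.\<close>

lemma ext_class_sub:
  assumes L1: "localizing U C L1" and L2: "localizing U C L2"
    and m: "is_mono C m" "Cod C m \<in> ext_class L1 L2"
  shows "Dom C m \<in> ext_class L1 L2"
proof -
  interpret S1: serre_quotient C L1 by (rule localizing_serre[OF L1])
  interpret S2: serre_quotient C L2 by (rule localizing_serre[OF L2])
  obtain i where i: "is_mono C i" "Cod C i = Cod C m" "Dom C i \<in> L1" "i \<in> L_isos C L2"
    using m(2) by (auto simp: ext_class_def)
  have A: "m \<in> Arr C" "i \<in> Arr C" using m i by simp_all
  obtain u v where uv: "pullback m i u v" "u \<in> L_isos C L2"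
    by (rule S2.ex_pullback_iso[OF A(1) i(4)]) (use i in auto)
  note d = pullbackD[OF uv(1)]
  have um: "is_mono C u" by (rule pullback_mono_left[OF uv(1) i(1) A(1)])
  have vm: "is_mono C v" by (rule pullback_mono_right[OF uv(1) m(1) A(2)])
  have "Dom C u \<in> L1" using S1.L_sub[OF vm] d i by simp
  then show ?thesis using ext_classI[OF um _ uv(2)] d by simp
qed

text \<open>The image of the \<open>L1\<close>-part serves: its cokernel is a quotient of the
  cokernel of \<open>i\<close>.\<close>

lemma ext_class_quot:
  assumes L1: "localizing U C L1" and L2: "localizing U C L2"
    and e: "is_epi C e" "Dom C e \<in> ext_class L1 L2"
  shows "Cod C e \<in> ext_class L1 L2"
proof -
  interpret S1: serre_quotient C L1 by (rule localizing_serre[OF L1])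
  interpret S2: serre_quotient C L2 by (rule localizing_serre[OF L2])
  obtain i where i: "is_mono C i" "Cod C i = Dom C e" "Dom C i \<in> L1" "i \<in> L_isos C L2"
    using e(2) by (auto simp: ext_class_def)
  have A: "e \<in> Arr C" "i \<in> Arr C" using e i by simp_all
  have ei: "e \<cdot> i \<in> Arr C" "Dom C (e \<cdot> i) = Dom C i" "Cod C (e \<cdot> i) = Cod C e" using A i by simp_all
  obtain \<epsilon> \<mu> where f: "is_epi C \<epsilon>" "is_mono C \<mu>" "Dom C \<epsilon> = Dom C i" "Cod C \<mu> = Cod C e"
    "Cod C \<epsilon> = Dom C \<mu>" "\<mu> \<cdot> \<epsilon> = e \<cdot> i"
    using image_factorization[OF ei(1)] ei by metis
  have "Dom C \<mu> \<in> L1" using S1.L_quot[OF f(1)] f i by simp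
  moreover have "\<mu> \<in> L_isos C L2"
  proof (rule S2.mono_isoI[OF f(2)])
    fix w assume w: "w \<in> Arr C" "Dom C w = Cod C \<mu>" "zarr (w \<cdot> \<mu>)"
    have "zarr ((w \<cdot> \<mu>) \<cdot> \<epsilon>)" by (rule zarr_comp_right[OF w(3)]) (use w f in simp_all)
    then have "zarr ((w \<cdot> e) \<cdot> i)" using w f A i by simp
    then have "S2.null (w \<cdot> e)"
      by (intro S2.L_isosD(3)[OF i(4) _ _ S2.null_zarr]) (use w f A i in simp_all)
    then show "S2.null w"
      by (rule S2.cokernel_null_cancel[OF A(1) S2.null_zarr[OF epi_zeroD[OF e(1)]] w(1), rotated -1])
        (use w f in simp_all)
  qed
  ultimately show ?thesis using ext_classI[OF f(2)] f(4) by simp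
qed

text \<open>Write \<open>Y \<le> E\<close> for \<open>i\<close>, with \<open>Y1 \<le> Y\<close> in
  \<open>L1\<close> and \<open>Y / Y1\<close> in \<open>L2\<close>. The layers of \<open>E\<close>
  come in the order \<open>L1, L2, L1, L2\<close>, and stability of \<open>L2\<close> exchanges the
  middle two: \<open>Y / Y1\<close> has a complement \<open>m\<close> in \<open>E / Y1\<close> with
  cokernel in \<open>L2\<close>. It embeds in \<open>Cod C p\<close>, so it has an
  \<open>L1\<close>-part \<open>i3\<close> with quotient in \<open>L2\<close>. The preimage of
  \<open>i3\<close> in \<open>E\<close> is an extension of it by \<open>Y1\<close>, hence in
  \<open>L1\<close>, and has quotient in \<open>L2\<close>.\<close>

lemma ext_class_ext:
  assumes L1: "localizing U C L1" and L2: "L2 \<in> stable_localizing U C"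
    and se: "short_exact C i p" and ip: "Dom C i \<in> ext_class L1 L2" "Cod C p \<in> ext_class L1 L2"
  shows "Cod C i \<in> ext_class L1 L2"
proof -
  note L2' = stable_localizingD[OF L2]
  interpret S1: serre_quotient C L1 by (rule localizing_serre[OF L1])
  interpret S2: serre_quotient C L2 by (rule localizing_serre[OF L2'])
  have k: "is_kernel C i p" using se by (simp add: short_exact_def)
  note kD = kernelD[OF k]
  obtain i1 where i1: "is_mono C i1" "Cod C i1 = Dom C i" "Dom C i1 \<in> L1" "i1 \<in> L_isos C L2"
    using ip(1) by (auto simp: ext_class_def)
  have i1A: "i1 \<in> Arr C" using i1 by simp
  have ii: "is_mono C (i \<cdot> i1)" by (rule mono_comp) (use i1 kD in simp_all)
  obtain c where c: "is_cokernel C c (i \<cdot> i1)" "c \<in> Arr C" "Dom C c = Cod C i" "zarr (c \<cdot> (i \<cdot> i1))" "is_epi C c"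
    by (rule cokernelE[of "i \<cdot> i1"]) (use i1 i1A kD in auto)
  have "zarr ((c \<cdot> i) \<cdot> i1)" using c i1 i1A kD by simp
  then have nci: "S2.null (c \<cdot> i)"
    by (intro S2.L_isosD(3)[OF i1(4) _ _ S2.null_zarr]) (use c i1 kD in simp_all)
  obtain \<epsilon> \<tau> where t: "is_epi C \<epsilon>" "is_mono C \<tau>" "Dom C \<epsilon> = Dom C (c \<cdot> i)" "Cod C \<tau> = Cod C (c \<cdot> i)"
    "Cod C \<epsilon> = Dom C \<tau>" "\<tau> \<cdot> \<epsilon> = c \<cdot> i"
    using image_factorization[OF S2.null_arr[OF nci]] by metis
  have dt: "Dom C \<epsilon> = Dom C i" "Cod C \<tau> = Cod C c" using t c kD by simp_all
  have "Dom C \<tau> \<in> L2" using S2.null_image[OF t(1,2,5)] t(6) nci by simp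
  then obtain m where m: "is_mono C m" "m \<in> L_isos C L2" "Cod C m = Cod C \<tau>"
    "\<And>v w. \<lbrakk>v \<in> Arr C; w \<in> Arr C; Cod C v = Dom C \<tau>; Cod C w = Dom C m; \<tau> \<cdot> v = m \<cdot> w\<rbrakk> \<Longrightarrow> zarr w"
    using stable_complementE[OF L2 t(2)] by metis
  have mA: "m \<in> Arr C" "Cod C m = Cod C c" using m dt by simp_all
  have "zarr ((p \<cdot> i) \<cdot> i1)" by (rule zarr_comp_right[OF kD(4)]) (use kD i1 in simp_all)
  then have "zarr (p \<cdot> (i \<cdot> i1))" using kD i1 i1A by simp
  moreover have "Dom C p = Cod C (i \<cdot> i1)" using kD i1 i1A by simp
  ultimately obtain \<pi> where \<pi>: "\<pi> \<in> Arr C" "Cod C \<pi> = Cod C p" "Dom C \<pi> = Cod C c" "\<pi> \<cdot> c = p"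
    using cokernel_factor[OF c(1) kD(2)] by metis
  \<comment> \<open>If \<open>\<pi> \<cdot> m \<cdot> w\<close> is zero, a lift \<open>y\<close> of
    \<open>m \<cdot> w\<close> to \<open>E\<close> is killed by \<open>p\<close> and so comes from
    \<open>Y\<close>. Thus \<open>m \<cdot> w\<close> lies in \<open>Y / Y1\<close> up to an epi,
    and \<open>m\<close> meets that in zero.\<close>
  have "is_mono C (\<pi> \<cdot> m)"
  proof (rule mono_zeroI)
    fix w assume w: "w \<in> Arr C" "Cod C w = Dom C (\<pi> \<cdot> m)" "zarr ((\<pi> \<cdot> m) \<cdot> w)"
    have cw: "Cod C w = Dom C m" using w \<pi> mA by simp
    have mw: "m \<cdot> w \<in> Arr C" "Dom C (m \<cdot> w) = Dom C w" "Cod C (m \<cdot> w) = Cod C c" using w(1) cw mA by simp_all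
    obtain u y where uy: "pullback (m \<cdot> w) c u y" "is_epi C u"
      by (rule ex_pullback_epi[OF mw(1) c(5) mw(3)])
    note d = pullbackD[OF uy(1)]
    have du: "Cod C u = Dom C w" using d mw by simp
    have "zarr (((\<pi> \<cdot> m) \<cdot> w) \<cdot> u)" by (rule zarr_comp_right[OF w(3)]) (use w(1) cw d du \<pi> mA in simp_all)
    moreover have "((\<pi> \<cdot> m) \<cdot> w) \<cdot> u = \<pi> \<cdot> ((m \<cdot> w) \<cdot> u)" using w(1) cw d(1-5) du \<pi>(1-3) mA by simp
    moreover have "\<pi> \<cdot> (c \<cdot> y) = p \<cdot> y" using comp_rw[OF \<pi>(4), of y] d(2,5) c(2) \<pi>(1-3) by simp
    ultimately have "zarr (p \<cdot> y)" using d(6) by simp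
    moreover have "Cod C y = Dom C p" using d c kD by simp
    ultimately obtain z where z: "z \<in> Arr C" "Dom C z = Dom C y" "Cod C z = Dom C i" "i \<cdot> z = y"
      using kernel_factor[OF k d(2)] by metis
    have "\<tau> \<cdot> (\<epsilon> \<cdot> z) = c \<cdot> (i \<cdot> z)" by (rule comp_reassoc[OF t(6)]) (use z c kD t dt in simp_all)
    also have "\<dots> = m \<cdot> (w \<cdot> u)" using z(4) d(6) w(1) cw d(1-4) du mA by simp
    finally have "zarr (w \<cdot> u)" by (rule m(4)[rotated -1]) (use z t dt w(1) cw d(1) du in simp_all)
    then show "zarr w" by (rule epi_zeroD[OF uy(2)]) (use w du in simp_all)
  qed (use \<pi> mA in simp)
  then have "Dom C (\<pi> \<cdot> m) \<in> ext_class L1 L2"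
    by (rule ext_class_sub[OF L1 L2']) (use \<pi> mA ip in simp)
  then obtain i3 where i3: "is_mono C i3" "Cod C i3 = Dom C m" "Dom C i3 \<in> L1" "i3 \<in> L_isos C L2"
    using \<pi> mA by (auto simp: ext_class_def)
  have i3A: "i3 \<in> Arr C" using i3 by simp
  have mi: "is_mono C (m \<cdot> i3)" "m \<cdot> i3 \<in> L_isos C L2"
    using mono_comp[OF i3(1) m(1) i3(2)] S2.L_isos_comp[OF i3(4) m(2) i3(2)] by simp_all
  have miA: "m \<cdot> i3 \<in> Arr C" "Cod C (m \<cdot> i3) = Cod C c" "Dom C (m \<cdot> i3) = Dom C i3" using i3 i3A mA by simp_all
  obtain u v where uv: "pullback c (m \<cdot> i3) u v" "u \<in> L_isos C L2"
    by (rule S2.ex_pullback_iso[OF c(2) mi(2) miA(2)[symmetric]])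
  note d = pullbackD[OF uv(1)]
  have um: "is_mono C u" by (rule pullback_mono_left[OF uv(1) mi(1) c(2)])
  have ker: "S1.null w" if w: "w \<in> Arr C" "Cod C w = Dom C v" "zarr (v \<cdot> w)" for w
  proof -
    have "zarr ((m \<cdot> i3) \<cdot> v \<cdot> w)" by (rule zarr_comp_left[OF w(3)]) (use w(1,2) d(1-5) miA in simp_all)
    moreover have "c \<cdot> (u \<cdot> w) = (m \<cdot> i3) \<cdot> v \<cdot> w"
      by (rule comp_reassoc[OF d(6)]) (use w(1,2) d(1-5) miA c in simp_all)
    ultimately have "zarr (c \<cdot> (u \<cdot> w))" by simp
    moreover have "u \<cdot> w \<in> Arr C" "Cod C (u \<cdot> w) = Dom C c" using w(1,2) d(1-5) by simp_all
    ultimately obtain z where z: "z \<in> Arr C" "Cod C z = Dom C (i \<cdot> i1)" "(i \<cdot> i1) \<cdot> z = u \<cdot> w"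
      using kernel_factor[OF mono_kernel_cokernel[OF ii c(1)]] by metis
    have "S1.null ((i \<cdot> i1) \<cdot> z)" by (rule S1.nullI) (use z i1 i1A kD in simp_all)
    then have n: "S1.null (u \<cdot> w)" using z by simp
    show ?thesis
    proof (rule S1.kernel_null_cancel[OF d(1) _ w(1) _ n])
      show "S1.null x" if "x \<in> Arr C" "Cod C x = Dom C u" "zarr (u \<cdot> x)" for x
        using S1.null_zarr[OF mono_zeroD[OF um that(3,1,2)]] .
    qed (use w d in simp)
  qed
  \<comment> \<open>The codomain of \<open>v\<close> lies in \<open>L1\<close> and its kernel is
    null by \<open>ker\<close>; cancelling \<open>v\<close> makes the identity of its domain
    null.\<close>
  have "S1.null (v \<cdot> Ident C (Dom C v))"
    by (rule S1.null_cod) (use d miA i3 in simp_all)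
  then have "S1.null (Ident C (Dom C v))"
    by (rule S1.kernel_null_cancel[OF d(2) ker, rotated -1]) (use d in simp_all)
  then have "Dom C u \<in> L1" using S1.null_mono[of "Ident C (Dom C v)"] d by simp
  then show ?thesis using ext_classI[OF um _ uv(2)] d c by simp
qed

text \<open>\<open>Dom C \<mu>\<close> is a quotient of a sum of objects of \<open>L1\<close>. An
  arrow killing \<open>\<mu>\<close> has on each summand an image in \<open>L2\<close>, hence
  factors through the sum of these images. Passing to the image of \<open>f\<close> avoids the
  question whether a sum of monos is monic.\<close>

lemma ext_class_coproduct:
  fixes I :: "'u set"
  assumes L1: "localizing U C L1" and L2: "localizing U C L2"
    and I: "small U I" "\<And>i. i \<in> I \<Longrightarrow> X i \<in> ext_class L1 L2" and S: "is_coproduct C I X S \<iota>"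
  shows "S \<in> ext_class L1 L2"
proof -
  interpret S1: serre_quotient C L1 by (rule localizing_serre[OF L1])
  interpret S2: serre_quotient C L2 by (rule localizing_serre[OF L2])
  have SO: "S \<in> Obj C" and \<iota>: "\<And>i. i \<in> I \<Longrightarrow> \<iota> i \<in> Arr C \<and> Dom C (\<iota> i) = X i \<and> Cod C (\<iota> i) = S"
    using S by (simp_all add: is_coproduct_def in_hom)
  have "\<forall>i\<in>I. \<exists>a. is_mono C a \<and> Cod C a = X i \<and> Dom C a \<in> L1 \<and> a \<in> L_isos C L2"
    using I(2) by (auto simp: ext_class_def)
  then obtain a where a: "\<And>i. i \<in> I \<Longrightarrow> is_mono C (a i)" "\<And>i. i \<in> I \<Longrightarrow> Cod C (a i) = X i"
    "\<And>i. i \<in> I \<Longrightarrow> Dom C (a i) \<in> L1" "\<And>i. i \<in> I \<Longrightarrow> a i \<in> L_isos C L2" by metis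
  have aA: "a i \<in> Arr C" if "i \<in> I" for i using a(1)[OF that] by simp
  obtain T \<tau> where T: "is_coproduct C I (\<lambda>i. Dom C (a i)) T \<tau>"
    using small_coproducts[OF I(1), of "\<lambda>i. Dom C (a i)"] aA by auto
  have TL: "T \<in> L1" by (rule localizing_coproduct[OF L1 I(1) a(3) T])
  have \<tau>: "\<And>i. i \<in> I \<Longrightarrow> \<tau> i \<in> Arr C \<and> Dom C (\<tau> i) = Dom C (a i) \<and> Cod C (\<tau> i) = T"
    using T by (simp add: is_coproduct_def in_hom)
  have fi: "\<iota> i \<cdot> a i \<in> homset C (Dom C (a i)) S" if "i \<in> I" for i
    using \<iota>[OF that] aA[OF that] a(2)[OF that] SO by (simp add: in_hom)
  obtain f where f: "f \<in> homset C T S" "\<And>i. i \<in> I \<Longrightarrow> f \<cdot> \<tau> i = \<iota> i \<cdot> a i"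
    using coproduct_desc[where f = "\<lambda>i. \<iota> i \<cdot> a i", OF T SO fi] by blast
  have fA: "f \<in> Arr C" "Dom C f = T" "Cod C f = S" using f by (simp_all add: in_hom)
  obtain \<epsilon> \<mu> where em: "is_epi C \<epsilon>" "is_mono C \<mu>" "Dom C \<epsilon> = T" "Cod C \<mu> = S" "Cod C \<epsilon> = Dom C \<mu>" "\<mu> \<cdot> \<epsilon> = f"
    using image_factorization[OF fA(1)] fA(2,3) by metis
  have D: "Dom C \<mu> \<in> L1" using S1.L_quot[OF em(1)] em TL by simp
  have "\<mu> \<in> L_isos C L2"
  proof (rule S2.mono_isoI[OF em(2)])
    fix w assume w: "w \<in> Arr C" "Dom C w = Cod C \<mu>" "zarr (w \<cdot> \<mu>)"
    have dw: "Dom C w = S" using w em by simp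
    have "\<exists>e b. is_epi C e \<and> is_mono C b \<and> Dom C e = X i \<and> Cod C b = Cod C w \<and> Cod C e = Dom C b \<and>
        b \<cdot> e = w \<cdot> \<iota> i \<and> Dom C b \<in> L2" if i: "i \<in> I" for i
    proof -
      have "zarr ((w \<cdot> \<mu>) \<cdot> (\<epsilon> \<cdot> \<tau> i))" by (rule zarr_comp_right[OF w(3)]) (use w(1,2) em(1-5) \<tau>[OF i] in simp_all)
      moreover have "(w \<cdot> \<mu>) \<cdot> (\<epsilon> \<cdot> \<tau> i) = w \<cdot> f \<cdot> \<tau> i"
        using comp_rw[OF em(6), of "\<tau> i"] w(1,2) em(1-5) \<tau>[OF i] by simp
      ultimately have "zarr ((w \<cdot> \<iota> i) \<cdot> a i)" using f(2)[OF i] w(1) dw \<iota>[OF i] aA[OF i] a(2)[OF i] by simp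
      then have n: "S2.null (w \<cdot> \<iota> i)"
        by (intro S2.L_isosD(3)[OF a(4)[OF i] _ _ S2.null_zarr]) (use w(1) dw \<iota>[OF i] a(2)[OF i] in simp_all)
      have wi: "w \<cdot> \<iota> i \<in> Arr C" "Dom C (w \<cdot> \<iota> i) = X i" "Cod C (w \<cdot> \<iota> i) = Cod C w" using w(1) dw \<iota>[OF i] by simp_all
      obtain e b where "is_epi C e" "is_mono C b" "Dom C e = X i" "Cod C b = Cod C w" "Cod C e = Dom C b" "b \<cdot> e = w \<cdot> \<iota> i"
        using image_factorization[OF wi(1)] wi(2,3) by metis
      then show ?thesis using S2.null_image[of e b] n by metis
    qed
    then have "\<forall>i\<in>I. \<exists>e b. is_epi C e \<and> is_mono C b \<and> Dom C e = X i \<and> Cod C b = Cod C w \<and> Cod C e = Dom C b \<and>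
        b \<cdot> e = w \<cdot> \<iota> i \<and> Dom C b \<in> L2" by (rule ballI)
    from bchoice[OF this] obtain e where "\<forall>i\<in>I. \<exists>b. is_epi C (e i) \<and> is_mono C b \<and> Dom C (e i) = X i \<and> Cod C b = Cod C w \<and>
        Cod C (e i) = Dom C b \<and> b \<cdot> e i = w \<cdot> \<iota> i \<and> Dom C b \<in> L2" ..
    from bchoice[OF this] obtain b where "\<forall>i\<in>I. is_epi C (e i) \<and> is_mono C (b i) \<and> Dom C (e i) = X i \<and>
        Cod C (b i) = Cod C w \<and> Cod C (e i) = Dom C (b i) \<and> b i \<cdot> e i = w \<cdot> \<iota> i \<and> Dom C (b i) \<in> L2" ..
    then have e: "\<And>i. i \<in> I \<Longrightarrow> is_epi C (e i)" "\<And>i. i \<in> I \<Longrightarrow> is_mono C (b i)" "\<And>i. i \<in> I \<Longrightarrow> Dom C (e i) = X i"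
      "\<And>i. i \<in> I \<Longrightarrow> Cod C (b i) = Cod C w" "\<And>i. i \<in> I \<Longrightarrow> Cod C (e i) = Dom C (b i)"
      "\<And>i. i \<in> I \<Longrightarrow> b i \<cdot> e i = w \<cdot> \<iota> i" "\<And>i. i \<in> I \<Longrightarrow> Dom C (b i) \<in> L2" by blast+
    have A: "e i \<in> Arr C" "b i \<in> Arr C" if "i \<in> I" for i using e(1,2)[OF that] by simp_all
    obtain B \<beta> where B: "is_coproduct C I (\<lambda>i. Dom C (b i)) B \<beta>"
      using small_coproducts[OF I(1), of "\<lambda>i. Dom C (b i)"] A by auto
    have BL: "B \<in> L2" by (rule localizing_coproduct[OF L2 I(1) e(7) B])
    have BO: "B \<in> Obj C" and \<beta>: "\<And>i. i \<in> I \<Longrightarrow> \<beta> i \<in> Arr C \<and> Dom C (\<beta> i) = Dom C (b i) \<and> Cod C (\<beta> i) = B"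
      using B by (simp_all add: is_coproduct_def in_hom)
    have gi: "b i \<in> homset C (Dom C (b i)) (Cod C w)" if "i \<in> I" for i
      using e(4)[OF that] A[OF that] w(1) by (simp add: in_hom)
    have wO: "Cod C w \<in> Obj C" using w(1) by simp
    obtain g where g: "g \<in> homset C B (Cod C w)" "\<And>i. i \<in> I \<Longrightarrow> g \<cdot> \<beta> i = b i"
      using coproduct_desc[where f = b, OF B wO gi] by blast
    have hi: "\<beta> i \<cdot> e i \<in> homset C (X i) B" if "i \<in> I" for i
      using \<beta>[OF that] e(3,5)[OF that] A[OF that] BO \<iota>[OF that] obj_dom_cod(1)[of "e i"] by (simp add: in_hom)
    obtain h where h: "h \<in> homset C S B" "\<And>i. i \<in> I \<Longrightarrow> h \<cdot> \<iota> i = \<beta> i \<cdot> e i"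
      using coproduct_desc[where f = "\<lambda>i. \<beta> i \<cdot> e i", OF S BO hi] by blast
    have gh: "g \<in> Arr C" "Dom C g = B" "Cod C g = Cod C w" "h \<in> Arr C" "Dom C h = S" "Cod C h = B"
      using g h by (simp_all add: in_hom)
    have "g \<cdot> h = w"
    proof (rule coproduct_unique[OF S])
      show "g \<cdot> h \<in> homset C S (Cod C w)" "w \<in> homset C S (Cod C w)" using gh w(1) dw SO by (simp_all add: in_hom)
      fix i assume i: "i \<in> I"
      have "(g \<cdot> h) \<cdot> \<iota> i = g \<cdot> \<beta> i \<cdot> e i" using h(2)[OF i] gh \<iota>[OF i] by simp
      also have "\<dots> = b i \<cdot> e i" by (rule comp_rw[OF g(2)[OF i]]) (use gh \<beta>[OF i] A[OF i] e(5)[OF i] in simp_all)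
      finally show "(g \<cdot> h) \<cdot> \<iota> i = w \<cdot> \<iota> i" using e(6)[OF i] by simp
    qed
    then show "S2.null w" using S2.nullI[of h g] gh BL by simp
  qed
  then show ?thesis using ext_classI[OF em(2) D] em(4) by simp
qed

lemma ext_class_localizing:
  assumes L1: "localizing U C L1" and L2: "L2 \<in> stable_localizing U C"
  shows "localizing U C (ext_class L1 L2)"
proof -
  note L2' = stable_localizingD[OF L2]
  show ?thesis unfolding localizing_def
  proof (intro conjI allI impI)
    show "ext_class L1 L2 \<subseteq> Obj C" by (auto simp: ext_class_def)
    show "Dom C i \<in> ext_class L1 L2" if "is_mono C i \<and> Cod C i \<in> ext_class L1 L2" for i
      using ext_class_sub[OF L1 L2'] that by blast
    show "Cod C i \<in> ext_class L1 L2" if "is_epi C i \<and> Dom C i \<in> ext_class L1 L2" for i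
      using ext_class_quot[OF L1 L2'] that by blast
    show "Cod C i \<in> ext_class L1 L2"
      if "short_exact C i p \<and> Dom C i \<in> ext_class L1 L2 \<and> Cod C p \<in> ext_class L1 L2" for i p
      using ext_class_ext[OF L1 L2] that by blast
    show "S \<in> ext_class L1 L2"
      if "small U I \<and> X \<in> I \<rightarrow> ext_class L1 L2 \<and> is_coproduct C I X S \<iota>" for I :: "'u set" and X S \<iota>
      using ext_class_coproduct[OF L1 L2', of I X S \<iota>] that by blast
  qed
qed

text \<open>By minimality of the join: an object of \<open>L1\<close> is its own
  \<open>L1\<close>-part, and for an object of \<open>L2\<close> the zero subobject serves.\<close>

lemma join_subset_ext_class:
  assumes L1: "localizing U C L1" and L2: "L2 \<in> stable_localizing U C"
  shows "localizing_join U C L1 L2 \<subseteq> ext_class L1 L2"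
proof -
  interpret S1: serre_quotient C L1 by (rule localizing_serre[OF L1])
  interpret S2: serre_quotient C L2 by (rule stable_serre[OF L2])
  have "L1 \<subseteq> ext_class L1 L2"
  proof
    fix X assume X: "X \<in> L1"
    then have "X \<in> Obj C" by (rule S1.L_obj)
    then show "X \<in> ext_class L1 L2" using ext_classI[of "Ident C X" L1 L2] X by simp
  qed
  moreover have "L2 \<subseteq> ext_class L1 L2"
  proof
    fix X assume X: "X \<in> L2"
    then have XO: "X \<in> Obj C" by (rule S2.L_obj)
    obtain N where N: "N \<in> Obj C" "is_zero_obj C N" by (rule zero_objE)
    have m: "is_mono C (Zero C N X)"
    proof (rule mono_zeroI)
      fix w assume w: "w \<in> Arr C" "Cod C w = Dom C (Zero C N X)"
      have "zarr (Ident C N \<cdot> w)" by (rule zarr_comp_right) (use N w XO zero_obj_iff in simp_all)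
      then show "zarr w" using w N XO by simp
    qed (use N XO in simp)
    have "Zero C N X \<in> L_isos C L2"
      by (rule S2.mono_isoI[OF m], rule S2.null_dom) (use N XO X in simp_all)
    then show "X \<in> ext_class L1 L2" using ext_classI[OF m] S1.L_zero N XO by simp
  qed
  ultimately show ?thesis using ext_class_localizing[OF L1 L2] unfolding localizing_join_def by blast
qed

section \<open>Intersections, joins and their distributivity\<close>

lemma localizing_Inter:
  assumes "\<And>L. L \<in> \<A> \<Longrightarrow> localizing U C L"
  shows "localizing U C (Obj C \<inter> \<Inter>\<A>)"
proof -
  note l = assms[unfolded localizing_def]
  show ?thesis
    unfolding localizing_def
  proof (intro conjI allI impI)
    show "Dom C i \<in> Obj C \<inter> \<Inter>\<A>" if "is_mono C i \<and> Cod C i \<in> Obj C \<inter> \<Inter>\<A>" for i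
      using l that mono_arr Dom_Obj by blast
    show "Cod C i \<in> Obj C \<inter> \<Inter>\<A>" if "is_epi C i \<and> Dom C i \<in> Obj C \<inter> \<Inter>\<A>" for i
      using l that epi_arr Cod_Obj by blast
    show "Cod C i \<in> Obj C \<inter> \<Inter>\<A>"
      if "short_exact C i p \<and> Dom C i \<in> Obj C \<inter> \<Inter>\<A> \<and> Cod C p \<in> Obj C \<inter> \<Inter>\<A>" for i p
      using l that kernelD(1) Cod_Obj unfolding short_exact_def by blast
    show "S \<in> Obj C \<inter> \<Inter>\<A>"
      if h: "small U I \<and> X \<in> I \<rightarrow> Obj C \<inter> \<Inter>\<A> \<and> is_coproduct C I X S \<iota>" for I :: "'u set" and X S \<iota>
    proof -
      have "S \<in> L" if "L \<in> \<A>" for L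
        by (rule localizing_coproduct[OF assms[OF that], of I X S \<iota>]) (use h that in auto)
      then show ?thesis using h by (auto simp: is_coproduct_def)
    qed
  qed simp
qed

text \<open>The factor \<open>Obj C\<close> gives the empty intersection its proper value, the whole
  category; this is what the empty covering requires.\<close>

lemma stable_localizing_Inter:
  assumes "\<And>L. L \<in> \<A> \<Longrightarrow> L \<in> stable_localizing U C"
  shows "Obj C \<inter> \<Inter>\<A> \<in> stable_localizing U C"
proof -
  have "Cod C i \<in> Obj C \<inter> \<Inter>\<A>" if i: "is_essential C i" "Dom C i \<in> Obj C \<inter> \<Inter>\<A>" for i
  proof -
    have "i \<in> Arr C" using i by (simp add: is_essential_def)
    moreover have "Cod C i \<in> L" if "L \<in> \<A>" for L
      using assms[OF that] i that by (simp add: stable_localizing_def)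
    ultimately show ?thesis by simp
  qed
  then show ?thesis using localizing_Inter[of \<A>] assms by (simp add: stable_localizing_def)
qed

lemma stable_localizing_Int:
  assumes "L \<in> stable_localizing U C" "M \<in> stable_localizing U C"
  shows "L \<inter> M \<in> stable_localizing U C"
proof -
  have "L \<subseteq> Obj C" using assms(1) by (simp add: stable_localizing_def localizing_def)
  then have "Obj C \<inter> \<Inter>{L, M} = L \<inter> M" by auto
  then show ?thesis using stable_localizing_Inter[of "{L, M}"] assms by auto
qed

lemma localizing_join:
  assumes "localizing U C L" "localizing U C M"
  shows "localizing U C (localizing_join U C L M)" "L \<subseteq> localizing_join U C L M" "M \<subseteq> localizing_join U C L M"
proof -
  let ?A = "{N. localizing U C N \<and> L \<subseteq> N \<and> M \<subseteq> N}"
  \<comment> \<open>The whole category is an upper bound, so the intersection defining the join is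
    over a nonempty family and stays inside \<open>Obj C\<close>.\<close>
  have "Obj C \<in> ?A" using localizing_Inter[of "{}"] assms by (auto simp: localizing_def)
  then have "localizing_join U C L M = Obj C \<inter> \<Inter>?A" unfolding localizing_join_def by blast
  then show "localizing U C (localizing_join U C L M)" using localizing_Inter[of ?A] by simp
qed (auto simp: localizing_join_def)

text \<open>\<open>X\<close> has subobjects \<open>i\<close> in \<open>A\<close> and
  \<open>j\<close> in \<open>B\<close>, both with quotient in \<open>M\<close>. Their intersection
  lies in \<open>A \<inter> B\<close>, and its quotient is still in \<open>M\<close> because arrows
  inverted modulo \<open>M\<close> are stable under pullback and composition.\<close>

lemma join_Int_distrib:
  assumes A: "A \<in> stable_localizing U C" and B: "B \<in> stable_localizing U C" and M: "M \<in> stable_localizing U C"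
  shows "localizing_join U C A M \<inter> localizing_join U C B M \<subseteq> localizing_join U C (A \<inter> B) M"
proof
  fix X assume X: "X \<in> localizing_join U C A M \<inter> localizing_join U C B M"
  have AB: "A \<inter> B \<in> stable_localizing U C" by (rule stable_localizing_Int[OF A B])
  note J = localizing_join[OF stable_localizingD[OF AB] stable_localizingD[OF M]]
  interpret A: serre_quotient C A by (rule stable_serre[OF A])
  interpret B: serre_quotient C B by (rule stable_serre[OF B])
  interpret M: serre_quotient C M by (rule stable_serre[OF M])
  interpret J: serre_quotient C "localizing_join U C (A \<inter> B) M" by (rule localizing_serre[OF J(1)])
  have "X \<in> ext_class A M" "X \<in> ext_class B M"
    using X join_subset_ext_class[OF stable_localizingD[OF A] M] join_subset_ext_class[OF stable_localizingD[OF B] M]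
    by auto
  then obtain i j where i: "is_mono C i" "Cod C i = X" "Dom C i \<in> A" "i \<in> L_isos C M"
    and j: "is_mono C j" "Cod C j = X" "Dom C j \<in> B" "j \<in> L_isos C M"
    unfolding ext_class_def by blast
  have ar: "i \<in> Arr C" "j \<in> Arr C" using i j by simp_all
  obtain u v where uv: "pullback i j u v" "u \<in> L_isos C M"
    by (rule M.ex_pullback_iso[OF ar(1) j(4)]) (use i j in auto)
  note d = pullbackD[OF uv(1)]
  have um: "is_mono C u" by (rule pullback_mono_left[OF uv(1) j(1) ar(1)])
  have vm: "is_mono C v" by (rule pullback_mono_right[OF uv(1) i(1) ar(2)])
  have P: "Dom C u \<in> A \<inter> B" using A.L_sub[OF um] B.L_sub[OF vm] d i j by simp
  have iu: "is_mono C (i \<cdot> u)" "i \<cdot> u \<in> L_isos C M"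
    using mono_comp[OF um i(1)] M.L_isos_comp[OF uv(2) i(4)] d by simp_all
  have du: "Dom C (i \<cdot> u) = Dom C u" "Cod C (i \<cdot> u) = X" using d(1-5) i ar by simp_all
  obtain p where p: "is_cokernel C p (i \<cdot> u)" "p \<in> Arr C" "Dom C p = Cod C (i \<cdot> u)" "zarr (p \<cdot> (i \<cdot> u))" "is_epi C p"
    using cokernelE[of "i \<cdot> u"] iu by auto
  have "M.null p" by (rule M.L_isosD(3)[OF iu(2) p(2,3) M.null_zarr[OF p(4)]])
  then have "Cod C p \<in> M" by (rule M.null_epi[OF p(5)])
  moreover have "short_exact C (i \<cdot> u) p" using mono_kernel_cokernel[OF iu(1) p(1)] p(1) by (simp add: short_exact_def)
  ultimately show "X \<in> localizing_join U C (A \<inter> B) M" using J.L_ext[of "i \<cdot> u" p] P J(2,3) du by auto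
qed

lemma join_INT_distrib:
  fixes Ls :: "nat \<Rightarrow> 'o set"
  assumes "\<And>i. i \<in> {1..n} \<Longrightarrow> Ls i \<in> stable_localizing U C" and M: "M \<in> stable_localizing U C"
  shows "Obj C \<inter> (\<Inter>i\<in>{1..n}. localizing_join U C (Ls i) M) \<subseteq> localizing_join U C (Obj C \<inter> (\<Inter>i\<in>{1..n}. Ls i)) M"
  using assms(1)
proof (induction n)
  case 0
  have "localizing U C (Obj C)" using localizing_Inter[of "{}"] by simp
  then show ?case using localizing_join(2)[OF _ stable_localizingD[OF M]] by simp
next
  case (Suc n)
  let ?L = "Obj C \<inter> (\<Inter>i\<in>{1..n}. Ls i)"
  have sL: "?L \<in> stable_localizing U C" by (rule stable_localizing_Inter) (use Suc.prems in auto)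
  have sS: "Ls (Suc n) \<in> stable_localizing U C" using Suc.prems by simp
  have e: "{1..Suc n} = insert (Suc n) {1..n}" by auto
  have "Obj C \<inter> (\<Inter>i\<in>{1..Suc n}. localizing_join U C (Ls i) M)
      \<subseteq> localizing_join U C ?L M \<inter> localizing_join U C (Ls (Suc n)) M"
    using Suc.IH Suc.prems unfolding e by auto
  also have "\<dots> \<subseteq> localizing_join U C (?L \<inter> Ls (Suc n)) M" by (rule join_Int_distrib[OF sL sS M])
  also have "?L \<inter> Ls (Suc n) = Obj C \<inter> (\<Inter>i\<in>{1..Suc n}. Ls i)" unfolding e by auto
  finally show ?case .
qed

section \<open>Shrinking denominators and gluing fractions\<close>

lemma stable_null_separate:
  assumes L: "L \<in> stable_localizing U C" and \<sigma>: "is_mono C \<sigma>" and d: "serre_subcategory.null C L d" "Dom C d = Dom C \<sigma>"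
  obtains m where "is_mono C m" "m \<in> L_isos C L" "Cod C m = Cod C \<sigma>"
    "\<forall>u v. u \<in> Arr C \<and> v \<in> Arr C \<and> Cod C u = Dom C m \<and> Cod C v = Dom C \<sigma> \<and> m \<cdot> u = \<sigma> \<cdot> v \<longrightarrow> zarr (d \<cdot> v)"
proof -
  interpret S: serre_quotient C L by (rule stable_serre[OF L])
  have sA: "\<sigma> \<in> Arr C" using \<sigma> by simp
  have dA: "d \<in> Arr C" using S.null_arr[OF d(1)] .
  obtain e i where e: "is_epi C e" "is_mono C i" "Dom C e = Dom C \<sigma>" "Cod C i = Cod C d" "Cod C e = Dom C i" "i \<cdot> e = d"
    using image_factorization[OF dA] d(2) by metis
  have QL: "Dom C i \<in> L" using S.null_image[OF e(1,2,5)] e(6) d(1) by simp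
  \<comment> \<open>Let \<open>Y \<le> X\<close> be given by \<open>\<sigma>\<close> and
    \<open>K\<close> be the kernel of \<open>d\<close>. The image of \<open>d\<close> is
    \<open>Y / K\<close>, a subobject \<open>\<mu>\<close> of \<open>X / K\<close> lying in
    \<open>L\<close>. The preimage \<open>m\<close> in \<open>X\<close> of its complement in
    \<open>X / K\<close> meets \<open>Y\<close> inside \<open>K\<close>. Thus \<open>d\<close>,
    which is defined on \<open>Y\<close> only, is made to vanish by shrinking in
    \<open>X\<close>.\<close>
  obtain \<kappa> where k: "is_kernel C \<kappa> e" "\<kappa> \<in> Arr C" "Cod C \<kappa> = Dom C e"
    by (rule kernelE[of e]) (use e in auto)
  obtain c where c: "is_cokernel C c (\<sigma> \<cdot> \<kappa>)" "c \<in> Arr C" "Dom C c = Cod C (\<sigma> \<cdot> \<kappa>)"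
    by (rule cokernelE[of "\<sigma> \<cdot> \<kappa>"]) (use k e sA in auto)
  have dc: "Dom C c = Cod C \<sigma>" using c k e sA by simp
  obtain \<mu> where \<mu>: "is_mono C \<mu>" "Dom C \<mu> = Cod C e" "Cod C \<mu> = Cod C c" "\<mu> \<cdot> e = c \<cdot> \<sigma>"
    by (rule cokernel_restrict_mono[OF \<sigma> e(1,3) k(1) c(1)])
  have "Dom C \<mu> \<in> L" using \<mu> e QL by simp
  then obtain m0 where m0: "is_mono C m0" "m0 \<in> L_isos C L" "Cod C m0 = Cod C \<mu>"
    "\<And>v w. \<lbrakk>v \<in> Arr C; w \<in> Arr C; Cod C v = Dom C \<mu>; Cod C w = Dom C m0; \<mu> \<cdot> v = m0 \<cdot> w\<rbrakk> \<Longrightarrow> zarr w"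
    using stable_complementE[OF L \<mu>(1)] by metis
  have m0A: "m0 \<in> Arr C" using m0 by simp
  obtain m m' where m: "pullback c m0 m m'" "m \<in> L_isos C L"
    by (rule S.ex_pullback_iso[OF c(2) m0(2)]) (use m0 \<mu> in auto)
  note D = pullbackD[OF m(1)]
  show thesis
  proof (rule that[of m])
    show "is_mono C m" by (rule pullback_mono_left[OF m(1) m0(1) c(2)])
    show "Cod C m = Cod C \<sigma>" using D dc by simp
    show "\<forall>u v. u \<in> Arr C \<and> v \<in> Arr C \<and> Cod C u = Dom C m \<and> Cod C v = Dom C \<sigma> \<and> m \<cdot> u = \<sigma> \<cdot> v \<longrightarrow> zarr (d \<cdot> v)"
    proof (intro allI impI)
      fix u v assume uv: "u \<in> Arr C \<and> v \<in> Arr C \<and> Cod C u = Dom C m \<and> Cod C v = Dom C \<sigma> \<and> m \<cdot> u = \<sigma> \<cdot> v"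
      have eA: "e \<in> Arr C" "\<mu> \<in> Arr C" "i \<in> Arr C" using e \<mu> by simp_all
      have "\<mu> \<cdot> (e \<cdot> v) = c \<cdot> (\<sigma> \<cdot> v)" by (rule comp_reassoc[OF \<mu>(4)]) (use uv eA e \<mu> c(2) dc sA in simp_all)
      also have "\<dots> = c \<cdot> (m \<cdot> u)" using uv by simp
      also have "\<dots> = m0 \<cdot> (m' \<cdot> u)" by (rule comp_reassoc[OF D(6)]) (use uv D(1-5) c(2) m0A in simp_all)
      finally have eq: "\<mu> \<cdot> (e \<cdot> v) = m0 \<cdot> (m' \<cdot> u)" .
      have "zarr (m' \<cdot> u)" by (rule m0(4)[OF _ _ _ _ eq]) (use uv D(1-5) eA e \<mu> in simp_all)
      then have "zarr (m0 \<cdot> (m' \<cdot> u))" by (rule zarr_comp_left) (use uv D(1-5) m0A in simp_all)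
      then have "zarr (\<mu> \<cdot> (e \<cdot> v))" using eq by simp
      then have "zarr (e \<cdot> v)" by (rule mono_zeroD[OF \<mu>(1)]) (use uv eA e \<mu> in simp_all)
      then have "zarr (i \<cdot> (e \<cdot> v))" by (rule zarr_comp_left) (use uv eA e in simp_all)
      then show "zarr (d \<cdot> v)" using comp_rw[OF e(6), of v] uv eA e by simp
    qed
  qed (rule m(2))
qed

text \<open>The kernel of \<open>s\<close> lies in \<open>L\<close>, so it has a complement
  \<open>m\<close> in \<open>Dom C s\<close> that is inverted modulo \<open>L\<close>; on it
  \<open>s\<close> is injective.\<close>

lemma stable_frac_mono:
  assumes L: "L \<in> stable_localizing U C" and r: "serre_quotient.roof C L s f"
  obtains u where "u \<in> Arr C" "Cod C u = Dom C s" "s \<cdot> u \<in> L_isos C L" "is_mono C (s \<cdot> u)"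
proof -
  interpret S: serre_quotient C L by (rule stable_serre[OF L])
  note sD = S.roofD[OF r]
  obtain k where k: "is_kernel C k s" "k \<in> Arr C" "Cod C k = Dom C s" "zarr (s \<cdot> k)" "is_mono C k"
    using kernelE[OF sD(2)] by metis
  have "S.null k" using S.L_isosD(2)[OF sD(1) k(2,3) S.null_zarr[OF k(4)]] .
  then have "Dom C k \<in> L" by (rule S.null_mono[OF k(5)])
  then obtain m where m: "is_mono C m" "m \<in> L_isos C L" "Cod C m = Cod C k"
    "\<And>v w. \<lbrakk>v \<in> Arr C; w \<in> Arr C; Cod C v = Dom C k; Cod C w = Dom C m; k \<cdot> v = m \<cdot> w\<rbrakk> \<Longrightarrow> zarr w"
    using stable_complementE[OF L k(5)] by metis
  have mA: "m \<in> Arr C" "Cod C m = Dom C s" using m k by simp_all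
  show thesis
  proof (rule that[OF mA])
    show "s \<cdot> m \<in> L_isos C L" by (rule S.L_isos_comp[OF m(2) sD(1) mA(2)])
    show "is_mono C (s \<cdot> m)"
    proof (rule mono_zeroI)
      fix w assume w: "w \<in> Arr C" "Cod C w = Dom C (s \<cdot> m)" "zarr ((s \<cdot> m) \<cdot> w)"
      have cw: "Cod C w = Dom C m" using w mA sD by simp
      have "zarr (s \<cdot> (m \<cdot> w))" using w cw mA sD by simp
      moreover have "m \<cdot> w \<in> Arr C" "Cod C (m \<cdot> w) = Dom C s" using w(1) cw mA by simp_all
      ultimately obtain h where h: "h \<in> Arr C" "Cod C h = Dom C k" "k \<cdot> h = m \<cdot> w"
        using kernel_factor[OF k(1)] by metis
      show "zarr w" by (rule m(4)[OF h(1) w(1) h(2) cw h(3)])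
    qed (use mA sD in simp)
  qed
qed

text \<open>
  Two roofs with monic denominators that agree modulo \<open>L1 \<or> L2\<close> are made to agree on the
  intersection of their domains: their difference has an image \<open>Q\<close> with \<open>T \<le> Q\<close>, \<open>T \<in> L1\<close>,
  \<open>Q / T \<in> L2\<close>; shrinking the first domain avoids \<open>T\<close>, then shrinking the second avoids the rest.
\<close>

lemma stable_agree:
  assumes L1: "L1 \<in> stable_localizing U C" and L2: "L2 \<in> stable_localizing U C"
    and s1: "is_mono C s1" "s1 \<in> L_isos C L1" "f1 \<in> Arr C" "Dom C f1 = Dom C s1"
    and s2: "is_mono C s2" "s2 \<in> L_isos C L2" "f2 \<in> Arr C" "Dom C f2 = Dom C s2"
    and c: "Cod C s1 = Cod C s2" "Cod C f1 = Cod C f2"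
    and eq: "roof_eq C (localizing_join U C L1 L2) (s1, f1) (s2, f2)"
  obtains n1 n2 where "n1 \<in> Arr C" "Cod C n1 = Dom C s1" "s1 \<cdot> n1 \<in> L_isos C L1"
    "n2 \<in> Arr C" "Cod C n2 = Dom C s2" "s2 \<cdot> n2 \<in> L_isos C L2"
    "\<forall>u v. u \<in> Arr C \<and> v \<in> Arr C \<and> Dom C u = Dom C v \<and> Cod C u = Dom C n1 \<and> Cod C v = Dom C n2 \<and>
       (s1 \<cdot> n1) \<cdot> u = (s2 \<cdot> n2) \<cdot> v \<longrightarrow> (f1 \<cdot> n1) \<cdot> u = (f2 \<cdot> n2) \<cdot> v"
proof -
  note l1 = stable_localizingD[OF L1] and l2 = stable_localizingD[OF L2]
  let ?J = "localizing_join U C L1 L2"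
  note J = localizing_join[OF l1 l2]
  interpret S1: serre_quotient C L1 by (rule localizing_serre[OF l1])
  interpret S2: serre_quotient C L2 by (rule localizing_serre[OF l2])
  interpret SJ: serre_quotient C ?J by (rule localizing_serre[OF J(1)])
  interpret P1: serre_quotient_pair C L1 ?J
    by (rule serre_quotient_pairI[OF S1.serre_quotient_axioms SJ.serre_quotient_axioms J(2)])
  interpret P2: serre_quotient_pair C L2 ?J
    by (rule serre_quotient_pairI[OF S2.serre_quotient_axioms SJ.serre_quotient_axioms J(3)])
  have sA: "s1 \<in> Arr C" "s2 \<in> Arr C" using s1 s2 by simp_all
  obtain u0 v0 where u0: "u0 \<in> Arr C" "v0 \<in> Arr C" "Dom C u0 = Dom C v0" "Cod C u0 = Dom C s1"
     "Cod C v0 = Dom C s2" "s1 \<cdot> u0 = s2 \<cdot> v0" "s1 \<cdot> u0 \<in> L_isos C ?J" "f1 \<cdot> u0 = f2 \<cdot> v0"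
    using eq unfolding SJ.roof_eq_iff by blast
  obtain a b where ab: "pullback s1 s2 a b" "a \<in> L_isos C L2"
    by (rule S2.ex_pullback_iso[OF sA(1) s2(2) c(1)])
  note A = pullbackD[OF ab(1)]
  have am: "is_mono C a" by (rule pullback_mono_left[OF ab(1) s2(1) sA(1)])
  \<comment> \<open>\<open>\<sigma>\<close> is the inclusion in \<open>X\<close> of the intersection
    of the two domains, and \<open>d\<close> is the difference of the numerators there.\<close>
  define \<sigma> where "\<sigma> = s1 \<cdot> a"
  have \<sigma>: "is_mono C \<sigma>" "\<sigma> \<in> Arr C" "Dom C \<sigma> = Dom C b" "Cod C \<sigma> = Cod C s2"
    using mono_comp[OF am s1(1) A(4)] A sA c by (simp_all add: \<sigma>_def)
  have \<sigma>J: "\<sigma> \<in> L_isos C ?J" unfolding \<sigma>_def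
    by (rule SJ.L_isos_comp) (use ab(2) s1(2) P1.L_isos_mono P2.L_isos_mono A in auto)
  define d where "d = diff (f1 \<cdot> a) (f2 \<cdot> b)"
  have d: "d \<in> Arr C" "Dom C d = Dom C b" "Cod C d = Cod C f2" using A s1 s2 c sA by (simp_all add: d_def)
  have dcomp: "d \<cdot> x = diff (f1 \<cdot> a \<cdot> x) (f2 \<cdot> b \<cdot> x)" if "x \<in> Arr C" "Cod C x = Dom C b" for x
    using that A s1 s2 c sA by (simp add: d_def diff_comp)
  \<comment> \<open>The refinement behind \<open>eq\<close> passes through the intersection by
    \<open>h0\<close>, along which \<open>d\<close> vanishes. Cancelling \<open>\<sigma>\<close>
    shows that \<open>h0\<close> is inverted modulo the join, so \<open>d\<close> is null modulo the
    join.\<close>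
  obtain h0 where h0: "h0 \<in> Arr C" "Dom C h0 = Dom C v0" "Cod C h0 = Dom C b" "a \<cdot> h0 = u0" "b \<cdot> h0 = v0"
    by (rule pullback_factor[OF ab(1) u0(6,1,2,3,4,5)])
  have dh: "zarr (d \<cdot> h0)"
    using dcomp[OF h0(1,3)] h0(4,5) u0(1-5,8) s1 s2 c sA by (simp add: zarr_diff_iff)
  have "\<sigma> \<cdot> h0 = s1 \<cdot> u0" using h0 A(1-5) sA by (simp add: \<sigma>_def)
  then have "h0 \<in> L_isos C ?J" using SJ.L_isos_cancel_left[OF \<sigma>J _ h0(1)] u0(7) h0(3) \<sigma>(3) by simp
  then have dnull: "SJ.null d" by (rule SJ.L_isosD(3)[OF _ d(1) _ SJ.null_zarr[OF dh]]) (use h0 d in simp)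
  obtain e i where e: "is_epi C e" "is_mono C i" "Dom C e = Dom C b" "Cod C i = Cod C d" "Cod C e = Dom C i" "i \<cdot> e = d"
    using image_factorization[OF d(1)] d(2) by metis
  have eA: "e \<in> Arr C" "i \<in> Arr C" using e by simp_all
  have "Dom C i \<in> ?J" using SJ.null_image[OF e(1,2,5)] e(6) dnull by simp
  then have "Dom C i \<in> ext_class L1 L2" using join_subset_ext_class[OF l1 L2] by blast
  then obtain t where t: "is_mono C t" "Cod C t = Dom C i" "Dom C t \<in> L1" "t \<in> L_isos C L2"
    unfolding ext_class_def by blast
  have tA: "t \<in> Arr C" using t by simp
  \<comment> \<open>\<open>j\<close> is the part of the intersection that \<open>d\<close> sends
    into \<open>T = Dom C t\<close>. There \<open>d\<close> is null modulo \<open>L1\<close>, and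
    the cokernel of \<open>j\<close> lies in \<open>L2\<close>.\<close>
  obtain j j' where j: "pullback e t j j'" "j \<in> L_isos C L2"
    by (rule S2.ex_pullback_iso[OF eA(1) t(4)]) (use e t in auto)
  note B = pullbackD[OF j(1)]
  have jm: "is_mono C j" by (rule pullback_mono_left[OF j(1) t(1) eA(1)])
  have dj: "d \<cdot> j = i \<cdot> t \<cdot> j'" 
  proof -
    have "d \<cdot> j = i \<cdot> (e \<cdot> j)" using comp_rw[OF e(6), of j] eA e B by simp
    then show ?thesis using B(6) by simp
  qed
  have ndj: "S1.null (d \<cdot> j)"
  proof -
    have "S1.null ((i \<cdot> t) \<cdot> j')" by (rule S1.nullI) (use B(1-5) eA e t tA in simp_all)
    then show ?thesis using dj B(1-5) eA e t tA by simp
  qed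
  have \<sigma>j: "is_mono C (\<sigma> \<cdot> j)" "Dom C (\<sigma> \<cdot> j) = Dom C j" "Cod C (\<sigma> \<cdot> j) = Cod C s2"
    using mono_comp[OF jm \<sigma>(1)] B e \<sigma> by simp_all
  have ddj: "Dom C (d \<cdot> j) = Dom C (\<sigma> \<cdot> j)" using \<sigma>j B e d by simp
  obtain m1 where m1: "is_mono C m1" "m1 \<in> L_isos C L1" "Cod C m1 = Cod C (\<sigma> \<cdot> j)"
    "\<forall>u v. u \<in> Arr C \<and> v \<in> Arr C \<and> Cod C u = Dom C m1 \<and> Cod C v = Dom C (\<sigma> \<cdot> j) \<and> m1 \<cdot> u = (\<sigma> \<cdot> j) \<cdot> v
       \<longrightarrow> zarr ((d \<cdot> j) \<cdot> v)"
    by (rule stable_null_separate[OF L1 \<sigma>j(1) ndj ddj])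
  have m1A: "m1 \<in> Arr C" using m1 by simp
  \<comment> \<open>The new first domain is the intersection of the old one with the subobject
    \<open>m1\<close>; since \<open>m1\<close> has cokernel in \<open>L1\<close>, the denominator
    remains inverted modulo \<open>L1\<close>.\<close>
  obtain n1 n1' where n1: "pullback s1 m1 n1 n1'" "n1 \<in> L_isos C L1"
    by (rule S1.ex_pullback_iso[OF sA(1) m1(2)]) (use m1 \<sigma>j c in auto)
  note N1 = pullbackD[OF n1(1)]
  have n1m: "is_mono C n1" by (rule pullback_mono_left[OF n1(1) m1(1) sA(1)])
  have sn1: "is_mono C (s1 \<cdot> n1)" "s1 \<cdot> n1 \<in> L_isos C L1" "s1 \<cdot> n1 \<in> Arr C" "Cod C (s1 \<cdot> n1) = Cod C s2"
      "Dom C (s1 \<cdot> n1) = Dom C n1'"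
    using mono_comp[OF n1m s1(1) N1(4)] S1.L_isos_comp[OF n1(2) s1(2) N1(4)] N1(1-5) sA c by simp_all
  obtain a' b' where ab': "pullback (s1 \<cdot> n1) s2 a' b'"
    by (rule ex_pullback[OF sn1(3) sA(2) sn1(4)])
  note A' = pullbackD[OF ab']
  have A'4: "Cod C a' = Dom C n1" using A' sn1 N1 by simp
  have na': "n1 \<cdot> a' \<in> Arr C" "Dom C (n1 \<cdot> a') = Dom C b'" "Cod C (n1 \<cdot> a') = Dom C s1" using A' A'4 N1 by simp_all
  have "s1 \<cdot> (n1 \<cdot> a') = s2 \<cdot> b'" using A'(1-3,5,6) A'4 N1(1-5) sA by simp
  then obtain \<iota> where \<iota>: "\<iota> \<in> Arr C" "Dom C \<iota> = Dom C b'" "Cod C \<iota> = Dom C b" "a \<cdot> \<iota> = n1 \<cdot> a'" "b \<cdot> \<iota> = b'"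
    by (rule pullback_factor[OF ab(1)]) (use na' A' in auto)
  define \<sigma>' where "\<sigma>' = s2 \<cdot> b'"
  have b'm: "is_mono C b'" by (rule pullback_mono_right[OF ab' sn1(1) sA(2)])
  have \<sigma>': "is_mono C \<sigma>'" "Dom C \<sigma>' = Dom C b'" "Cod C \<sigma>' = Cod C s2"
    using mono_comp[OF b'm s2(1)] A' sA by (simp_all add: \<sigma>'_def)
  have \<sigma>\<iota>: "\<sigma> \<cdot> \<iota> = s1 \<cdot> n1 \<cdot> a'" using \<iota> A(1-5) sA by (simp add: \<sigma>_def)
  have d\<iota>: "d \<cdot> \<iota> \<in> Arr C" "Dom C (d \<cdot> \<iota>) = Dom C b'" using d \<iota> by simp_all
  \<comment> \<open>On the new intersection \<open>d\<close> vanishes along the pullback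
    \<open>y\<close> of \<open>j\<close>, by the choice of \<open>m1\<close>. As \<open>y\<close> is
    inverted modulo \<open>L2\<close>, the rest of \<open>d\<close> is null modulo \<open>L2\<close>
    and can be removed on the second side.\<close>
  have nd: "S2.null (d \<cdot> \<iota>)"
  proof -
    have "Cod C \<iota> = Cod C j" using \<iota> B e by simp
    then obtain y y' where y: "pullback \<iota> j y y'" "y \<in> L_isos C L2"
      by (rule S2.ex_pullback_iso[OF \<iota>(1) j(2)])
    note Y = pullbackD[OF y(1)]
    have Y4: "Cod C y = Dom C b'" using Y \<iota> by simp
    have dc: "Cod C j = Dom C b" using B e by simp
    have "m1 \<cdot> (n1' \<cdot> (a' \<cdot> y)) = s1 \<cdot> (n1 \<cdot> (a' \<cdot> y))"
      by (rule comp_reassoc[OF N1(6)[symmetric]]) (use N1(1-5) A'(1-3) A'4 Y(1) Y4 sA m1A in simp_all)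
    also have "\<dots> = (s1 \<cdot> n1 \<cdot> a') \<cdot> y" using N1(1-5) A'(1-3) A'4 Y(1) Y4 sA by simp
    also have "\<dots> = \<sigma> \<cdot> (\<iota> \<cdot> y)" using \<sigma>\<iota>[symmetric] \<iota>(1-3) Y(1) Y4 \<sigma> by simp
    also have "\<dots> = (\<sigma> \<cdot> j) \<cdot> y'" using Y(6) Y(1-5) dc \<sigma> B(1) by simp
    finally have "zarr ((d \<cdot> j) \<cdot> y')"
      by (intro m1(4)[rule_format, of "n1' \<cdot> (a' \<cdot> y)"] conjI) (use N1(1-5) A'(1-3) A'4 Y(1-5) Y4 \<sigma>j in simp_all)
    then have "zarr (d \<cdot> (\<iota> \<cdot> y))" using Y(6) Y(1-5) d dc B(1) by simp
    then have "zarr ((d \<cdot> \<iota>) \<cdot> y)" using Y(1) Y4 \<iota>(1-3) d by simp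
    then show ?thesis by (intro S2.L_isosD(3)[OF y(2) d\<iota>(1) _ S2.null_zarr]) (use Y4 d\<iota> in simp_all)
  qed
  obtain m2 where m2: "is_mono C m2" "m2 \<in> L_isos C L2" "Cod C m2 = Cod C \<sigma>'"
    "\<forall>u v. u \<in> Arr C \<and> v \<in> Arr C \<and> Cod C u = Dom C m2 \<and> Cod C v = Dom C \<sigma>' \<and> m2 \<cdot> u = \<sigma>' \<cdot> v
       \<longrightarrow> zarr ((d \<cdot> \<iota>) \<cdot> v)"
    by (rule stable_null_separate[OF L2 \<sigma>'(1) nd]) (use \<sigma>' d\<iota> in auto)
  have m2A: "m2 \<in> Arr C" using m2 by simp
  obtain n2 n2' where n2: "pullback s2 m2 n2 n2'" "n2 \<in> L_isos C L2"
    by (rule S2.ex_pullback_iso[OF sA(2) m2(2)]) (use m2 \<sigma>' in auto)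
  note N2 = pullbackD[OF n2(1)]
  show thesis
  proof (rule that[OF N1(1,4) sn1(2) N2(1,4)])
    show "s2 \<cdot> n2 \<in> L_isos C L2" by (rule S2.L_isos_comp[OF n2(2) s2(2) N2(4)])
    show "\<forall>u v. u \<in> Arr C \<and> v \<in> Arr C \<and> Dom C u = Dom C v \<and> Cod C u = Dom C n1 \<and> Cod C v = Dom C n2 \<and>
       (s1 \<cdot> n1) \<cdot> u = (s2 \<cdot> n2) \<cdot> v \<longrightarrow> (f1 \<cdot> n1) \<cdot> u = (f2 \<cdot> n2) \<cdot> v"
    proof (intro allI impI)
      fix u v assume "u \<in> Arr C \<and> v \<in> Arr C \<and> Dom C u = Dom C v \<and> Cod C u = Dom C n1 \<and> Cod C v = Dom C n2 \<and>
         (s1 \<cdot> n1) \<cdot> u = (s2 \<cdot> n2) \<cdot> v"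
      then have uv: "u \<in> Arr C" "v \<in> Arr C" "Dom C u = Dom C v" "Cod C u = Dom C n1" "Cod C v = Dom C n2"
         "(s1 \<cdot> n1) \<cdot> u = (s2 \<cdot> n2) \<cdot> v" by auto
      have "(s1 \<cdot> n1) \<cdot> u = s2 \<cdot> (n2 \<cdot> v)" using uv N2(1-5) sA by simp
      then obtain h where h: "h \<in> Arr C" "Dom C h = Dom C v" "Cod C h = Dom C b'" "a' \<cdot> h = u" "b' \<cdot> h = n2 \<cdot> v"
        by (rule pullback_factor[OF ab']) (use uv N1(1-5) N2(1-5) sA in auto)
      have "m2 \<cdot> (n2' \<cdot> v) = s2 \<cdot> (n2 \<cdot> v)"
        by (rule comp_reassoc[OF N2(6)[symmetric]]) (use uv N2(1-5) sA m2A in simp_all)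
      also have "\<dots> = \<sigma>' \<cdot> h" using h(1,3) h(5) A' sA by (simp add: \<sigma>'_def)
      finally have z: "zarr ((d \<cdot> \<iota>) \<cdot> h)"
        by (intro m2(4)[rule_format, of "n2' \<cdot> v"] conjI) (use uv N2(1-5) h \<sigma>' in simp_all)
      have 1: "a \<cdot> \<iota> \<cdot> h = n1 \<cdot> u" using comp_reassoc[OF \<iota>(4), of h] \<iota>(1-3) h A A' A'4 N1 by simp
      have 2: "b \<cdot> \<iota> \<cdot> h = n2 \<cdot> v" using comp_rw[OF \<iota>(5), of h] \<iota>(1-3) h A by simp
      have "d \<cdot> (\<iota> \<cdot> h) = diff (f1 \<cdot> n1 \<cdot> u) (f2 \<cdot> n2 \<cdot> v)"
        using dcomp[of "\<iota> \<cdot> h"] 1 2 \<iota>(1-3) h(1,3) by simp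
      then have "zarr (diff (f1 \<cdot> n1 \<cdot> u) (f2 \<cdot> n2 \<cdot> v))" using z d \<iota>(1-3) h(1,3) by simp
      then have "f1 \<cdot> n1 \<cdot> u = f2 \<cdot> n2 \<cdot> v"
        using uv N1(1-5) N2(1-5) s1(3,4) s2(3,4) c sA by (simp add: zarr_diff_iff)
      then show "(f1 \<cdot> n1) \<cdot> u = (f2 \<cdot> n2) \<cdot> v"
        using uv N1(1-5) N2(1-5) s1(3,4) s2(3,4) by simp
    qed
  qed
qed

text \<open>\<open>s\<close> is the inclusion of the image of \<open>r\<close>, the arrow on the
  biproduct with components \<open>s1\<close> and \<open>s2\<close>. The kernel of \<open>r\<close>
  consists, up to a sign, of the pairs over which \<open>eq\<close> says that \<open>f1\<close> and
  \<open>f2\<close> agree, so the arrow \<open>\<phi>\<close> with components \<open>f1\<close> and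
  \<open>f2\<close> descends to that image.\<close>

lemma glue_roofs:
  assumes L1: "L1 \<in> stable_localizing U C" and L2: "L2 \<in> stable_localizing U C"
    and s1: "s1 \<in> L_isos C L1" "f1 \<in> Arr C" "Dom C f1 = Dom C s1"
    and s2: "s2 \<in> L_isos C L2" "f2 \<in> Arr C" "Dom C f2 = Dom C s2"
    and c: "Cod C s1 = Cod C s2" "Cod C f1 = Cod C f2"
    and eq: "\<And>u v. \<lbrakk>u \<in> Arr C; v \<in> Arr C; Dom C u = Dom C v; Cod C u = Dom C s1; Cod C v = Dom C s2;
       s1 \<cdot> u = s2 \<cdot> v\<rbrakk> \<Longrightarrow> f1 \<cdot> u = f2 \<cdot> v"
  obtains s f t1 t2 where "s \<in> L_isos C (L1 \<inter> L2)" "f \<in> Arr C" "Dom C f = Dom C s" "Cod C s = Cod C s2" "Cod C f = Cod C f2"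
    "t1 \<in> Arr C" "Cod C t1 = Dom C s" "s \<cdot> t1 = s1" "f \<cdot> t1 = f1"
    "t2 \<in> Arr C" "Cod C t2 = Dom C s" "s \<cdot> t2 = s2" "f \<cdot> t2 = f2"
proof -
  interpret S1: serre_quotient C L1 by (rule stable_serre[OF L1])
  interpret S2: serre_quotient C L2 by (rule stable_serre[OF L2])
  interpret S0: serre_quotient C "L1 \<inter> L2" by (rule stable_serre[OF stable_localizing_Int[OF L1 L2]])
  have sA: "s1 \<in> Arr C" "s2 \<in> Arr C" using s1 s2 by simp_all
  obtain S i j p q where S: "S \<in> Obj C" "i \<in> Arr C" "Dom C i = Dom C s1" "Cod C i = S"
    "j \<in> Arr C" "Dom C j = Dom C s2" "Cod C j = S" "p \<in> Arr C" "Dom C p = S" "Cod C p = Dom C s1"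
    "q \<in> Arr C" "Dom C q = S" "Cod C q = Dom C s2" "p \<cdot> i = Ident C (Dom C s1)" "q \<cdot> j = Ident C (Dom C s2)"
    "p \<cdot> j = Zero C (Dom C s2) (Dom C s1)" "q \<cdot> i = Zero C (Dom C s1) (Dom C s2)"
    "Plus C (i \<cdot> p) (j \<cdot> q) = Ident C S"
    by (rule biproductE[of "Dom C s1" "Dom C s2"]) (use sA in auto)
  define r where "r = Plus C (s1 \<cdot> p) (s2 \<cdot> q)"
  define \<phi> where "\<phi> = Plus C (f1 \<cdot> p) (f2 \<cdot> q)"
  have r: "r \<in> Arr C" "Dom C r = S" "Cod C r = Cod C s2" using S sA c by (simp_all add: r_def)
  have \<phi>: "\<phi> \<in> Arr C" "Dom C \<phi> = S" "Cod C \<phi> = Cod C f2" using S s1 s2 sA c by (simp_all add: \<phi>_def)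
  have ri: "r \<cdot> i = s1" "r \<cdot> j = s2" "\<phi> \<cdot> i = f1" "\<phi> \<cdot> j = f2"
    using S(1-17) sA s1(2,3) s2(2,3) c by (simp_all add: r_def \<phi>_def)
  obtain e s where e: "is_epi C e" "is_mono C s" "Dom C e = S" "Cod C s = Cod C s2" "Cod C e = Dom C s" "s \<cdot> e = r"
    using image_factorization[OF r(1)] r(2,3) by metis
  have eA: "e \<in> Arr C" "s \<in> Arr C" using e by simp_all
  have dphi: "Dom C \<phi> = Dom C e" using \<phi> e by simp
  obtain f where f: "f \<in> Arr C" "Cod C f = Cod C \<phi>" "Dom C f = Cod C e" "f \<cdot> e = \<phi>"
  proof (rule epi_factor[OF e(1) \<phi>(1) dphi])
    fix w assume w: "w \<in> Arr C" "Cod C w = Dom C e" "zarr (e \<cdot> w)"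
    have cw: "Cod C w = S" using w e by simp
    have "zarr (s \<cdot> (e \<cdot> w))" by (rule zarr_comp_left[OF w(3)]) (use w(1) cw eA e in simp_all)
    then have z: "zarr (r \<cdot> w)" using comp_rw[OF e(6), of w] w(1) cw eA e by simp
    \<comment> \<open>The components of an arrow killed by \<open>r\<close> satisfy
      \<open>s1 \<cdot> x = - (s2 \<cdot> y)\<close>; the negation is moved into the second one so
      that \<open>eq\<close> applies.\<close>
    have rw: "r \<cdot> w = diff (s1 \<cdot> (p \<cdot> w)) (s2 \<cdot> neg (q \<cdot> w))" using S(1-17) sA c w(1) cw by (simp add: r_def diff_def)
    have "s1 \<cdot> (p \<cdot> w) = s2 \<cdot> neg (q \<cdot> w)"
      using z[unfolded rw] S(1-17) sA c w(1) cw by (simp add: zarr_diff_iff del: comp_neg)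
    then have "f1 \<cdot> (p \<cdot> w) = f2 \<cdot> neg (q \<cdot> w)"
      by (rule eq[rotated -1]) (use S(1-17) sA w(1) cw in simp_all)
    moreover have "\<phi> \<cdot> w = diff (f1 \<cdot> (p \<cdot> w)) (f2 \<cdot> neg (q \<cdot> w))"
      using S(1-17) s1(2,3) s2(2,3) c w(1) cw by (simp add: \<phi>_def diff_def)
    ultimately show "zarr (\<phi> \<cdot> w)" using S(1-17) s1(2,3) s2(2,3) c w(1) cw by (simp add: zarr_diff_iff del: comp_neg)
  qed
  have st: "s \<cdot> (e \<cdot> i) = s1" "s \<cdot> (e \<cdot> j) = s2"
    using comp_rw[OF e(6), of i] comp_rw[OF e(6), of j] ri eA e S by simp_all
  have ft: "f \<cdot> (e \<cdot> i) = f1" "f \<cdot> (e \<cdot> j) = f2"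
    using comp_rw[OF f(4), of i] comp_rw[OF f(4), of j] ri eA e S f(1,3) by simp_all
  have tA: "e \<cdot> i \<in> Arr C" "Cod C (e \<cdot> i) = Dom C s" "e \<cdot> j \<in> Arr C" "Cod C (e \<cdot> j) = Dom C s" using eA e S by simp_all
  \<comment> \<open>An arrow killing \<open>s\<close> kills \<open>s1\<close> and \<open>s2\<close>,
    so its one image in \<open>C\<close> lies in \<open>L1\<close> as well as in
    \<open>L2\<close>.\<close>
  have iso: "s \<in> L_isos C (L1 \<inter> L2)"
  proof (rule S0.mono_isoI[OF e(2)])
    fix w assume w: "w \<in> Arr C" "Dom C w = Cod C s" "zarr (w \<cdot> s)"
    have "zarr ((w \<cdot> s) \<cdot> (e \<cdot> i))" "zarr ((w \<cdot> s) \<cdot> (e \<cdot> j))"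
      by (rule zarr_comp_right[OF w(3)]; use w(1,2) eA tA in simp)+
    moreover have "(w \<cdot> s) \<cdot> (e \<cdot> i) = w \<cdot> s1" "(w \<cdot> s) \<cdot> (e \<cdot> j) = w \<cdot> s2"
      unfolding st[symmetric] using w(1,2) eA tA by simp_all
    ultimately have z: "zarr (w \<cdot> s1)" "zarr (w \<cdot> s2)" by simp_all
    have n: "S1.null w" "S2.null w"
      using S1.L_isosD(3)[OF s1(1) w(1) _ S1.null_zarr[OF z(1)]] S2.L_isosD(3)[OF s2(1) w(1) _ S2.null_zarr[OF z(2)]]
        w(2) e(4) c by simp_all
    obtain x y where xy: "is_epi C x" "is_mono C y" "Cod C x = Dom C y" "y \<cdot> x = w"
      using image_factorization[OF w(1)] by metis
    have "Dom C y \<in> L1 \<inter> L2" using S1.null_image[OF xy(1-3)] S2.null_image[OF xy(1-3)] n xy(4) by simp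
    then show "S0.null w" using S0.null_iff_image[OF xy(1-3)] xy(4) by simp
  qed
  show thesis
    by (rule that[OF iso f(1), of "e \<cdot> i" "e \<cdot> j"]) (use f \<phi> e st ft tA in simp_all)
qed

lemma glue_pair:
  assumes L1: "L1 \<in> stable_localizing U C" and L2: "L2 \<in> stable_localizing U C"
    and h1: "h1 \<in> homset (quotient_category C L1) X Y" and h2: "h2 \<in> homset (quotient_category C L2) X Y"
    and eq: "quotient_functor C L1 (localizing_join U C L1 L2) h1 = quotient_functor C L2 (localizing_join U C L1 L2) h2"
  obtains h where "h \<in> homset (quotient_category C (L1 \<inter> L2)) X Y"
    "quotient_functor C (L1 \<inter> L2) L1 h = h1" "quotient_functor C (L1 \<inter> L2) L2 h = h2"
proof -
  note l1 = stable_localizingD[OF L1] and l2 = stable_localizingD[OF L2]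
  let ?J = "localizing_join U C L1 L2"
  note J = localizing_join[OF l1 l2]
  interpret S1: serre_quotient C L1 by (rule localizing_serre[OF l1])
  interpret S2: serre_quotient C L2 by (rule localizing_serre[OF l2])
  interpret S0: serre_quotient C "L1 \<inter> L2" by (rule stable_serre[OF stable_localizing_Int[OF L1 L2]])
  interpret SJ: serre_quotient C ?J by (rule localizing_serre[OF J(1)])
  interpret P1: serre_quotient_pair C L1 ?J
    by (rule serre_quotient_pairI[OF S1.serre_quotient_axioms SJ.serre_quotient_axioms J(2)])
  interpret P2: serre_quotient_pair C L2 ?J
    by (rule serre_quotient_pairI[OF S2.serre_quotient_axioms SJ.serre_quotient_axioms J(3)])
  interpret R1: serre_quotient_pair C "L1 \<inter> L2" L1
    by (rule serre_quotient_pairI[OF S0.serre_quotient_axioms S1.serre_quotient_axioms]) simp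
  interpret R2: serre_quotient_pair C "L1 \<inter> L2" L2
    by (rule serre_quotient_pairI[OF S0.serre_quotient_axioms S2.serre_quotient_axioms]) simp
  obtain s1' f1' where a1: "S1.roof s1' f1'" "Cod C s1' = X" "Cod C f1' = Y" "h1 = S1.frac s1' f1'"
    using h1 S1.in_homset_frac by blast
  obtain s2' f2' where a2: "S2.roof s2' f2'" "Cod C s2' = X" "Cod C f2' = Y" "h2 = S2.frac s2' f2'"
    using h2 S2.in_homset_frac by blast
  note D1 = S1.roofD[OF a1(1)] and D2 = S2.roofD[OF a2(1)]
  obtain u1 where u1: "u1 \<in> Arr C" "Cod C u1 = Dom C s1'" "s1' \<cdot> u1 \<in> L_isos C L1" "is_mono C (s1' \<cdot> u1)"
    by (rule stable_frac_mono[OF L1 a1(1)])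
  obtain u2 where u2: "u2 \<in> Arr C" "Cod C u2 = Dom C s2'" "s2' \<cdot> u2 \<in> L_isos C L2" "is_mono C (s2' \<cdot> u2)"
    by (rule stable_frac_mono[OF L2 a2(1)])
  define s1 f1 s2 f2 where "s1 = s1' \<cdot> u1" and "f1 = f1' \<cdot> u1" and "s2 = s2' \<cdot> u2" and "f2 = f2' \<cdot> u2"
  have r1: "S1.frac s1 f1 = h1" "S1.roof s1 f1" "Cod C s1 = X" "Cod C f1 = Y" "is_mono C s1"
    using S1.frac_expand[OF a1(1) u1(1-3)] a1 D1 u1 by (simp_all add: s1_def f1_def)
  have r2: "S2.frac s2 f2 = h2" "S2.roof s2 f2" "Cod C s2 = X" "Cod C f2 = Y" "is_mono C s2"
    using S2.frac_expand[OF a2(1) u2(1-3)] a2 D2 u2 by (simp_all add: s2_def f2_def)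
  note E1 = S1.roofD[OF r1(2)] and E2 = S2.roofD[OF r2(2)]
  have "SJ.frac s1 f1 = SJ.frac s2 f2" using eq P1.F_frac[OF r1(2)] P2.F_frac[OF r2(2)] r1(1) r2(1) by simp
  then have req: "roof_eq C ?J (s1, f1) (s2, f2)"
    using SJ.frac_eq_iff[OF P1.roof_mono[OF r1(2)] P2.roof_mono[OF r2(2)]] by simp
  obtain n1 n2 where n: "n1 \<in> Arr C" "Cod C n1 = Dom C s1" "s1 \<cdot> n1 \<in> L_isos C L1"
    "n2 \<in> Arr C" "Cod C n2 = Dom C s2" "s2 \<cdot> n2 \<in> L_isos C L2"
    "\<forall>u v. u \<in> Arr C \<and> v \<in> Arr C \<and> Dom C u = Dom C v \<and> Cod C u = Dom C n1 \<and> Cod C v = Dom C n2 \<and>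
       (s1 \<cdot> n1) \<cdot> u = (s2 \<cdot> n2) \<cdot> v \<longrightarrow> (f1 \<cdot> n1) \<cdot> u = (f2 \<cdot> n2) \<cdot> v"
    by (rule stable_agree[OF L1 L2 r1(5) E1(1,3,4) r2(5) E2(1,3,4) _ _ req]) (use r1 r2 in auto)
  note x1 = S1.frac_expand[OF r1(2) n(1-3)] and x2 = S2.frac_expand[OF r2(2) n(4-6)]
  note G1 = S1.roofD[OF x1(2)] and G2 = S2.roofD[OF x2(2)]
  have dd: "Dom C (s1 \<cdot> n1) = Dom C n1" "Dom C (s2 \<cdot> n2) = Dom C n2" "Cod C (s1 \<cdot> n1) = X" "Cod C (s2 \<cdot> n2) = X"
    "Cod C (f1 \<cdot> n1) = Y" "Cod C (f2 \<cdot> n2) = Y"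
    using n E1 E2 r1 r2 by simp_all
  obtain s f t1 t2 where g: "s \<in> L_isos C (L1 \<inter> L2)" "f \<in> Arr C" "Dom C f = Dom C s"
    "Cod C s = Cod C (s2 \<cdot> n2)" "Cod C f = Cod C (f2 \<cdot> n2)"
    "t1 \<in> Arr C" "Cod C t1 = Dom C s" "s \<cdot> t1 = s1 \<cdot> n1" "f \<cdot> t1 = f1 \<cdot> n1"
    "t2 \<in> Arr C" "Cod C t2 = Dom C s" "s \<cdot> t2 = s2 \<cdot> n2" "f \<cdot> t2 = f2 \<cdot> n2"
    by (rule glue_roofs[OF L1 L2 n(3) G1(3,4) n(6) G2(3,4)]) (use dd n(7) in auto)
  have r0: "S0.roof s f" using g by (simp add: S0.roof_def)
  have 1: "S1.frac s f = h1"
    using S1.frac_expand(1)[OF R1.roof_mono[OF r0] g(6,7)] g(8,9) n(3) x1(1) r1(1) by simp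
  have 2: "S2.frac s f = h2"
    using S2.frac_expand(1)[OF R2.roof_mono[OF r0] g(10,11)] g(12,13) n(6) x2(1) r2(1) by simp
  show thesis
  proof (rule that[of "S0.frac s f"])
    show "S0.frac s f \<in> homset S0.Q X Y" unfolding S0.in_homset_frac using r0 g dd by auto
  qed (simp_all add: R1.F_frac[OF r0] R2.F_frac[OF r0] 1 2)
qed

lemma glue_family:
  fixes Ls :: "nat \<Rightarrow> 'o set"
  assumes XY: "X \<in> Obj C" "Y \<in> Obj C"
    and "\<And>i. i \<in> {1..n} \<Longrightarrow> Ls i \<in> stable_localizing U C"
    and "\<And>i. i \<in> {1..n} \<Longrightarrow> h i \<in> homset (quotient_category C (Ls i)) X Y"
    and "\<And>i j. i \<in> {1..n} \<Longrightarrow> j \<in> {1..n} \<Longrightarrow>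
      quotient_functor C (Ls i) (localizing_join U C (Ls i) (Ls j)) (h i) =
      quotient_functor C (Ls j) (localizing_join U C (Ls i) (Ls j)) (h j)"
  shows "\<exists>g \<in> homset (quotient_category C (Obj C \<inter> (\<Inter>i\<in>{1..n}. Ls i))) X Y.
    \<forall>i\<in>{1..n}. quotient_functor C (Obj C \<inter> (\<Inter>i\<in>{1..n}. Ls i)) (Ls i) g = h i"
  using assms(3-5)
proof (induction n)
  case 0
  have "localizing U C (Obj C)" using localizing_Inter[of "{}"] by simp
  then interpret S: serre_quotient C "Obj C" by (rule localizing_serre)
  interpret Q: preadditive_category S.Q by (rule S.Q_preadditive)
  \<comment> \<open>Without members of the covering every arrow satisfies the condition; the zero
    arrow provides one.\<close>
  have "Zero S.Q X Y \<in> homset S.Q X Y" using XY by (simp add: Q.in_hom)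
  then show ?case by (intro bexI[of _ "Zero S.Q X Y"]) simp_all
next
  case (Suc n)
  let ?L = "Obj C \<inter> (\<Inter>i\<in>{1..n}. Ls i)" and ?M = "Ls (Suc n)"
  have st: "\<And>i. i \<in> {1..n} \<Longrightarrow> Ls i \<in> stable_localizing U C" and M: "?M \<in> stable_localizing U C"
    using Suc.prems(1) by simp_all
  have "\<exists>g\<in>homset (quotient_category C ?L) X Y. \<forall>i\<in>{1..n}. quotient_functor C ?L (Ls i) g = h i"
  proof (rule Suc.IH)
    fix i j assume "i \<in> {1..n}" "j \<in> {1..n}"
    then show "quotient_functor C (Ls i) (localizing_join U C (Ls i) (Ls j)) (h i) =
      quotient_functor C (Ls j) (localizing_join U C (Ls i) (Ls j)) (h j)" by (intro Suc.prems(3)) simp_all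
  qed (use Suc.prems(1,2) in simp_all)
  then obtain g where g: "g \<in> homset (quotient_category C ?L) X Y" "\<And>i. i \<in> {1..n} \<Longrightarrow> quotient_functor C ?L (Ls i) g = h i"
    by blast
  have L: "?L \<in> stable_localizing U C" by (rule stable_localizing_Inter) (use st in auto)
  define J where "J i = localizing_join U C (Ls i) ?M" for i
  let ?K = "Obj C \<inter> (\<Inter>i\<in>{1..n}. J i)" and ?JL = "localizing_join U C ?L ?M"
  have J: "localizing U C (J i)" "Ls i \<subseteq> J i" "?M \<subseteq> J i" if "i \<in> {1..n}" for i
    using localizing_join[OF stable_localizingD[OF st[OF that]] stable_localizingD[OF M]] by (simp_all add: J_def)
  have K: "localizing U C ?K" by (rule localizing_Inter) (use J(1) in auto)
  note JL = localizing_join[OF stable_localizingD[OF L] stable_localizingD[OF M]]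
  have sJ: "serre_quotient C (J i)" if "i \<in> {1..n}" for i using localizing_serre[OF J(1)[OF that]] .
  note sL = stable_serre[OF L] and sM = stable_serre[OF M] and sK = localizing_serre[OF K]
    and sJL = localizing_serre[OF JL(1)]
  have LK: "?L \<subseteq> ?K" "?M \<subseteq> ?K" using J(2,3) serre_subcategory.L_obj[OF serre_quotient.axioms[OF sM]] by blast+
  have KJ: "?K \<subseteq> ?JL" unfolding J_def by (rule join_INT_distrib[OF st M])
  have hM: "h (Suc n) \<in> homset (quotient_category C ?M) X Y" using Suc.prems(2) by simp
  interpret PL: serre_quotient_pair C ?L ?K by (rule serre_quotient_pairI[OF sL sK LK(1)])
  interpret PM: serre_quotient_pair C ?M ?K by (rule serre_quotient_pairI[OF sM sK LK(2)])
  have ga: "g \<in> Arr (quotient_category C ?L)" "h (Suc n) \<in> Arr (quotient_category C ?M)"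
    using g(1) hM by (simp_all add: homset_def)
  \<comment> \<open>Compatibility equates the two arrows in each \<open>C / J i\<close> only.
    Faithfulness into these quotients gives equality modulo \<open>?K\<close>, and \<open>KJ\<close>
    then carries it to the join \<open>?JL\<close> required by \<open>glue_pair\<close>.\<close>
  have "PL.F g = PM.F (h (Suc n))"
  proof (rule quotient_functor_jointly_faithful[OF sK sJ refl])
    fix i assume i: "i \<in> {1..n}"
    have LI: "?L \<subseteq> Ls i" using i by auto
    have KI: "?K \<subseteq> J i" using i by auto
    have "quotient_functor C ?K (J i) (PL.F g) = quotient_functor C ?L (J i) g"
      by (rule quotient_functor_trans[OF sL sK sJ[OF i] LK(1) KI ga(1)])
    also have "\<dots> = quotient_functor C (Ls i) (J i) (quotient_functor C ?L (Ls i) g)"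
      by (rule quotient_functor_trans[OF sL stable_serre[OF st[OF i]] sJ[OF i] LI J(2)[OF i] ga(1), symmetric])
    also have "\<dots> = quotient_functor C ?M (J i) (h (Suc n))"
      using Suc.prems(3)[of i "Suc n"] i g(2)[OF i] by (simp add: J_def)
    also have "\<dots> = quotient_functor C ?K (J i) (PM.F (h (Suc n)))"
      by (rule quotient_functor_trans[OF sM sK sJ[OF i] LK(2) KI ga(2), symmetric])
    finally show "quotient_functor C ?K (J i) (PL.F g) = quotient_functor C ?K (J i) (PM.F (h (Suc n)))" .
  qed (use PL.F_hom[OF g(1)] PM.F_hom[OF hM] in \<open>simp_all add: homset_def\<close>)
  then have "quotient_functor C ?L ?JL g = quotient_functor C ?M ?JL (h (Suc n))"
    using quotient_functor_trans[OF sL sK sJL LK(1) KJ ga(1)] quotient_functor_trans[OF sM sK sJL LK(2) KJ ga(2)]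
    by simp
  then obtain k where k: "k \<in> homset (quotient_category C (?L \<inter> ?M)) X Y"
    "quotient_functor C (?L \<inter> ?M) ?L k = g" "quotient_functor C (?L \<inter> ?M) ?M k = h (Suc n)"
    by (rule glue_pair[OF L M g(1) hM])
  have LM: "?L \<inter> ?M = Obj C \<inter> (\<Inter>i\<in>{1..Suc n}. Ls i)" by (auto simp: atLeastAtMostSuc_conv)
  have ka: "k \<in> Arr (quotient_category C (?L \<inter> ?M))" using k by (simp add: homset_def)
  have "quotient_functor C (?L \<inter> ?M) (Ls i) k = h i" if i: "i \<in> {1..Suc n}" for i
  proof (cases "i = Suc n")
    case False
    then have i': "i \<in> {1..n}" using i by auto
    have LI: "?L \<subseteq> Ls i" using i' by auto
    show ?thesis
      using quotient_functor_trans[OF stable_serre[OF stable_localizing_Int[OF L M]] sL stable_serre[OF st[OF i']] Int_lower1 LI ka]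
        k(2) g(2)[OF i'] by simp
  qed (use k in simp)
  then show ?case using k(1) unfolding LM by blast
qed

end

theorem theorem1p1:
  fixes U :: "'u itself" and C :: "('o, 'm) addcat"
  assumes "grothendieck_universe U"
    and "grothendieck_category U C"
  shows "sheaf_of_comm_rings
           (stable_localizing U C)
           (\<lambda>L2 L1. L1 \<subseteq> L2)
           (stable_covering U C)
           (localizing_join U C)
           (\<lambda>L. center (quotient_category C L))
           (center_restrict C)"
proof -
  interpret grothendieck_universe_category U C
    using assms by (simp add: grothendieck_universe_category_def grothendieck_universe_category_axioms_def)
  have cc: "center_restrict C L L' z X = quotient_functor C L L' (z X)" if "X \<in> Obj C" for L L' z X
    using that by (simp add: center_restrict_def)
  have presheaf: "presheaf_of_comm_rings (stable_localizing U C) (\<lambda>L2 L1. L1 \<subseteq> L2)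
      (\<lambda>L. center (quotient_category C L)) (center_restrict C)"
    unfolding presheaf_of_comm_rings_def
  proof (intro conjI ballI impI)
    fix L assume L: "L \<in> stable_localizing U C"
    interpret S: serre_quotient C L by (rule stable_serre[OF L])
    interpret Q: preadditive_category S.Q by (rule S.Q_preadditive)
    show "cring (center (quotient_category C L))" by (rule Q.center_cring)
    fix x assume x: "x \<in> carrier (center S.Q)"
    interpret P: serre_quotient_pair C L L by (rule S.pair_refl)
    show "center_restrict C L L x = x"
      by (rule Q.center_eqI[OF P.center_restrict_closed[OF x] x])
        (use Q.center_arr[OF x] in \<open>simp add: cc S.quotient_functor_refl\<close>)
  next
    fix L M assume "L \<in> stable_localizing U C" "M \<in> stable_localizing U C" "L \<subseteq> M"
    then interpret P: serre_quotient_pair C L M using serre_quotient_pairI stable_serre by blast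
    show "center_restrict C L M \<in> ring_hom (center (quotient_category C L)) (center (quotient_category C M))"
      by (rule P.center_restrict_ring_hom)
  next
    fix L M N x assume L: "L \<in> stable_localizing U C" and M: "M \<in> stable_localizing U C"
      and N: "N \<in> stable_localizing U C" and le: "L \<subseteq> M \<and> M \<subseteq> N"
      and x: "x \<in> carrier (center (quotient_category C L))"
    interpret S: serre_quotient C L by (rule stable_serre[OF L])
    interpret Q: preadditive_category S.Q by (rule S.Q_preadditive)
    show "center_restrict C M N (center_restrict C L M x) = center_restrict C L N x"
      unfolding center_restrict_def
      using quotient_functor_trans[OF L[THEN stable_serre] M[THEN stable_serre] N[THEN stable_serre]] le
        Q.center_arr(1)[OF x] by (auto simp: restrict_def fun_eq_iff)
  qed
  show ?thesis
    unfolding sheaf_of_comm_rings_def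
  proof (intro conjI presheaf ballI allI impI)
    fix L n and Ls :: "nat \<Rightarrow> 'o set" and x
    assume L: "L \<in> stable_localizing U C" and cov: "stable_covering U C L n Ls"
      and x: "(\<forall>i\<in>{1..n}. x i \<in> carrier (center (quotient_category C (Ls i)))) \<and>
        (\<forall>i\<in>{1..n}. \<forall>j\<in>{1..n}.
          center_restrict C (Ls i) (localizing_join U C (Ls i) (Ls j)) (x i) =
          center_restrict C (Ls j) (localizing_join U C (Ls i) (Ls j)) (x j))"
    have st: "Ls i \<in> stable_localizing U C" if "i \<in> {1..n}" for i using cov that by (simp add: stable_covering_def)
    have eL: "L = Obj C \<inter> (\<Inter>i\<in>{1..n}. Ls i)" using cov by (simp add: stable_covering_def)
    have xc: "x i \<in> carrier (center (quotient_category C (Ls i)))" if "i \<in> {1..n}" for i using x that by blast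
    note sL = stable_serre[OF L]
    have sLs: "serre_quotient C (Ls i)" if "i \<in> {1..n}" for i by (rule stable_serre[OF st[OF that]])
    have pair: "serre_quotient_pair C L (Ls i)" if "i \<in> {1..n}" for i
      by (rule serre_quotient_pairI[OF sL sLs[OF that]]) (use eL that in auto)
    interpret S: serre_quotient C L by (rule sL)
    interpret Q: preadditive_category S.Q by (rule S.Q_preadditive)
    have xA: "x i X \<in> Arr (quotient_category C (Ls i))" "Dom (quotient_category C (Ls i)) (x i X) = X"
      "Cod (quotient_category C (Ls i)) (x i X) = X" if i: "i \<in> {1..n}" "X \<in> Obj C" for i X
    proof -
      interpret Si: serre_quotient C "Ls i" by (rule sLs[OF i(1)])
      interpret Qi: preadditive_category Si.Q by (rule Si.Q_preadditive)
      show "x i X \<in> Arr (quotient_category C (Ls i))" "Dom (quotient_category C (Ls i)) (x i X) = X"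
        "Cod (quotient_category C (Ls i)) (x i X) = X" using Qi.center_arr[OF xc[OF i(1)]] i(2) by simp_all
    qed
    have faithful: "a = b" if "a \<in> Arr S.Q" "b \<in> Arr S.Q" "Dom S.Q a = Dom S.Q b" "Cod S.Q a = Cod S.Q b"
      "\<And>i. i \<in> {1..n} \<Longrightarrow> quotient_functor C L (Ls i) a = quotient_functor C L (Ls i) b" for a b
      by (rule quotient_functor_jointly_faithful[OF sL sLs eL that])
    have "\<exists>g \<in> homset S.Q X X. \<forall>i\<in>{1..n}. quotient_functor C L (Ls i) g = x i X" if X: "X \<in> Obj C" for X
      unfolding eL
    proof (rule glue_family[OF X X st])
      show "x i X \<in> homset (quotient_category C (Ls i)) X X" if "i \<in> {1..n}" for i
        using xA[OF that X] by (simp add: homset_def)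
      fix i j assume i: "i \<in> {1..n}" and j: "j \<in> {1..n}"
      have "center_restrict C (Ls i) (localizing_join U C (Ls i) (Ls j)) (x i) X =
          center_restrict C (Ls j) (localizing_join U C (Ls i) (Ls j)) (x j) X" using x i j by metis
      then show "quotient_functor C (Ls i) (localizing_join U C (Ls i) (Ls j)) (x i X) =
          quotient_functor C (Ls j) (localizing_join U C (Ls i) (Ls j)) (x j X)" using X by (simp add: cc)
    qed
    then obtain y0 where y0: "\<And>X. X \<in> Obj C \<Longrightarrow> y0 X \<in> homset S.Q X X"
      "\<And>X i. X \<in> Obj C \<Longrightarrow> i \<in> {1..n} \<Longrightarrow> quotient_functor C L (Ls i) (y0 X) = x i X" by metis
    \<comment> \<open>The restriction to \<open>Obj C\<close> makes \<open>y\<close> extensional, as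
      membership in \<open>center\<close> demands.\<close>
    define y where "y = (\<lambda>X\<in>Obj C. y0 X)"
    have yA: "y X \<in> Arr S.Q" "Dom S.Q (y X) = X" "Cod S.Q (y X) = X" if "X \<in> Obj C" for X
      using y0(1)[OF that] that by (simp_all add: y_def homset_def)
    have yx: "quotient_functor C L (Ls i) (y X) = x i X" if "X \<in> Obj C" "i \<in> {1..n}" for X i
      using y0(2)[OF that] that by (simp add: y_def)
    have "y (Cod S.Q a) \<cdot>\<^bsub>S.Q\<^esub> a = a \<cdot>\<^bsub>S.Q\<^esub> y (Dom S.Q a)" if a: "a \<in> Arr S.Q" for a
    proof -
      have O: "Dom S.Q a \<in> Obj C" "Cod S.Q a \<in> Obj C" using Q.obj_dom_cod[OF a] by simp_all
      show ?thesis
      proof (rule faithful)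
        fix i assume i: "i \<in> {1..n}"
        interpret P: serre_quotient_pair C L "Ls i" by (rule pair[OF i])
        interpret Qi: preadditive_category P.B.Q by (rule P.B.Q_preadditive)
        have "x i (Cod S.Q a) \<cdot>\<^bsub>P.B.Q\<^esub> P.F a = P.F a \<cdot>\<^bsub>P.B.Q\<^esub> x i (Dom S.Q a)"
          by (rule Qi.center_nat[OF xc[OF i]]) (use P.F_arr[OF a] in simp_all)
        then show "P.F (y (Cod S.Q a) \<cdot>\<^bsub>S.Q\<^esub> a) = P.F (a \<cdot>\<^bsub>S.Q\<^esub> y (Dom S.Q a))"
          using P.F_comp[of a "y (Cod S.Q a)"] P.F_comp[of "y (Dom S.Q a)" a] a O yA yx[OF _ i] by simp
      qed (use yA O a in simp_all)
    qed
    then have yc: "y \<in> carrier (center S.Q)"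
      using yA by (simp add: Q.center_carrier Q.in_hom y_def)
    have yr: "center_restrict C L (Ls i) y = x i" if i: "i \<in> {1..n}" for i
    proof -
      interpret P: serre_quotient_pair C L "Ls i" by (rule pair[OF i])
      interpret Qi: preadditive_category P.B.Q by (rule P.B.Q_preadditive)
      show ?thesis
        by (rule Qi.center_eqI[OF P.center_restrict_closed[OF yc] xc[OF i]]) (simp add: cc yx[OF _ i])
    qed
    show "\<exists>!y. y \<in> carrier (center (quotient_category C L)) \<and> (\<forall>i\<in>{1..n}. center_restrict C L (Ls i) y = x i)"
    proof (rule ex1I[of _ y])
      fix z assume z: "z \<in> carrier (center S.Q) \<and> (\<forall>i\<in>{1..n}. center_restrict C L (Ls i) z = x i)"
      then have zc: "z \<in> carrier (center S.Q)" by blast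
      show "z = y"
      proof (rule Q.center_eqI[OF zc yc])
        fix X assume "X \<in> Obj S.Q"
        then have X: "X \<in> Obj C" by simp
        show "z X = y X"
        proof (rule faithful)
          fix i assume i: "i \<in> {1..n}"
          have "center_restrict C L (Ls i) z X = x i X" using z i by simp
          then show "quotient_functor C L (Ls i) (z X) = quotient_functor C L (Ls i) (y X)"
            using cc[OF X] yx[OF X i] by simp
        qed (use Q.center_arr[OF zc] yA[OF X] X in simp_all)
      qed
    qed (use yc yr in simp)
  qed
qed

end
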